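(* Let $\Omega$ be a measurable space, let $(X_t)_{t\ge0}$ be a time-inhomogeneous Markov chain on $\Omega$ with initial distribution $\mu_0$ and Markov kernels $(P_t)_{t\ge1}$, and let $F_t:\Omega\to\mathsf{H}_m$, $t\ge1$, be measurable. Assume: (1) the quantities $\Delta_{\mathrm{op}}:=\sup_{t\ge1,\,x,y\in\Omega}\|F_t(x)-F_t(y)\|_{\mathrm{op}}$ and $\Delta_{\mathrm F}:=\sup_{t\ge1,\,x,y\in\Omega}\|F_t(x)-F_t(y)\|_{\mathrm F}$ belong to $(0,\infty)$; (2) there exists $\lambda\in(0,1]$ such that for every $t\ge1$ $$\sum_{k=1}^{t+1}\ \prod_{\ell=k}^{t}\sigma_\ell\ \le\ \frac1\lambda,$$ where an empty product equals $1$ and $\sigma_\ell$ is the one-step singular value of $P_\ell$. Let $v_B^2:=\frac{768}{\pi^2}\,\frac{\Delta_{\mathrm{op}}\Delta_{\mathrm F}}{\lambda}$. Then for every integer $n\ge1$ and every $\varepsilon\ge0$, $$\mathbb{P}_{\mu_0}\Big(\lambda_{\max}\Big(\sum_{j=1}^n (F_j(X_j)-\mathbb{E}F_j(X_j))\Big)\ge n\varepsilon\Big)\le m^{2-\pi/4}\exp\left(-\frac{n\varepsilon^2}{2v_B^2}\right).$$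
   Context: $\mathsf{H}_m$ is the set of $m\times m$ complex Hermitian matrices, $\lambda_{\max}$ the largest eigenvalue, $\|\cdot\|_{\mathrm{op}}$ the operator norm and $\|A\|_{\mathrm F}=\sqrt{\mathrm{tr}\,A^*A}$ the Frobenius norm. A time-inhomogeneous Markov chain with kernels $P_t$ satisfies $\mathbb{P}(X_t\in A\mid X_{t-1}=x)=P_t(x,A)$ for $t\ge1$; $\mathbb{P}_{\mu_0}$ and $\mathbb{E}$ refer to the path law with $X_0\sim\mu_0$. The law of $X_t$ is $\mu_t$, so $\mu_t=\mu_{t-1}P_t$. For a function $f$, $P_tf(x)=\int f(y)\,P_t(x,dy)$. One-step (second) singular value: for $t\ge1$, $$\sigma_t:=\sup\big\{\|P_tf\|_{2,\mu_{t-1}}:\ \|f\|_{2,\mu_t}=1,\ \mu_t(f)=0\big\},$$ where $\|f\|_{2,\nu}=(\int|f|^2d\nu)^{1/2}$ and $\mu_t(f)=\int f\,d\mu_t$; that is, $\sigma_t$ is the norm of $P_t$ as an operator from the mean-zero subspace of $L^2(\mu_t)$ to that of $L^2(\mu_{t-1})$. *)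

theory Defs
  imports "HOL-Probability.Probability"
begin

definition ctranspose :: "complex ^ 'n ^ 'm \<Rightarrow> complex ^ 'm ^ 'n" where
  "ctranspose A = (\<chi> i j. cnj (A $ j $ i))"

definition hermitian :: "complex ^ 'm ^ 'm \<Rightarrow> bool" where
  "hermitian A \<longleftrightarrow> ctranspose A = A"

definition frobenius_norm :: "complex ^ 'm ^ 'm \<Rightarrow> real" where
  "frobenius_norm A = sqrt (Re (trace (ctranspose A ** A)))"

text \<open>The norm on \<^typ>\<open>complex ^ 'm\<close> is the Euclidean one, so this is the spectral norm.\<close>

definition op_norm :: "complex ^ 'm ^ 'm \<Rightarrow> real" where
  "op_norm A = onorm (\<lambda>v. A *v v)"

text \<open>Only real eigenvalues are collected; for a Hermitian matrix these are all the
  eigenvalues, and they form a finite nonempty set.\<close>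

definition lambda_max :: "complex ^ 'm ^ 'm \<Rightarrow> real" where
  "lambda_max A = Max {r. \<exists>v. v \<noteq> 0 \<and> A *v v = complex_of_real r *s v}"

text \<open>The sigma-algebra generated by \<open>X 0, \<dots>, X t\<close>.\<close>

definition natural_sigma :: "'w measure \<Rightarrow> 'a measure \<Rightarrow> (nat \<Rightarrow> 'w \<Rightarrow> 'a) \<Rightarrow> nat \<Rightarrow> 'w measure" where
  "natural_sigma N M X t =
     sigma (space N) (\<Union>s\<in>{..t}. {X s -` A \<inter> space N | A. A \<in> sets M})"

text \<open>Kernels are indexed from 1: \<open>P t\<close> governs the step from time \<open>t - 1\<close> to time \<open>t\<close>,
  and \<open>P 0\<close> is irrelevant.\<close>

definition markov_chain ::
  "'w measure \<Rightarrow> 'a measure \<Rightarrow> 'a measure \<Rightarrow> (nat \<Rightarrow> 'a \<Rightarrow> 'a measure) \<Rightarrow> (nat \<Rightarrow> 'w \<Rightarrow> 'a) \<Rightarrow> bool" where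
  "markov_chain N M \<mu>0 P X \<longleftrightarrow>
     prob_space N \<and>
     (\<forall>t\<ge>1. P t \<in> M \<rightarrow>\<^sub>M prob_algebra M) \<and>
     (\<forall>t. X t \<in> N \<rightarrow>\<^sub>M M) \<and>
     distr N M (X 0) = \<mu>0 \<and>
     (\<forall>t\<ge>1. \<forall>A\<in>sets M.
        AE \<omega> in N. real_cond_exp N (natural_sigma N M X (t - 1))
                     (indicator (X t -` A \<inter> space N)) \<omega>
                   = measure (P t (X (t - 1) \<omega>)) A)"

definition kernel_op :: "('a \<Rightarrow> 'a measure) \<Rightarrow> ('a \<Rightarrow> complex) \<Rightarrow> 'a \<Rightarrow> complex" where
  "kernel_op K f x = (\<integral>y. f y \<partial>K x)"

definition L2_norm :: "'a measure \<Rightarrow> ('a \<Rightarrow> complex) \<Rightarrow> real" where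
  "L2_norm \<nu> f = sqrt (\<integral>x. (norm (f x))\<^sup>2 \<partial>\<nu>)"

text \<open>Here \<open>\<nu>\<close> is the law before and \<open>\<mu>\<close> the law after the step with kernel \<open>K\<close>. The set of norms
  is bounded above by 1 when \<open>\<mu> = \<nu>K\<close>. It is empty precisely when the mean-zero
  subspace of \<open>L\<^sup>2(\<mu>)\<close> is trivial; inserting 0 gives the operator norm 0 in that case
  and changes nothing otherwise.\<close>

definition singular_value :: "('a \<Rightarrow> 'a measure) \<Rightarrow> 'a measure \<Rightarrow> 'a measure \<Rightarrow> real" where
  "singular_value K \<nu> \<mu> = Sup (insert 0 {L2_norm \<nu> (kernel_op K f) | f.
     f \<in> borel_measurable \<mu> \<and> integrable \<mu> (\<lambda>x. (norm (f x))\<^sup>2) \<and>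
     L2_norm \<mu> f = 1 \<and> (\<integral>x. f x \<partial>\<mu>) = 0})"

definition chain_sigma ::
  "'w measure \<Rightarrow> 'a measure \<Rightarrow> (nat \<Rightarrow> 'a \<Rightarrow> 'a measure) \<Rightarrow> (nat \<Rightarrow> 'w \<Rightarrow> 'a) \<Rightarrow> nat \<Rightarrow> real" where
  "chain_sigma N M P X t = singular_value (P t) (distr N M (X (t - 1))) (distr N M (X t))"

text \<open>Diameters take values in \<^typ>\<open>ennreal\<close>, where the suprema always exist.\<close>

definition Delta_op :: "'a measure \<Rightarrow> (nat \<Rightarrow> 'a \<Rightarrow> complex ^ 'm ^ 'm) \<Rightarrow> ennreal" where
  "Delta_op M F = (SUP t\<in>{1..}. SUP x\<in>space M. SUP y\<in>space M. ennreal (op_norm (F t x - F t y)))"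

definition Delta_F :: "'a measure \<Rightarrow> (nat \<Rightarrow> 'a \<Rightarrow> complex ^ 'm ^ 'm) \<Rightarrow> ennreal" where
  "Delta_F M F = (SUP t\<in>{1..}. SUP x\<in>space M. SUP y\<in>space M. ennreal (frobenius_norm (F t x - F t y)))"

end

theory Submission
  imports Defs "HOL-Complex_Analysis.Cauchy_Integral_Formula"
begin

text \<open>The matrix sum is linearised by a product of simple factors, one for each time. For Hermitian
  matrices \<open>A\<^sub>j\<close> of operator norm at most \<open>\<beta> \<le> 1\<close> put
  \<open>G\<^sub>j(z) = (1 + \<beta>\<^sup>2 z\<^sup>2) I + z A\<^sub>j\<close> and let \<open>B(z) = G\<^sub>n(z) \<dots> G\<^sub>1(z)\<close>. Then \<open>B(0) = I\<close> and
  \<open>B'(0) = \<Sum> A\<^sub>j\<close>, so for a unit vector \<open>v\<close> with \<open>(\<Sum> A\<^sub>j) v = r v\<close> the function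
  \<open>f(z) = \<langle>v, B(z) v\<rangle>\<close> has \<open>f(0) = 1\<close> and \<open>f'(0) = r\<close>. The quadratic term makes every factor a
  contraction on the imaginary segment \<open>[-\<i>, \<i>]\<close>, as \<open>exp (z A\<^sub>j)\<close> would be. A Carleman formula on the
  right half of the unit disk (\<open>exp_deriv_le_arc_mean\<close>, applied to \<open>f\<^sup>2\<close>) therefore bounds
  \<open>exp (\<pi> r / 2)\<close> by the mean of \<open>\<parallel>B(exp (\<i>\<phi>))\<parallel>\<^sup>2\<close> over \<open>\<bar>\<phi>\<bar> \<le> \<pi>/2\<close> with weight \<open>cos \<phi> / 2\<close>,
  where the norm is the Frobenius norm (\<open>exp_eigenvalue_le_arc_mean\<close>). This plays the role of a
  multi-matrix Golden-Thompson inequality for the largest eigenvalue.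

  It remains to bound the expectation of \<open>\<parallel>B(z)\<parallel>\<^sup>2\<close> for \<open>\<bar>z\<bar> = 1\<close> when \<open>A\<^sub>j\<close> is a multiple of the
  centred matrix \<open>F\<^sub>j(X\<^sub>j) - \<E> F\<^sub>j(X\<^sub>j)\<close>. More generally, one follows the expectation of
  \<open>g(X\<^sub>t) \<bullet> B\<^sub>t B\<^sub>t*\<close> for a matrix-valued function \<open>g\<close>, where \<open>B\<^sub>t\<close> contains the first \<open>t\<close> factors.
  By the Markov property the value for \<open>g\<close> at time \<open>t + 1\<close> is the value at time \<open>t\<close> for the
  kernel mean of \<open>G* g G\<close>. Split \<open>g\<close> into its mean and its deviation from the mean. As the \<open>A\<^sub>j\<close> have
  mean zero, one step multiplies the mean by \<open>1 + O(\<beta>\<^sup>2)\<close>, while mean and deviation feed into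
  each other with weight \<open>O(\<beta>)\<close>, and every new deviation is multiplied by the singular value
  \<open>\<sigma>\<close> (\<open>one_step_bounds\<close>). The sums \<open>S\<^sub>t\<close> of the gap condition satisfy
  \<open>S\<^sub>t\<^sub>+\<^sub>1 = 1 + \<sigma>\<^sub>t\<^sub>+\<^sub>1 S\<^sub>t\<close>, which makes mean \<open>+ K S\<^sub>t\<close> deviation, with \<open>K\<close> of order \<open>\<beta>\<close>, a potential that
  grows in each step by at most a factor \<open>exp (16 \<beta>\<^sup>2 / \<lambda>)\<close> as long as \<open>\<beta> / \<lambda>\<close> is small
  (\<open>potential_step\<close>, \<open>growth_rate_le\<close>). Hence the expectation of \<open>\<parallel>B\<parallel>\<^sup>2\<close> is at most
  \<open>m exp (16 n \<beta>\<^sup>2 / \<lambda>)\<close>.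

  Markov's inequality and a choice of \<open>\<beta>\<close> proportional to \<open>\<epsilon>\<close> give the tail bound with the
  prefactor \<open>m\<close>, which is at most \<open>m powr (2 - \<pi>/4)\<close>, and with the variance proxy
  \<open>\<Delta>\<^sub>o\<^sub>p\<^sup>2 / \<lambda>\<close>, which is dominated by \<open>\<Delta>\<^sub>o\<^sub>p \<Delta>\<^sub>F / \<lambda>\<close> because the operator norm is at most the
  Frobenius norm.\<close>

section \<open>Carleman's formula on the half disk\<close>

text \<open>The function \<open>(g(z) - 1) (1 + 1 / z\<^sup>2)\<close> has a removable singularity at 0, so its integral
  over the half circle from \<open>-\<i>\<close> to \<open>\<i>\<close> equals that over the segment between these points. On the
  circle \<open>1 + 1 / z\<^sup>2\<close> contributes the weight \<open>2 cos t\<close>, on the segment \<open>z = \<i> y\<close> the weight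
  \<open>1 - 1 / y\<^sup>2 \<le> 0\<close>, against which \<open>Re g - 1 \<le> 0\<close> integrates to something nonnegative.\<close>

lemma half_disk_mean_ge:
  fixes g :: "complex \<Rightarrow> complex" and R :: real
  assumes R: "R > 1" and holo: "g holomorphic_on ball 0 R"
    and g0: "g 0 = 1" and dg0: "deriv g 0 = 0"
    and axis: "\<And>y. \<bar>y\<bar> \<le> 1 \<Longrightarrow> Re (g (\<i> * of_real y)) \<le> 1"
  shows "2 \<le> integral {-pi/2..pi/2} (\<lambda>t. Re (g (cis t)) * cos t)"
proof -
  \<comment> \<open>\<open>h z = (g z - 1) / z\<^sup>2\<close>, built by removing one zero at a time\<close>
  define k where "k z = (if z = 0 then deriv g 0 else (g z - g 0) / (z - 0))" for z
  define h where "h z = (if z = 0 then deriv k 0 else (k z - k 0) / (z - 0))" for z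
  have "k holomorphic_on ball 0 R"
    unfolding k_def by (rule pole_lemma_open[OF holo]) auto
  then have "h holomorphic_on ball 0 R"
    unfolding h_def by (rule pole_lemma_open) auto
  then have "(\<lambda>z. h z * (1 + z\<^sup>2)) holomorphic_on ball 0 R"
    by (intro holomorphic_intros)
  then obtain H where H: "\<And>z. z \<in> ball 0 R \<Longrightarrow>
      (H has_field_derivative h z * (1 + z\<^sup>2)) (at z within ball 0 R)"
    using holomorphic_convex_primitive'[OF convex_ball open_ball] by blast
  have H': "(H has_field_derivative h z * (1 + z\<^sup>2)) (at z)" if "norm z < R" for z
    using H[of z] that by (simp add: at_within_open[of z "ball 0 R"])
  have h_eq: "h z = (g z - 1) / z\<^sup>2" if "z \<noteq> 0" for z
    using that by (simp add: h_def k_def g0 dg0 power2_eq_square)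
  have arc: "((\<lambda>t. (g (cis t) - 1) * (2 * \<i> * of_real (cos t))) has_integral
      H (cis (pi/2)) - H (cis (-pi/2))) {-pi/2..pi/2}"
  proof (rule fundamental_theorem_of_calculus)
    fix t assume "t \<in> {-pi/2..pi/2}"
    have *: "(cis has_vector_derivative \<i> * cis t) (at t within {-pi/2..pi/2})"
      by (auto intro!: derivative_eq_intros simp: cis_conv_exp has_vector_derivative_def
          scaleR_conv_of_real fun_eq_iff algebra_simps intro: has_derivative_eq_rhs)
    have "((H \<circ> cis) has_vector_derivative (\<i> * cis t) * (h (cis t) * (1 + (cis t)\<^sup>2)))
        (at t within {-pi/2..pi/2})"
      by (rule field_vector_diff_chain_within[OF *]) 
         (use H'[of "cis t"] R in \<open>auto intro: has_field_derivative_at_within\<close>)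
    moreover have "(\<i> * cis t) * (h (cis t) * (1 + (cis t)\<^sup>2)) =
        (g (cis t) - 1) * (2 * \<i> * of_real (cos t))"
    proof -
      have "cis t * (1 + (cis t)\<^sup>2) = (cis t)\<^sup>2 * (2 * of_real (cos t))"
      proof -
        have "1 + (cis t)\<^sup>2 = cis t * (2 * of_real (cos t))"
          using sin_cos_squared_add[of t] by (auto simp: complex_eq_iff power2_eq_square algebra_simps)
        then show ?thesis by (simp add: power2_eq_square)
      qed
      moreover have "(\<i> * cis t) * (h (cis t) * (1 + (cis t)\<^sup>2)) =
          \<i> * ((g (cis t) - 1) / (cis t)\<^sup>2) * (cis t * (1 + (cis t)\<^sup>2))"
        by (simp add: h_eq)
      ultimately show ?thesis by simp
    qed
    ultimately show "((\<lambda>t. H (cis t)) has_vector_derivative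
        (g (cis t) - 1) * (2 * \<i> * of_real (cos t))) (at t within {-pi/2..pi/2})"
      by (simp add: o_def)
  qed simp
  have seg: "((\<lambda>y. \<i> * (h (\<i> * of_real y) * (1 + (\<i> * of_real y)\<^sup>2))) has_integral
      H (\<i> * of_real 1) - H (\<i> * of_real (-1))) {-1..1::real}"
  proof (rule fundamental_theorem_of_calculus)
    fix y :: real assume y: "y \<in> {-1..1}"
    have *: "((\<lambda>y. \<i> * of_real y) has_vector_derivative \<i>) (at y within {-1..1})"
      by (auto intro!: derivative_eq_intros)
    have "((H \<circ> (\<lambda>y. \<i> * of_real y)) has_vector_derivative
        \<i> * (h (\<i> * of_real y) * (1 + (\<i> * of_real y)\<^sup>2))) (at y within {-1..1})"
      by (rule field_vector_diff_chain_within[OF *]) 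
         (use H'[of "\<i> * of_real y"] R y in \<open>auto intro: has_field_derivative_at_within simp: norm_mult\<close>)
    then show "((\<lambda>y. H (\<i> * of_real y)) has_vector_derivative
        \<i> * (h (\<i> * of_real y) * (1 + (\<i> * of_real y)\<^sup>2))) (at y within {-1..1})"
      by (simp add: o_def)
  qed simp
  have "0 \<le> Im (H \<i> - H (-\<i>))"
  proof (rule has_integral_nonneg)
    \<comment> \<open>the sign of the integrand is known away from the single point \<open>y = 0\<close>\<close>
    define q where "q y = (if y = 0 then 0 else Im (\<i> * (h (\<i> * of_real y) * (1 + (\<i> * of_real y)\<^sup>2))))"
      for y :: real
    have "((\<lambda>y. Im (\<i> * (h (\<i> * of_real y) * (1 + (\<i> * of_real y)\<^sup>2)))) has_integral
      Im (H \<i> - H (-\<i>))) {-1..1::real}"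
      using has_integral_linear[OF seg bounded_linear_Im] by (simp add: o_def)
    then show "(q has_integral Im (H \<i> - H (-\<i>))) {-1..1}"
      by (rule has_integral_spike_finite[of "{0}", rotated -1]) (auto simp: q_def)
    fix y :: real assume y: "y \<in> {-1..1}"
    show "0 \<le> q y"
    proof (cases "y = 0")
      case False
      have "\<i> * (h (\<i> * of_real y) * (1 + (\<i> * of_real y)\<^sup>2)) =
          \<i> * ((1 - g (\<i> * of_real y)) * of_real ((1 - y\<^sup>2) / y\<^sup>2))"
        using False by (simp add: h_eq power_mult_distrib field_simps)
      then have "q y = (1 - Re (g (\<i> * of_real y))) * ((1 - y\<^sup>2) / y\<^sup>2)"
        using False by (simp add: q_def)
      moreover have "y\<^sup>2 \<le> 1" using y by (simp add: abs_square_le_1 abs_le_iff)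
      moreover have "Re (g (\<i> * of_real y)) \<le> 1" using axis[of y] y by auto
      ultimately show ?thesis by (simp add: mult_nonneg_nonneg)
    qed (simp add: q_def)
  qed
  have "((\<lambda>t. 2 * ((Re (g (cis t)) - 1) * cos t)) has_integral Im (H \<i> - H (-\<i>))) {-pi/2..pi/2}"
  proof -
    have "cis (- pi / 2) = - \<i>" by (simp add: complex_eq_iff)
    then show ?thesis
      using has_integral_linear[OF arc bounded_linear_Im] by (simp add: o_def algebra_simps)
  qed
  from has_integral_divide[OF this, of 2]
  have "((\<lambda>t. (Re (g (cis t)) - 1) * cos t) has_integral Im (H \<i> - H (-\<i>)) / 2) {-pi/2..pi/2}"
    by simp
  moreover have "(cos has_integral (sin (pi/2) - sin (-pi/2))) {-pi/2..pi/2}"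
    by (rule fundamental_theorem_of_calculus)
       (auto intro!: derivative_eq_intros simp: has_real_derivative_iff_has_vector_derivative[symmetric])
  ultimately have "((\<lambda>t. Re (g (cis t)) * cos t) has_integral Im (H \<i> - H (-\<i>)) / 2 + 2) {-pi/2..pi/2}"
    using has_integral_add[of "\<lambda>t. (Re (g (cis t)) - 1) * cos t" "Im (H \<i> - H (-\<i>)) / 2" "{-pi/2..pi/2}" cos 2]
    by (simp add: algebra_simps)
  then show ?thesis using \<open>0 \<le> Im (H \<i> - H (-\<i>))\<close> by (simp add: integral_unique)
qed

text \<open>The real part of \<open>Arctan\<close> is a multiple of the harmonic measure of the half circle in the half
  disk: it vanishes on the imaginary segment and equals \<open>\<pi>/4\<close> on the open half circle.\<close>

lemma Re_Arctan_imaginary: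
  assumes "\<bar>y\<bar> < 1" shows "Re (Arctan (\<i> * of_real y)) = 0"
proof -
  have e: "(1 - \<i> * (\<i> * of_real y)) / (1 + \<i> * (\<i> * of_real y)) = complex_of_real ((1 + y) / (1 - y))"
    by (simp add: mult.assoc[symmetric])
  have "(1 + y) / (1 - y) > 0" using assms by auto
  then show ?thesis unfolding Arctan_def e
    by (subst Ln_of_real) auto
qed

lemma Re_Arctan_cis:
  assumes "\<bar>t\<bar> < pi/2" shows "Re (Arctan (cis t)) = pi/4"
proof -
  have c: "cos t > 0" using assms by (intro cos_gt_zero_pi) auto
  have nz: "1 + \<i> * cis t \<noteq> 0" using c by (auto simp: complex_eq_iff)
  have s: "sin t < 1"
  proof -
    have "(sin t)\<^sup>2 < 1" using c sin_cos_squared_add[of t] zero_less_power[OF c, of 2] by linarith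
    then show ?thesis by (metis abs_square_less_1 abs_less_iff)
  qed
  have "(1 - \<i> * cis t) = (1 + \<i> * cis t) * (-\<i> * of_real (cos t / (1 - sin t)))"
    using s sin_cos_squared_add[of t] by (auto simp: complex_eq_iff field_simps power2_eq_square)
  then have "(1 - \<i> * cis t) / (1 + \<i> * cis t) = (-\<i> * of_real (cos t / (1 - sin t)))"
    using nz by (simp add: field_simps)
  moreover define r where "r = cos t / (1 - sin t)"
  moreover have "r > 0" using c s by (simp add: r_def)
  then have "Ln (-\<i> * of_real r) = of_real (ln r) - \<i> * of_real (pi/2)"
    using Ln_times_of_real[of r "-\<i>"] Ln_of_real[of r] by (simp add: mult.commute)
  ultimately have "Arctan (cis t) = \<i>/2 * (of_real (ln r) - \<i> * of_real (pi/2))"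
    unfolding Arctan_def by metis
  also have "\<dots> = Complex (pi/4) (ln r / 2)" by (simp add: complex_eq_iff)
  finally show ?thesis by simp
qed

text \<open>Dividing \<open>f\<close> by \<open>exp (a Arctan z)\<close> cancels its derivative at 0, leaves its modulus on the imaginary
  segment unchanged and divides its modulus on the half circle by the constant \<open>exp (\<pi> a / 4)\<close>.
  The previous mean value inequality then gives the claim, without taking a logarithm of \<open>f\<close>,
  which may have zeros.\<close>

lemma exp_deriv_le_arc_mean:
  fixes f :: "complex \<Rightarrow> complex" and a :: real
  assumes holo: "f holomorphic_on UNIV" and f0: "f 0 = 1"
    and df0: "(f has_field_derivative of_real a) (at 0)"
    and axis: "\<And>y. \<bar>y\<bar> \<le> 1 \<Longrightarrow> norm (f (\<i> * of_real y)) \<le> 1"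
  shows "exp (pi * a / 4) \<le> integral {-pi/2..pi/2} (\<lambda>t. norm (f (cis t)) * (cos t / 2))"
proof -
  have cf: "continuous_on UNIV f" using holo by (rule holomorphic_on_imp_continuous_on)
  \<comment> \<open>\<open>Arctan\<close> is singular at \<open>\<plusminus>\<i>\<close>, so it is replaced by \<open>R Arctan (z / R)\<close>, which is
    holomorphic near the closed half disk, and \<open>R\<close> tends to 1 by dominated convergence\<close>
  define R :: "nat \<Rightarrow> real" where "R n = 1 + 1 / real (Suc n)" for n
  have R1: "R n > 1" for n by (simp add: R_def)
  define q where "q n z = of_real (a * R n) * Arctan (z / of_real (R n))" for n z
  have slit: "Re (z / of_real (R n)) = 0 \<Longrightarrow> \<bar>Im (z / of_real (R n))\<bar> < 1" if "norm z < R n" for z n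
  proof -
    have "\<bar>Im z\<bar> < R n" using that abs_Im_le_cmod[of z] by linarith
    then show ?thesis using R1[of n] by (simp add: divide_simps abs_if split: if_splits)
  qed
  have lower: "2 \<le> integral {-pi/2..pi/2} (\<lambda>t. norm (f (cis t)) * exp (- Re (q n (cis t))) * cos t)"
    for n
  proof -
    define g where "g z = f z * exp (- q n z)" for z
    have R: "R n \<noteq> 0" using R1[of n] by simp
    have hA: "(\<lambda>z. Arctan (z / of_real (R n))) holomorphic_on ball 0 (R n)"
    proof -
      have "Arctan holomorphic_on ((\<lambda>z. z / of_real (R n)) ` ball 0 (R n))"
        by (rule holomorphic_on_Arctan) (use slit in auto)
      then have "(Arctan \<circ> (\<lambda>z. z / of_real (R n))) holomorphic_on ball 0 (R n)"
        using R by (intro holomorphic_on_compose holomorphic_intros) auto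
      then show ?thesis
        by (simp add: o_def)
    qed
    have hg: "g holomorphic_on ball 0 (R n)"
      unfolding g_def q_def using hA holo
      by (intro holomorphic_intros holomorphic_on_subset[OF holo]) (use R in auto)
    have "((\<lambda>z. Arctan (z / of_real (R n))) has_field_derivative 1 / of_real (R n)) (at 0)"
      using R by (auto intro!: derivative_eq_intros)
    then have dq: "(q n has_field_derivative of_real a) (at 0)"
      unfolding q_def using R by (auto intro!: derivative_eq_intros)
    have q0: "q n 0 = 0" by (simp add: q_def)
    have dg: "(g has_field_derivative 0) (at 0)"
      unfolding g_def by (rule derivative_eq_intros df0 dq refl)+ (simp add: f0 q0)
    have "2 \<le> integral {-pi/2..pi/2} (\<lambda>t. Re (g (cis t)) * cos t)"
    proof (rule half_disk_mean_ge[OF R1 hg])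
      show "g 0 = 1" by (simp add: g_def f0 q0)
      show "deriv g 0 = 0" using dg by (rule DERIV_imp_deriv)
      fix y :: real assume y: "\<bar>y\<bar> \<le> 1"
      have "\<bar>y / R n\<bar> < 1" using y R1[of n] by (simp add: abs_if field_simps split: if_splits)
      then have "Re (q n (\<i> * of_real y)) = 0"
        using Re_Arctan_imaginary[of "y / R n"] by (simp add: q_def)
      then have "norm (g (\<i> * of_real y)) \<le> 1"
        using axis[OF y] by (simp add: g_def norm_mult)
      then show "Re (g (\<i> * of_real y)) \<le> 1" using complex_Re_le_cmod order_trans by blast
    qed
    also have "\<dots> \<le> integral {-pi/2..pi/2} (\<lambda>t. norm (g (cis t)) * cos t)"
    proof (rule integral_le)
      have c: "continuous_on {-pi/2..pi/2} (\<lambda>t. g (cis t))"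
        by (rule continuous_on_compose2[OF holomorphic_on_imp_continuous_on[OF hg]])
           (use R1[of n] in \<open>auto simp: cis_conv_exp intro!: continuous_intros\<close>)
      show "(\<lambda>t. Re (g (cis t)) * cos t) integrable_on {-pi/2..pi/2}"
        "(\<lambda>t. norm (g (cis t)) * cos t) integrable_on {-pi/2..pi/2}"
        by (intro integrable_continuous_real continuous_intros c)+
      fix t assume "t \<in> {-pi/2..pi/2}"
      then have "cos t \<ge> 0" by (intro cos_ge_zero) auto
      then show "Re (g (cis t)) * cos t \<le> norm (g (cis t)) * cos t"
        by (intro mult_right_mono complex_Re_le_cmod)
    qed
    finally show ?thesis by (simp add: g_def norm_mult)
  qed
  define G where "G t = norm (f (cis t)) * exp (- (pi * a / 4)) * cos t" for t
  have lim: "(\<lambda>n. norm (f (cis t)) * exp (- Re (q n (cis t))) * cos t) \<longlonglongrightarrow> G t"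
    if t: "t \<in> {-pi/2..pi/2}" for t
  proof (cases "\<bar>t\<bar> < pi/2")
    case True
    have R1': "R \<longlonglongrightarrow> 1" unfolding R_def
      using tendsto_add[OF tendsto_const LIMSEQ_inverse_real_of_nat, of 1] by (simp add: field_simps)
    have "cos t > 0" using True by (intro cos_gt_zero_pi) auto
    then have "isCont Arctan (cis t)" by (intro continuous_at_Arctan) auto
    moreover have "(\<lambda>n. cis t / of_real (R n)) \<longlonglongrightarrow> cis t"
      using tendsto_divide[OF tendsto_const[of "cis t"] tendsto_of_real[OF R1']] by simp
    ultimately have "(\<lambda>n. Arctan (cis t / of_real (R n))) \<longlonglongrightarrow> Arctan (cis t)"
      by (rule isCont_tendsto_compose)
    then have "(\<lambda>n. Re (q n (cis t))) \<longlonglongrightarrow> Re (of_real (a * 1) * Arctan (cis t))"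
      unfolding q_def by (intro tendsto_intros R1')
    then have "(\<lambda>n. Re (q n (cis t))) \<longlonglongrightarrow> pi * a / 4"
      using Re_Arctan_cis[OF True] by (simp add: mult.commute)
    then show ?thesis unfolding G_def by (intro tendsto_intros)
  next
    case False
    then have "t = pi/2 \<or> t = -pi/2" using t by auto
    then have "cos t = 0" using cos_pi_half by fastforce
    then show ?thesis by (simp add: G_def)
  qed
  have int: "(\<lambda>t. norm (f (cis t)) * exp (- Re (q n (cis t))) * cos t) integrable_on {-pi/2..pi/2}" for n
  proof -
    have "continuous_on {-pi/2..pi/2} (\<lambda>t. f (cis t))"
      by (rule continuous_on_compose2[OF cf]) (auto simp: cis_conv_exp intro!: continuous_intros)
    moreover have "continuous_on {-pi/2..pi/2} (\<lambda>t. Arctan (cis t / of_real (R n)))"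
      by (rule continuous_on_compose2[OF continuous_on_Arctan[of "(\<lambda>t. cis t / of_real (R n)) ` {-pi/2..pi/2}"]])
         (use slit[of "cis _" n] R1[of n] in \<open>auto intro!: continuous_intros\<close>)
    ultimately show ?thesis unfolding q_def
      by (intro integrable_continuous_real continuous_intros)
  qed
  obtain B where B: "\<And>z. z \<in> sphere 0 1 \<Longrightarrow> norm (f z) \<le> B"
    using compact_imp_bounded[OF compact_continuous_image[OF continuous_on_subset[OF cf] compact_sphere]]
    unfolding bounded_iff by (metis image_eqI subset_UNIV)
  have bd: "norm (norm (f (cis t)) * exp (- Re (q n (cis t))) * cos t) \<le> B * exp (\<bar>a\<bar> * 2 * (pi/2))"
    for t n
  proof -
    have R2: "R n \<le> 2" by (simp add: R_def)
    have "\<bar>Re (Arctan (cis t / of_real (R n)))\<bar> \<le> pi/2"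
      using Re_Arctan_bounds[of "cis t / of_real (R n)"] slit[of "cis t" n] R1[of n] by force
    moreover have "\<bar>a * R n\<bar> \<le> \<bar>a\<bar> * 2"
      using R1[of n] R2 by (auto simp: abs_mult intro!: mult_left_mono)
    ultimately have "\<bar>a * R n\<bar> * \<bar>Re (Arctan (cis t / of_real (R n)))\<bar> \<le> (\<bar>a\<bar> * 2) * (pi/2)"
      by (intro mult_mono) auto
    then have "\<bar>Re (q n (cis t))\<bar> \<le> (\<bar>a\<bar> * 2) * (pi/2)"
      by (simp add: q_def abs_mult)
    then have "exp (- Re (q n (cis t))) \<le> exp (\<bar>a\<bar> * 2 * (pi/2))" by simp
    moreover have "norm (f (cis t)) \<le> B" by (rule B) simp
    ultimately have "(norm (f (cis t)) * exp (- Re (q n (cis t)))) * \<bar>cos t\<bar> \<le> (B * exp (\<bar>a\<bar> * 2 * (pi/2))) * 1"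
      using order_trans[OF norm_ge_zero \<open>norm (f (cis t)) \<le> B\<close>] by (intro mult_mono) auto
    then show ?thesis by (simp add: abs_mult)
  qed
  have "G integrable_on {-pi/2..pi/2}"
    and conv: "(\<lambda>n. integral {-pi/2..pi/2} (\<lambda>t. norm (f (cis t)) * exp (- Re (q n (cis t))) * cos t))
      \<longlonglongrightarrow> integral {-pi/2..pi/2} G"
    using dominated_convergence[OF int integrable_const_ivl bd lim] by blast+
  have "2 \<le> integral {-pi/2..pi/2} G"
    by (rule LIMSEQ_le_const[OF conv]) (use lower in blast)
  also have "G = (\<lambda>t. 2 * exp (- (pi * a / 4)) * (norm (f (cis t)) * (cos t / 2)))"
    by (simp add: G_def fun_eq_iff)
  also have "integral {-pi/2..pi/2} \<dots> = 2 * exp (- (pi * a / 4)) * integral {-pi/2..pi/2} (\<lambda>t. norm (f (cis t)) * (cos t / 2))"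
    by (rule integral_mult_right)
  finally show ?thesis by (simp add: exp_minus field_simps)
qed

section \<open>Complex matrices and Hermitian eigenvalues\<close>

text \<open>Multiplication of a matrix by a complex scalar; \<open>*\<^sub>R\<close> covers the real scalars.\<close>

definition cscale :: "complex \<Rightarrow> complex ^ 'n ^ 'm \<Rightarrow> complex ^ 'n ^ 'm" where
  "cscale c A = (\<chi> i j. c * A $ i $ j)"

lemma cscale_nth [simp]: "cscale c A $ i $ j = c * A $ i $ j"
  by (simp add: cscale_def)

lemma cscale_mult_left: "cscale c A ** B = cscale c (A ** B)"
  by (simp add: cscale_def matrix_matrix_mult_def vec_eq_iff sum_distrib_left mult.assoc)

lemma cscale_mult_right: "A ** cscale c B = cscale c (A ** B)"
  by (simp add: cscale_def matrix_matrix_mult_def vec_eq_iff sum_distrib_left mult_ac)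

lemma matrix_add_rdistrib: "(A + B) ** C = A ** C + B ** C"
  for A B :: "complex ^ 'n ^ 'm"
  by (simp add: matrix_matrix_mult_def vec_eq_iff sum.distrib distrib_right)

lemma cscale_mult_vec: "cscale c A *v x = c *s (A *v x)"
  by (simp add: cscale_def matrix_vector_mult_def vec_eq_iff sum_distrib_left mult.assoc)

lemma cscale_cscale: "cscale c (cscale d A) = cscale (c * d) A"
  by (simp add: vec_eq_iff)

lemma cscale_add: "cscale c (A + B) = cscale c A + cscale c B"
  by (simp add: vec_eq_iff algebra_simps)

lemma norm_cscale: "norm (cscale c A) = norm c * norm A"
proof -
  have "norm (cscale c A $ i) = norm c * norm (A $ i)" for i
    by (simp add: cscale_def norm_vec_def norm_mult L2_set_right_distrib)
  then show ?thesis
    unfolding norm_vec_def[of "cscale c A"] norm_vec_def[of A] by (simp add: L2_set_right_distrib)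
qed

lemma norm_scalar_mult_vec: "norm (c *s (x :: complex ^ 'n)) = norm c * norm x"
  by (simp add: norm_vec_def norm_mult L2_set_right_distrib)

lemma of_real_scalar_mult_vec: "complex_of_real r *s (v :: complex ^ 'n) = r *\<^sub>R v"
  by (simp only: vec_eq_iff vector_smult_component vector_scaleR_component)
     (simp add: scaleR_conv_of_real)

lemma ctranspose_nth [simp]: "ctranspose A $ i $ j = cnj (A $ j $ i)"
  by (simp add: ctranspose_def)

lemma ctranspose_mult: "ctranspose (A ** B) = ctranspose B ** ctranspose A"
  by (simp add: vec_eq_iff matrix_matrix_mult_def mult.commute)

lemma ctranspose_ctranspose [simp]: "ctranspose (ctranspose A) = A"
  by (simp add: vec_eq_iff)

lemma ctranspose_add: "ctranspose (A + B) = ctranspose A + ctranspose B"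
  by (simp add: vec_eq_iff)

lemma ctranspose_cscale: "ctranspose (cscale c A) = cscale (cnj c) (ctranspose A)"
  by (simp add: vec_eq_iff)

lemma ctranspose_mat_1 [simp]: "ctranspose (mat 1) = mat 1"
  by (simp add: vec_eq_iff mat_def)

text \<open>The Euclidean inner product on complex matrices is the real part of the Hilbert-Schmidt inner
  product. This makes left and right multiplication by \<open>A\<close> adjoint to multiplication by the
  conjugate transpose of \<open>A\<close>, and it identifies the Frobenius norm with the Euclidean norm.\<close>

lemma inner_matrix_eq_trace: "X \<bullet> Y = Re (trace (ctranspose X ** Y))"
  for X Y :: "complex ^ 'm ^ 'm"
proof -
  have "X \<bullet> Y = (\<Sum>i\<in>UNIV. \<Sum>j\<in>UNIV. Re (cnj (X $ i $ j) * Y $ i $ j))"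
    by (simp add: inner_vec_def inner_complex_def)
  also have "\<dots> = (\<Sum>j\<in>UNIV. \<Sum>i\<in>UNIV. Re (cnj (X $ i $ j) * Y $ i $ j))"
    by (rule sum.swap)
  finally show ?thesis by (simp add: trace_def matrix_matrix_mult_def)
qed

lemma frobenius_norm_eq_norm: "frobenius_norm A = norm A"
  unfolding frobenius_norm_def norm_eq_sqrt_inner inner_matrix_eq_trace ..

lemma inner_mult_left: "(A ** X) \<bullet> Y = X \<bullet> (ctranspose A ** Y)"
  for A X Y :: "complex ^ 'm ^ 'm"
  by (simp add: inner_matrix_eq_trace ctranspose_mult matrix_mul_assoc)

lemma inner_mult_right: "(X ** A) \<bullet> Y = X \<bullet> (Y ** ctranspose A)"
  for A X Y :: "complex ^ 'm ^ 'm"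
  by (metis inner_matrix_eq_trace ctranspose_mult matrix_mul_assoc trace_mul_sym)

lemma norm_ctranspose: "norm (ctranspose A) = norm A" for A :: "complex ^ 'm ^ 'm"
  by (simp add: norm_eq_sqrt_inner inner_matrix_eq_trace trace_mul_sym[of A "ctranspose A"])

lemma inner_matrix_vector_mult: "(A *v x) \<bullet> y = x \<bullet> (ctranspose A *v y)"
  for A :: "complex ^ 'm ^ 'm"
proof -
  have re: "a \<bullet> b = Re (cnj a * b)" for a b :: complex
    by (simp add: inner_complex_def)
  have "(A *v x) \<bullet> y = (\<Sum>i\<in>UNIV. \<Sum>j\<in>UNIV. Re (cnj (A $ i $ j) * cnj (x $ j) * y $ i))"
    unfolding inner_vec_def re matrix_vector_mult_def
    by (simp only: vec_lambda_beta cnj_sum complex_cnj_mult sum_distrib_right Re_sum)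
  also have "\<dots> = (\<Sum>j\<in>UNIV. \<Sum>i\<in>UNIV. Re (cnj (A $ i $ j) * cnj (x $ j) * y $ i))"
    by (rule sum.swap)
  also have "\<dots> = x \<bullet> (ctranspose A *v y)"
    unfolding inner_vec_def re matrix_vector_mult_def
    by (simp only: vec_lambda_beta sum_distrib_left Re_sum ctranspose_nth mult_ac)
  finally show ?thesis .
qed

lemma bounded_linear_matrix_vector: "bounded_linear (\<lambda>v. A *v v)" for A :: "complex ^ 'm ^ 'm"
proof -
  have "linear (\<lambda>v. A *v v)"
  proof (rule linearI)
    show "A *v (x + y) = A *v x + A *v y" for x y by (rule matrix_vector_right_distrib)
    show "A *v (r *\<^sub>R x) = r *\<^sub>R (A *v x)" for r x
      by (simp add: matrix_vector_mult_def vec_eq_iff scaleR_sum_right)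
  qed
  then show ?thesis by (rule linear_conv_bounded_linear[THEN iffD1])
qed

lemma norm_matrix_vector_le: "norm (A *v v) \<le> op_norm A * norm v" for A :: "complex ^ 'm ^ 'm"
  unfolding op_norm_def by (rule onorm[OF bounded_linear_matrix_vector])

lemma op_norm_le: "(\<And>v. norm (A *v v) \<le> b * norm v) \<Longrightarrow> op_norm A \<le> b" for A :: "complex ^ 'm ^ 'm"
  unfolding op_norm_def by (rule onorm_le)

lemma op_norm_nonneg: "0 \<le> op_norm A" for A :: "complex ^ 'm ^ 'm"
  unfolding op_norm_def by (rule onorm_pos_le[OF bounded_linear_matrix_vector])

lemma norm_power2_columns: "(norm A)\<^sup>2 = (\<Sum>j\<in>UNIV. (norm (column j A))\<^sup>2)"
  for A :: "complex ^ 'm ^ 'm"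
proof -
  have "(norm A)\<^sup>2 = (\<Sum>i\<in>UNIV. \<Sum>j\<in>UNIV. (norm (A $ i $ j))\<^sup>2)"
    by (simp add: norm_vec_def L2_set_def real_sqrt_pow2 sum_nonneg)
  also have "\<dots> = (\<Sum>j\<in>UNIV. \<Sum>i\<in>UNIV. (norm (A $ i $ j))\<^sup>2)" by (rule sum.swap)
  finally show ?thesis
    by (simp add: norm_vec_def L2_set_def real_sqrt_pow2 sum_nonneg column_def)
qed

lemma column_mult: "column j (A ** B) = A *v column j B"
  by (simp add: column_def matrix_matrix_mult_def matrix_vector_mult_def vec_eq_iff)

text \<open>Multiplication by \<open>A\<close> acts on each column separately, so the operator norm of \<open>A\<close> on vectors is
  also its norm as an operator on matrices with the Frobenius norm.\<close>

lemma norm_mult_left_le: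
  fixes A W :: "complex ^ 'm ^ 'm"
  assumes "\<And>v. norm (A *v v) \<le> b * norm v" "0 \<le> b"
  shows "norm (A ** W) \<le> b * norm W"
proof (rule power2_le_imp_le)
  have "(norm (A ** W))\<^sup>2 = (\<Sum>j\<in>UNIV. (norm (A *v column j W))\<^sup>2)"
    by (simp add: norm_power2_columns column_mult)
  also have "\<dots> \<le> (\<Sum>j\<in>UNIV. (b * norm (column j W))\<^sup>2)"
    by (intro sum_mono power_mono assms) simp
  also have "\<dots> = (b * norm W)\<^sup>2"
    by (simp add: norm_power2_columns power_mult_distrib sum_distrib_left)
  finally show "(norm (A ** W))\<^sup>2 \<le> (b * norm W)\<^sup>2" .
qed (simp add: assms)

lemma norm_mult_right_le:
  fixes A W :: "complex ^ 'm ^ 'm"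
  assumes "hermitian A" "\<And>v. norm (A *v v) \<le> b * norm v" "0 \<le> b"
  shows "norm (W ** A) \<le> b * norm W"
  using norm_mult_left_le[OF assms(2,3), of "ctranspose W"] assms(1)
  by (metis ctranspose_mult hermitian_def norm_ctranspose)

lemma norm_matrix_vector_le_norm: "norm (A *v v) \<le> norm A * norm v" for A :: "complex ^ 'm ^ 'm"
proof -
  have "norm ((A *v v) $ i) \<le> norm (A $ i) * norm v" for i
  proof -
    have "norm ((A *v v) $ i) \<le> (\<Sum>j\<in>UNIV. norm (A $ i $ j) * norm (v $ j))"
      unfolding matrix_vector_mult_def by (simp add: sum_norm_le norm_mult)
    also have "\<dots> \<le> norm (A $ i) * norm v"
      unfolding norm_vec_def by (rule order_trans[OF _ L2_set_mult_ineq]) simp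
    finally show ?thesis .
  qed
  then have "L2_set (\<lambda>i. norm ((A *v v) $ i)) UNIV \<le> L2_set (\<lambda>i. norm (A $ i) * norm v) UNIV"
    by (intro L2_set_mono) auto
  then show ?thesis
    unfolding norm_vec_def[of "A *v v"] norm_vec_def[of A] by (simp add: L2_set_left_distrib)
qed

lemma op_norm_le_frobenius_norm: "op_norm A \<le> frobenius_norm A"
  unfolding frobenius_norm_eq_norm by (rule op_norm_le) (rule norm_matrix_vector_le_norm)

lemma norm_mat_1: "norm (mat 1 :: complex ^ 'm ^ 'm) = sqrt CARD('m)"
proof -
  have "norm ((mat 1 :: complex ^ 'm ^ 'm) $ i) = 1" for i
    by (simp add: norm_vec_def L2_set_def mat_def if_distrib[of norm] if_distrib[of "\<lambda>x. x\<^sup>2"] cong: if_cong)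
  then show ?thesis by (subst norm_vec_def) (simp add: L2_set_def)
qed

text \<open>The Rayleigh quotient attains its maximum \<open>r\<close> on the compact unit sphere, at \<open>u\<close> say. Then
  \<open>Q y = r \<parallel>y\<parallel>\<^sup>2 - y \<bullet> H y\<close> is a nonnegative quadratic form with \<open>Q u = 0\<close>, and moving from \<open>u\<close> against
  its gradient would make it negative unless \<open>H u = r u\<close>.\<close>

lemma hermitian_eigenvalue_exists:
  fixes H :: "complex ^ 'm ^ 'm"
  assumes H: "hermitian H"
  shows "\<exists>r v. v \<noteq> 0 \<and> H *v v = complex_of_real r *s v"
proof -
  interpret bl: bounded_linear "\<lambda>v. H *v v" by (rule bounded_linear_matrix_vector)
  have sym: "(H *v x) \<bullet> y = x \<bullet> (H *v y)" for x y
    using inner_matrix_vector_mult[of H x y] H by (simp add: hermitian_def)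
  have "\<exists>u\<in>sphere (0 :: complex ^ 'm) 1. \<forall>y\<in>sphere 0 1. y \<bullet> (H *v y) \<le> u \<bullet> (H *v u)"
    by (rule continuous_attains_sup)
       (auto intro!: continuous_intros bl.continuous_on)
  then obtain u where u: "norm u = 1" and max: "\<And>y. norm y = 1 \<Longrightarrow> y \<bullet> (H *v y) \<le> u \<bullet> (H *v u)"
    by auto
  define r where "r = u \<bullet> (H *v u)"
  define Q where "Q y = r * (y \<bullet> y) - y \<bullet> (H *v y)" for y
  have Q_nonneg: "Q y \<ge> 0" for y
  proof (cases "y = 0")
    case False
    have "(y /\<^sub>R norm y) \<bullet> (H *v (y /\<^sub>R norm y)) \<le> r"
      unfolding r_def by (rule max) (use False in simp)
    then have "(y \<bullet> (H *v y)) / (norm y)\<^sup>2 \<le> r"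
      by (simp add: bl.scaleR power2_eq_square divide_simps)
    then show ?thesis using False by (simp add: Q_def dot_square_norm divide_simps)
  qed (simp add: Q_def bl.zero)
  define w where "w = r *\<^sub>R u - H *v u"
  have "w \<bullet> w = 0"
  proof (rule ccontr)
    assume "w \<bullet> w \<noteq> 0"
    then have pos: "w \<bullet> w > 0" by (simp add: order_less_le)
    have Q_eq: "Q (u - s *\<^sub>R w) = s\<^sup>2 * Q w - 2 * s * (w \<bullet> w)" for s
    proof -
      have "Q (u - s *\<^sub>R w) = Q u + s\<^sup>2 * Q w - 2 * s * (r * (u \<bullet> w) - w \<bullet> (H *v u))"
        using sym[of w u] by (simp add: Q_def inner_commute[of u "H *v w"] bl.diff bl.scaleR inner_diff_left inner_diff_right
            power2_eq_square algebra_simps inner_commute[of "H *v u"] inner_commute[of w u])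
      also have "r * (u \<bullet> w) - w \<bullet> (H *v u) = w \<bullet> w"
        unfolding w_def by (simp add: inner_diff_left inner_diff_right inner_commute algebra_simps)
      also have "Q u = 0" using u by (simp add: Q_def r_def dot_square_norm)
      finally show ?thesis by simp
    qed
    \<comment> \<open>small enough for the linear term to win; the \<open>+ 1\<close> avoids a division by zero\<close>
    define s where "s = (w \<bullet> w) / (Q w + 1)"
    have s: "s > 0" unfolding s_def using pos Q_nonneg[of w] by (intro divide_pos_pos) auto
    have "s * Q w \<le> w \<bullet> w"
      unfolding s_def using pos Q_nonneg[of w] by (simp add: divide_simps)
    then have "s * Q w < 2 * (w \<bullet> w)" using pos by linarith
    then have "s * (s * Q w) < s * (2 * (w \<bullet> w))" using s by simp
    then have "Q (u - s *\<^sub>R w) < 0" unfolding Q_eq by (simp add: power2_eq_square algebra_simps)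
    with Q_nonneg show False by (simp add: not_le[symmetric])
  qed
  then have "H *v u = complex_of_real r *s u"
    by (simp add: w_def of_real_scalar_mult_vec)
  then show ?thesis using u by (metis norm_zero zero_neq_one)
qed

text \<open>Eigenvectors for distinct eigenvalues are orthogonal, hence linearly independent.\<close>

lemma finite_hermitian_eigenvalues:
  fixes H :: "complex ^ 'm ^ 'm"
  assumes H: "hermitian H"
  shows "finite {r. \<exists>v. v \<noteq> 0 \<and> H *v v = complex_of_real r *s v}" (is "finite ?S")
proof -
  have sym: "(H *v x) \<bullet> y = x \<bullet> (H *v y)" for x y
    using inner_matrix_vector_mult[of H x y] H by (simp add: hermitian_def)
  have sc: "complex_of_real r *s v = r *\<^sub>R v" for r and v :: "complex ^ 'm"
    by (rule of_real_scalar_mult_vec)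
  define e where "e r = (SOME v. v \<noteq> 0 \<and> H *v v = r *\<^sub>R v)" for r
  have e: "e r \<noteq> 0 \<and> H *v e r = r *\<^sub>R e r" if "r \<in> ?S" for r
    unfolding e_def by (rule someI_ex) (use that in \<open>simp add: sc\<close>)
  have orth: "e r \<bullet> e s = 0" if "r \<in> ?S" "s \<in> ?S" "r \<noteq> s" for r s
  proof -
    have "r * (e r \<bullet> e s) = s * (e r \<bullet> e s)"
      using sym[of "e r" "e s"] e[OF that(1)] e[OF that(2)] by simp
    then show ?thesis using that by simp
  qed
  have inj: "inj_on e ?S"
  proof (rule inj_onI, rule ccontr)
    fix r s assume rs: "r \<in> ?S" "s \<in> ?S" "e r = e s" "r \<noteq> s"
    then have "e r \<bullet> e r = 0" using orth[OF rs(1,2,4)] by simp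
    then show False using e[OF rs(1)] by simp
  qed
  have "pairwise orthogonal (e ` ?S)"
    unfolding pairwise_def orthogonal_def using orth by (auto simp del: mem_Collect_eq)
  then have "independent (e ` ?S)"
  proof (rule pairwise_orthogonal_independent)
    show "0 \<notin> e ` ?S" using e by (metis (no_types, lifting) imageE)
  qed
  then have "finite (e ` ?S)" by (rule independent_imp_finite)
  then show ?thesis using inj by (rule finite_imageD)
qed

text \<open>A maximum is only meaningful for a finite nonempty set, which is what the two preceding lemmas
  provide.\<close>

lemma lambda_max_eigenvector:
  fixes H :: "complex ^ 'm ^ 'm"
  assumes H: "hermitian H"
  obtains v where "norm v = 1" "H *v v = complex_of_real (lambda_max H) *s v"
proof -
  have "lambda_max H \<in> {r. \<exists>v. v \<noteq> 0 \<and> H *v v = complex_of_real r *s v}"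
    unfolding lambda_max_def
    using finite_hermitian_eigenvalues[OF H] hermitian_eigenvalue_exists[OF H]
    by (intro Max_in) auto
  then obtain v where v: "v \<noteq> 0" "H *v v = complex_of_real (lambda_max H) *s v" by blast
  have "H *v (v /\<^sub>R norm v) = complex_of_real (lambda_max H) *s (v /\<^sub>R norm v)"
    using v(2) linear_scale[OF bounded_linear.linear[OF bounded_linear_matrix_vector[of H]]]
    by (simp add: of_real_scalar_mult_vec mult.commute)
  then show thesis using v(1) that[of "v /\<^sub>R norm v"] by simp
qed

section \<open>Quadratic replacements for the matrix exponential\<close>

text \<open>A polynomial substitute for \<open>exp (z A)\<close> that agrees with it to first order at 0. The part without \<open>A\<close>
  is a scalar matrix, so it commutes with all matrices, and for \<open>\<kappa> = \<beta>\<^sup>2\<close> the quadratic term compensates the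
  growth of \<open>I + z A\<close> along the imaginary axis.\<close>

definition rotation_step :: "real \<Rightarrow> complex \<Rightarrow> complex ^ 'm ^ 'm \<Rightarrow> complex ^ 'm ^ 'm" where
  "rotation_step \<kappa> z A = cscale (1 + of_real \<kappa> * z\<^sup>2) (mat 1) + cscale z A"

primrec rotation_product ::
  "real \<Rightarrow> (nat \<Rightarrow> complex ^ 'm ^ 'm) \<Rightarrow> nat \<Rightarrow> complex \<Rightarrow> complex ^ 'm ^ 'm" where
  "rotation_product \<kappa> A 0 z = mat 1"
| "rotation_product \<kappa> A (Suc t) z = rotation_step \<kappa> z (A (Suc t)) ** rotation_product \<kappa> A t z"

lemma rotation_step_vec:
  "rotation_step \<kappa> z A *v w = (1 + of_real \<kappa> * z\<^sup>2) *s w + z *s (A *v w)"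
  by (simp add: rotation_step_def matrix_vector_mult_add_rdistrib cscale_mult_vec)

lemma rotation_step_mult:
  "rotation_step \<kappa> z A ** W = cscale (1 + of_real \<kappa> * z\<^sup>2) W + cscale z (A ** W)"
  by (simp add: rotation_step_def matrix_add_rdistrib cscale_mult_left)

text \<open>For \<open>z = \<i> y\<close> the vectors \<open>w\<close> and \<open>\<i> A w\<close> are orthogonal for the real inner product, because \<open>\<i> A\<close> is
  skew-Hermitian. By Pythagoras the squared norm is at most \<open>(1 - s)\<^sup>2 + s = 1 - s (1 - s)\<close> times that of
  \<open>w\<close>, where \<open>s = (\<beta> y)\<^sup>2 \<le> 1\<close>.\<close>

lemma norm_rotation_step_imaginary_le:
  fixes A :: "complex ^ 'm ^ 'm"
  assumes A: "hermitian A" "\<And>v. norm (A *v v) \<le> \<beta> * norm v"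
    and \<beta>: "0 \<le> \<beta>" "\<beta> \<le> 1" and y: "\<bar>y\<bar> \<le> 1"
  shows "norm (rotation_step (\<beta>\<^sup>2) (\<i> * of_real y) A *v w) \<le> norm w"
proof (rule power2_le_imp_le)
  define p where "p = cscale \<i> A *v w"
  have "p \<bullet> w = w \<bullet> (ctranspose (cscale \<i> A) *v w)"
    unfolding p_def by (rule inner_matrix_vector_mult)
  also have "ctranspose (cscale \<i> A) *v w = - p"
  proof -
    have "(- \<i>) *s x = - (\<i> *s x)" for x :: "complex ^ 'm" by (simp add: vec_eq_iff)
    then show ?thesis
      using A(1) by (simp add: hermitian_def ctranspose_cscale p_def cscale_mult_vec)
  qed
  finally have orth: "w \<bullet> p = 0" by (simp add: inner_commute)
  have np: "norm p \<le> \<beta> * norm w" using A(2)[of w] by (simp add: p_def cscale_mult_vec norm_scalar_mult_vec)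
  have "rotation_step (\<beta>\<^sup>2) (\<i> * of_real y) A *v w = (1 - \<beta>\<^sup>2 * y\<^sup>2) *\<^sub>R w + y *\<^sub>R p"
    unfolding of_real_scalar_mult_vec[symmetric]
    by (simp add: rotation_step_vec p_def cscale_mult_vec vec_eq_iff power_mult_distrib)
  then have "(norm (rotation_step (\<beta>\<^sup>2) (\<i> * of_real y) A *v w))\<^sup>2 =
      (1 - \<beta>\<^sup>2 * y\<^sup>2)\<^sup>2 * (norm w)\<^sup>2 + y\<^sup>2 * (norm p)\<^sup>2"
    using orth by (simp add: norm_add_Pythagorean orthogonal_def power_mult_distrib)
  also have "\<dots> \<le> (1 - \<beta>\<^sup>2 * y\<^sup>2)\<^sup>2 * (norm w)\<^sup>2 + y\<^sup>2 * (\<beta> * norm w)\<^sup>2"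
    by (intro add_left_mono mult_left_mono power_mono np) auto
  also have "\<dots> = (1 - (\<beta> * y)\<^sup>2 * (1 - (\<beta> * y)\<^sup>2)) * (norm w)\<^sup>2"
    by (simp add: power2_eq_square algebra_simps)
  also have "\<dots> \<le> 1 * (norm w)\<^sup>2"
  proof (rule mult_right_mono)
    have "\<bar>\<beta> * y\<bar> \<le> 1" using \<beta> y by (simp add: abs_mult mult_le_one)
    then have "(\<beta> * y)\<^sup>2 \<le> 1" by (simp add: abs_square_le_1)
    then show "1 - (\<beta> * y)\<^sup>2 * (1 - (\<beta> * y)\<^sup>2) \<le> 1" by simp
  qed simp
  finally show "(norm (rotation_step (\<beta>\<^sup>2) (\<i> * of_real y) A *v w))\<^sup>2 \<le> (norm w)\<^sup>2" by simp
qed simp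

lemma norm_rotation_product_imaginary_le:
  fixes A :: "nat \<Rightarrow> complex ^ 'm ^ 'm"
  assumes A: "\<And>t. 1 \<le> t \<Longrightarrow> t \<le> n \<Longrightarrow> hermitian (A t)"
    "\<And>t v. 1 \<le> t \<Longrightarrow> t \<le> n \<Longrightarrow> norm (A t *v v) \<le> \<beta> * norm v"
    and \<beta>: "0 \<le> \<beta>" "\<beta> \<le> 1" and y: "\<bar>y\<bar> \<le> 1"
  shows "norm (rotation_product (\<beta>\<^sup>2) A n (\<i> * of_real y) *v w) \<le> norm w"
  using A
proof (induction n)
  case (Suc n)
  have "norm (rotation_product (\<beta>\<^sup>2) A (Suc n) (\<i> * of_real y) *v w)
      \<le> norm (rotation_product (\<beta>\<^sup>2) A n (\<i> * of_real y) *v w)"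
    using norm_rotation_step_imaginary_le[OF Suc.prems(1,2) \<beta> y, of "Suc n"]
    by (simp add: matrix_vector_mul_assoc[symmetric])
  also have "\<dots> \<le> norm w" by (rule Suc.IH) (use Suc.prems in auto)
  finally show ?case .
qed simp

lemma rotation_product_0 [simp]: "rotation_product \<kappa> A n 0 = mat 1"
  by (induction n) (simp_all add: rotation_step_mult vec_eq_iff)

lemma holomorphic_rotation_product:
  "(\<lambda>z. rotation_product \<kappa> A n z $ i $ j) holomorphic_on S"
proof (induction n arbitrary: i j)
  case (Suc n)
  then show ?case
    unfolding rotation_product.simps rotation_step_mult
    by (auto simp: matrix_matrix_mult_def intro!: holomorphic_intros)
qed simp

lemma has_field_derivative_rotation_product:
  "((\<lambda>z. rotation_product \<kappa> A n z $ i $ j) has_field_derivative (\<Sum>t=1..n. A t) $ i $ j) (at 0)"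
proof (induction n arbitrary: i j)
  case (Suc n)
  have "((\<lambda>z. (1 + of_real \<kappa> * z\<^sup>2) * rotation_product \<kappa> A n z $ i $ j +
      z * (\<Sum>k\<in>UNIV. A (Suc n) $ i $ k * rotation_product \<kappa> A n z $ k $ j)) has_field_derivative
      (\<Sum>t=1..n. A t) $ i $ j + (\<Sum>k\<in>UNIV. A (Suc n) $ i $ k * (mat 1 :: complex^'a^'a) $ k $ j)) (at 0)"
    by (rule derivative_eq_intros Suc refl)+ simp
  moreover have "(\<Sum>k\<in>UNIV. A (Suc n) $ i $ k * (mat 1 :: complex^'a^'a) $ k $ j) = A (Suc n) $ i $ j"
    by (simp add: mat_def if_distrib cong: if_cong)
  ultimately show ?case
    unfolding rotation_product.simps rotation_step_mult by (simp add: matrix_matrix_mult_def)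
qed (simp add: mat_def)

lemma hermitian_sum: "(\<And>t. t \<in> I \<Longrightarrow> hermitian (A t)) \<Longrightarrow> hermitian (\<Sum>t\<in>I. A t)"
  by (simp add: hermitian_def vec_eq_iff)

lemma norm_hermitian_product_le:
  "norm (\<Sum>i\<in>UNIV. cnj (v $ i) * w $ i) \<le> norm v * norm w" for v w :: "complex ^ 'm"
proof -
  have "norm (\<Sum>i\<in>UNIV. cnj (v $ i) * w $ i) \<le> (\<Sum>i\<in>UNIV. \<bar>norm (v $ i)\<bar> * \<bar>norm (w $ i)\<bar>)"
    by (rule sum_norm_le) (simp add: norm_mult)
  also have "\<dots> \<le> norm v * norm w" unfolding norm_vec_def by (rule L2_set_mult_ineq)
  finally show ?thesis .
qed

lemma continuous_on_rotation_product_cis: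
  "continuous_on S (\<lambda>\<phi>. rotation_product \<kappa> A n (cis \<phi>))"
proof -
  have c: "continuous_on UNIV (\<lambda>z. rotation_product \<kappa> A n z $ i $ j)" for i j
    by (rule holomorphic_on_imp_continuous_on[OF holomorphic_rotation_product])
  have "continuous_on S (\<lambda>\<phi>. rotation_product \<kappa> A n (cis \<phi>) $ i $ j)" for i j
    by (rule continuous_on_compose2[OF c]) (auto intro!: continuous_intros)
  then have "continuous_on S (\<lambda>\<phi>. \<chi> i j. rotation_product \<kappa> A n (cis \<phi>) $ i $ j)"
    by (intro continuous_on_vec_lambda)
  then show ?thesis by simp
qed

text \<open>The substitute for the Golden-Thompson inequality. The half disk inequality is applied to the
  square of \<open>f(z) = \<langle>v, B(z) v\<rangle>\<close>, which has modulus at most 1 on the imaginary segment since \<open>B(z)\<close> is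
  a contraction there, and derivative \<open>2 r\<close> at 0.\<close>

lemma exp_eigenvalue_le_arc_mean:
  fixes A :: "nat \<Rightarrow> complex ^ 'm ^ 'm"
  assumes A: "\<And>t. 1 \<le> t \<Longrightarrow> t \<le> n \<Longrightarrow> hermitian (A t)"
    "\<And>t v. 1 \<le> t \<Longrightarrow> t \<le> n \<Longrightarrow> norm (A t *v v) \<le> \<beta> * norm v"
    and \<beta>: "0 \<le> \<beta>" "\<beta> \<le> 1"
    and v: "norm v = 1" "(\<Sum>t=1..n. A t) *v v = complex_of_real r *s v"
  shows "exp (pi / 2 * r) \<le>
    integral {-pi/2..pi/2} (\<lambda>\<phi>. (norm (rotation_product (\<beta>\<^sup>2) A n (cis \<phi>)))\<^sup>2 * (cos \<phi> / 2))"
proof -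
  define H where "H = (\<Sum>t=1..n. A t)"
  define B where "B = rotation_product (\<beta>\<^sup>2) A n"
  define f where "f z = (\<Sum>i\<in>UNIV. cnj (v $ i) * (B z *v v) $ i)" for z
  have vv: "(\<Sum>i\<in>UNIV. cnj (v $ i) * v $ i) = 1"
  proof -
    have "(\<Sum>i\<in>UNIV. cnj (v $ i) * v $ i) = of_real (\<Sum>i\<in>UNIV. (norm (v $ i))\<^sup>2)"
      unfolding of_real_sum by (intro sum.cong refl) (simp only: complex_norm_square mult.commute)
    also have "(\<Sum>i\<in>UNIV. (norm (v $ i))\<^sup>2) = (norm v)\<^sup>2"
      by (simp add: norm_vec_def L2_set_def real_sqrt_pow2 sum_nonneg)
    finally show ?thesis using v by simp
  qed
  have f_le: "norm (f z) \<le> norm (B z *v v)" for z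
    using norm_hermitian_product_le[of v "B z *v v"] v by (simp add: f_def)
  have f0: "f 0 = 1" using vv by (simp add: f_def B_def)
  have "(f has_field_derivative (\<Sum>i\<in>UNIV. cnj (v $ i) * (H *v v) $ i)) (at 0)"
    unfolding f_def matrix_vector_mult_def B_def H_def
    unfolding vec_lambda_beta
    by (intro DERIV_sum DERIV_cmult DERIV_cmult_right has_field_derivative_rotation_product)
  also have "(\<Sum>i\<in>UNIV. cnj (v $ i) * (H *v v) $ i) =
      of_real (r) * (\<Sum>i\<in>UNIV. cnj (v $ i) * v $ i)"
    unfolding H_def v(2) by (simp add: sum_distrib_left mult_ac)
  finally have df: "(f has_field_derivative of_real (r)) (at 0)" by (simp add: vv)
  have "exp (pi * (2 * r) / 4) \<le>
      integral {-pi/2..pi/2} (\<lambda>t. norm ((f (cis t))\<^sup>2) * (cos t / 2))"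
  proof (rule exp_deriv_le_arc_mean)
    show "(\<lambda>z. (f z)\<^sup>2) holomorphic_on UNIV"
      unfolding f_def matrix_vector_mult_def B_def
      by (auto intro!: holomorphic_intros holomorphic_rotation_product)
    show "(f 0)\<^sup>2 = 1" by (simp add: f0)
    show "((\<lambda>z. (f z)\<^sup>2) has_field_derivative of_real (2 * r)) (at 0)"
      by (rule derivative_eq_intros df refl)+ (simp add: f0)
    fix y :: real assume y: "\<bar>y\<bar> \<le> 1"
    have "norm (f (\<i> * of_real y)) \<le> 1"
      using f_le[of "\<i> * of_real y"] norm_rotation_product_imaginary_le[of n A \<beta> y v, OF A \<beta> y] v
      by (simp add: B_def)
    then show "norm ((f (\<i> * of_real y))\<^sup>2) \<le> 1" by (simp add: norm_power power_le_one)
  qed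
  also have "\<dots> \<le> integral {-pi/2..pi/2} (\<lambda>t. (norm (B (cis t)))\<^sup>2 * (cos t / 2))"
  proof (rule integral_le)
    have cBB: "continuous_on {-pi/2..pi/2} (\<lambda>t. B (cis t))"
      unfolding B_def by (rule continuous_on_rotation_product_cis)
    show "(\<lambda>t. (norm (B (cis t)))\<^sup>2 * (cos t / 2)) integrable_on {-pi/2..pi/2}"
      by (intro integrable_continuous_real continuous_on_mult continuous_on_power continuous_on_norm cBB)
         (auto intro!: continuous_intros)
    show "(\<lambda>t. norm ((f (cis t))\<^sup>2) * (cos t / 2)) integrable_on {-pi/2..pi/2}"
      unfolding f_def matrix_vector_mult_def using cBB
      by (intro integrable_continuous_real) (auto intro!: continuous_intros)
    fix t assume "t \<in> {-pi/2..pi/2}"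
    then have "cos t \<ge> 0" by (intro cos_ge_zero) auto
    moreover have "norm (f (cis t)) \<le> norm (B (cis t))"
      using f_le[of "cis t"] norm_matrix_vector_le_norm[of "B (cis t)" v] v by simp
    ultimately show "norm ((f (cis t))\<^sup>2) * (cos t / 2) \<le> (norm (B (cis t)))\<^sup>2 * (cos t / 2)"
      by (intro mult_right_mono) (auto simp: norm_power intro: power_mono)
  qed
  finally show ?thesis by (simp add: H_def B_def algebra_simps)
qed

section \<open>The Markov property for bounded functions\<close>

text \<open>All test functions along the chain are bounded, which keeps every integral in sight finite.\<close>

definition bounded_measurable :: "'a measure \<Rightarrow> ('a \<Rightarrow> 'b::euclidean_space) \<Rightarrow> bool" where
  "bounded_measurable M f \<longleftrightarrow> f \<in> borel_measurable M \<and> (\<exists>K. \<forall>x\<in>space M. norm (f x) \<le> K)"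

lemma bounded_measurableI:
  "f \<in> borel_measurable M \<Longrightarrow> (\<And>x. x \<in> space M \<Longrightarrow> norm (f x) \<le> K) \<Longrightarrow> bounded_measurable M f"
  unfolding bounded_measurable_def by blast

lemma bounded_measurable_measurable: "bounded_measurable M f \<Longrightarrow> f \<in> borel_measurable M"
  unfolding bounded_measurable_def by blast

lemma bounded_measurable_bound:
  assumes "bounded_measurable M f"
  shows "\<exists>K\<ge>0. \<forall>x\<in>space M. norm (f x) \<le> K"
proof -
  obtain K where "\<forall>x\<in>space M. norm (f x) \<le> K"
    using assms unfolding bounded_measurable_def by blast
  then have "\<forall>x\<in>space M. norm (f x) \<le> \<bar>K\<bar>"
    by (meson abs_ge_self order_trans)
  then show ?thesis by (intro exI[of _ "\<bar>K\<bar>"]) auto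
qed

lemma bounded_measurable_const [simp, intro]: "bounded_measurable M (\<lambda>x. c)"
  by (rule bounded_measurableI[of _ _ "norm c"]) auto

lemma bounded_measurable_add:
  assumes "bounded_measurable M f" "bounded_measurable M g"
  shows "bounded_measurable M (\<lambda>x. f x + g x)"
proof -
  obtain K where "\<And>x. x \<in> space M \<Longrightarrow> norm (f x) \<le> K" using bounded_measurable_bound[OF assms(1)] by blast
  moreover obtain L where "\<And>x. x \<in> space M \<Longrightarrow> norm (g x) \<le> L" using bounded_measurable_bound[OF assms(2)] by blast
  ultimately have "norm (f x + g x) \<le> K + L" if "x \<in> space M" for x
    using that by (intro norm_triangle_mono) auto
  then show ?thesis
    using assms by (intro bounded_measurableI[of _ _ "K + L"]) (auto dest!: bounded_measurable_measurable)
qed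

lemma bounded_measurable_bounded_linear:
  assumes f: "bounded_measurable M f" and l: "bounded_linear l"
  shows "bounded_measurable M (\<lambda>x. l (f x))"
proof -
  interpret bounded_linear l by (rule l)
  obtain K where K: "K \<ge> 0" "\<And>x. x \<in> space M \<Longrightarrow> norm (f x) \<le> K" using bounded_measurable_bound[OF f] by blast
  obtain C where C: "C > 0" "\<And>x. norm (l x) \<le> norm x * C" using pos_bounded by blast
  have "norm (l (f x)) \<le> K * C" if "x \<in> space M" for x
    using C K(2)[OF that] by (meson less_imp_le mult_right_mono order_trans)
  moreover have "(\<lambda>x. l (f x)) \<in> borel_measurable M"
    using f by (intro borel_measurable_continuous_on[of l] linear_continuous_on[OF l])
      (auto dest: bounded_measurable_measurable)
  ultimately show ?thesis by (rule bounded_measurableI[rotated])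
qed

lemma bounded_measurable_bounded_bilinear:
  assumes f: "bounded_measurable M f" and g: "bounded_measurable M g" and b: "bounded_bilinear b"
  shows "bounded_measurable M (\<lambda>x. b (f x) (g x))"
proof -
  interpret bounded_bilinear b by (rule b)
  obtain K where K: "K \<ge> 0" "\<And>x. x \<in> space M \<Longrightarrow> norm (f x) \<le> K" using bounded_measurable_bound[OF f] by blast
  obtain L where L: "L \<ge> 0" "\<And>x. x \<in> space M \<Longrightarrow> norm (g x) \<le> L" using bounded_measurable_bound[OF g] by blast
  obtain C where C: "C > 0" "\<And>x y. norm (b x y) \<le> norm x * norm y * C" using pos_bounded by blast
  have "norm (b (f x) (g x)) \<le> K * L * C" if "x \<in> space M" for x
    by (rule order_trans[OF C(2)]) (use C(1) K(1) L(1) K(2)[OF that] L(2)[OF that] in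
      \<open>auto intro!: mult_mono\<close>)
  moreover have "continuous_on UNIV (\<lambda>p. b (fst p) (snd p))"
    by (intro continuous_on continuous_on_fst continuous_on_snd continuous_on_id)
  then have "(\<lambda>x. b (f x) (g x)) \<in> borel_measurable M"
    using f g borel_measurable_continuous_Pair[of f M g b]
    by (auto dest: bounded_measurable_measurable)
  ultimately show ?thesis by (rule bounded_measurableI[rotated])
qed

lemma bounded_measurable_diff:
  "bounded_measurable M f \<Longrightarrow> bounded_measurable M g \<Longrightarrow> bounded_measurable M (\<lambda>x. f x - g x)"
  using bounded_measurable_add[of M f "\<lambda>x. - g x"]
    bounded_measurable_bounded_linear[of M g "\<lambda>x. - x"] bounded_linear_minus[OF bounded_linear_ident]
  by auto

lemma bounded_measurable_norm_power2:
  assumes "bounded_measurable M f" shows "bounded_measurable M (\<lambda>x. (norm (f x))\<^sup>2)"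
proof -
  obtain K where K: "K \<ge> 0" "\<And>x. x \<in> space M \<Longrightarrow> norm (f x) \<le> K" using bounded_measurable_bound[OF assms] by blast
  then show ?thesis
    using assms by (intro bounded_measurableI[of _ _ "K\<^sup>2"])
      (auto dest!: bounded_measurable_measurable intro!: power_mono)
qed

lemma bounded_measurable_inner:
  "bounded_measurable M f \<Longrightarrow> bounded_measurable M g \<Longrightarrow> bounded_measurable M (\<lambda>x. f x \<bullet> g x)"
  by (rule bounded_measurable_bounded_bilinear[OF _ _ bounded_bilinear_inner])

lemma bounded_measurable_compose:
  assumes f: "bounded_measurable M f" and X: "X \<in> N \<rightarrow>\<^sub>M M"
  shows "bounded_measurable N (\<lambda>x. f (X x))"
proof -
  obtain K where K: "\<And>x. x \<in> space M \<Longrightarrow> norm (f x) \<le> K" using bounded_measurable_bound[OF f] by blast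
  show ?thesis
    using K measurable_space[OF X] measurable_compose[OF X bounded_measurable_measurable[OF f]]
    by (intro bounded_measurableI[of _ _ K]) auto
qed

lemma bounded_measurable_cong_sets:
  fixes f :: "'a \<Rightarrow> 'b::euclidean_space"
  shows "sets M = sets M' \<Longrightarrow> bounded_measurable M f \<longleftrightarrow> bounded_measurable M' f"
  unfolding bounded_measurable_def
  using measurable_cong_sets[of M M' "borel :: 'b measure" borel] sets_eq_imp_space_eq[of M M'] by simp

lemma (in finite_measure) integrable_bounded_measurable:
  assumes "bounded_measurable M f" shows "integrable M f"
proof -
  obtain K where K: "\<And>x. x \<in> space M \<Longrightarrow> norm (f x) \<le> K" using bounded_measurable_bound[OF assms] by blast
  then show ?thesis
    using bounded_measurable_measurable[OF assms] by (intro integrable_const_bound[of _ K]) auto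
qed

text \<open>The variance formula. It yields that centring does not increase the second moment, and Jensen's
  inequality for the squared norm.\<close>

lemma (in prob_space) expectation_norm_diff_power2:
  fixes f :: "'a \<Rightarrow> 'b::euclidean_space"
  assumes "bounded_measurable M f"
  shows "(\<integral>x. (norm (f x - expectation f))\<^sup>2 \<partial>M) = (\<integral>x. (norm (f x))\<^sup>2 \<partial>M) - (norm (expectation f))\<^sup>2"
proof -
  have i: "integrable M f" "integrable M (\<lambda>x. (norm (f x))\<^sup>2)"
    using assms by (auto intro!: integrable_bounded_measurable bounded_measurable_norm_power2)
  have "(norm (f x - expectation f))\<^sup>2 =
      (norm (f x))\<^sup>2 - 2 * (f x \<bullet> expectation f) + (norm (expectation f))\<^sup>2" for x
    by (simp add: power2_norm_eq_inner inner_diff_left inner_diff_right inner_commute)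
  moreover have "(\<integral>x. f x \<bullet> expectation f \<partial>M) = (norm (expectation f))\<^sup>2"
    using i by (simp add: power2_norm_eq_inner)
  ultimately show ?thesis using i by (simp add: prob_space)
qed

lemma (in prob_space) norm_expectation_power2_le:
  fixes f :: "'a \<Rightarrow> 'b::euclidean_space"
  assumes "bounded_measurable M f"
  shows "(norm (expectation f))\<^sup>2 \<le> (\<integral>x. (norm (f x))\<^sup>2 \<partial>M)"
proof -
  have "0 \<le> (\<integral>x. (norm (f x - expectation f))\<^sup>2 \<partial>M)" by (rule integral_nonneg_AE) simp
  then show ?thesis using expectation_norm_diff_power2[OF assms] by simp
qed

lemma subalgebra_natural_sigma:
  assumes "\<And>t. X t \<in> N \<rightarrow>\<^sub>M M"
  shows "subalgebra N (natural_sigma N M X t)"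
proof -
  have *: "(\<Union>s\<in>{..t}. {X s -` A \<inter> space N | A. A \<in> sets M}) \<subseteq> sets N"
    using measurable_sets[OF assms] by auto
  then have "(\<Union>s\<in>{..t}. {X s -` A \<inter> space N | A. A \<in> sets M}) \<subseteq> Pow (space N)"
    using sets.space_closed by blast
  then show ?thesis
    unfolding subalgebra_def natural_sigma_def
    using sets.sigma_sets_subset[OF *] by (simp add: space_measure_of_conv sets_measure_of)
qed

lemma measurable_natural_sigma:
  assumes X: "\<And>t. X t \<in> N \<rightarrow>\<^sub>M M" and s: "s \<le> t"
  shows "X s \<in> natural_sigma N M X t \<rightarrow>\<^sub>M M"
proof (rule measurableI)
  have sub: "(\<Union>s\<in>{..t}. {X s -` A \<inter> space N | A. A \<in> sets M}) \<subseteq> Pow (space N)"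
    by auto
  have sp: "space (natural_sigma N M X t) = space N"
    using subalgebra_natural_sigma[OF X] by (simp add: subalgebra_def)
  show "X s x \<in> space M" if "x \<in> space (natural_sigma N M X t)" for x
    using measurable_space[OF X] that sp by simp
  show "X s -` A \<inter> space (natural_sigma N M X t) \<in> sets (natural_sigma N M X t)"
    if "A \<in> sets M" for A
    unfolding sp using that s
    by (auto simp: natural_sigma_def sets_measure_of[OF sub] intro!: sigma_sets.Basic)
qed


text \<open>The Markov property is given through conditional probabilities of events. Testing these against a
  weight \<open>c\<close> that depends on the past up to time \<open>t\<close> gives the claim for indicators, and monotone
  approximation extends it to all nonnegative functions.\<close>

lemma markov_chain_nn_integral_step:
  assumes chain: "markov_chain N M \<mu>0 P X"
    and c: "bounded_measurable (natural_sigma N M X t) c" "\<And>\<omega>. \<omega> \<in> space N \<Longrightarrow> (0::real) \<le> c \<omega>"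
    and u: "u \<in> borel_measurable M"
  shows "(\<integral>\<^sup>+\<omega>. ennreal (c \<omega>) * u (X (Suc t) \<omega>) \<partial>N) =
    (\<integral>\<^sup>+\<omega>. ennreal (c \<omega>) * (\<integral>\<^sup>+y. u y \<partial>P (Suc t) (X t \<omega>)) \<partial>N)"
proof -
  define G where "G = natural_sigma N M X t"
  have "\<forall>t\<ge>1. \<forall>A\<in>sets M. AE \<omega> in N. real_cond_exp N (natural_sigma N M X (t - 1))
      (indicator (X t -` A \<inter> space N)) \<omega> = measure (P t (X (t - 1) \<omega>)) A"
    using chain unfolding markov_chain_def by (elim conjE)
  from this[rule_format, of "Suc t"]
  have step: "AE \<omega> in N. real_cond_exp N (natural_sigma N M X t)
      (indicator (X (Suc t) -` A \<inter> space N)) \<omega> = measure (P (Suc t) (X t \<omega>)) A" if "A \<in> sets M" for A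
    using that by simp
  have N: "prob_space N" and P: "P (Suc t) \<in> M \<rightarrow>\<^sub>M prob_algebra M" and X: "X s \<in> N \<rightarrow>\<^sub>M M" for s
    using chain by (auto simp: markov_chain_def)
  interpret prob_space N by (rule N)
  have sub: "subalgebra N G" unfolding G_def by (rule subalgebra_natural_sigma[OF X])
  interpret finite_measure_subalgebra N G by unfold_locales (rule sub)
  have sp: "space G = space N" using sub by (simp add: subalgebra_def)
  have cN: "bounded_measurable N c"
    using c(1) measurable_from_subalg[OF sub] sp unfolding G_def[symmetric]
    by (auto simp: bounded_measurable_def)
  have c_meas [measurable]: "c \<in> borel_measurable G" "c \<in> borel_measurable N"
    using c(1) cN by (auto simp: bounded_measurable_def G_def)
  note X [measurable]
  have PX: "(\<lambda>\<omega>. P (Suc t) (X t \<omega>)) \<in> N \<rightarrow>\<^sub>M subprob_algebra M"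
    using measurable_compose[OF X measurable_prob_algebraD[OF P]] .
  have kernel: "sets (P (Suc t) (X t \<omega>)) = sets M" "prob_space (P (Suc t) (X t \<omega>))"
    if "\<omega> \<in> space N" for \<omega>
    using measurable_space[OF P measurable_space[OF X that]] by (auto simp: space_prob_algebra)
  have meas: "v \<in> borel_measurable M \<Longrightarrow> (\<lambda>\<omega>. \<integral>\<^sup>+y. v y \<partial>P (Suc t) (X t \<omega>)) \<in> borel_measurable N"
    for v :: "'b \<Rightarrow> ennreal"
    by (rule measurable_compose[OF PX nn_integral_measurable_subprob_algebra])
  show ?thesis
    using u
  proof (induction rule: borel_measurable_induct)
    case (cong f g)
    have "(\<integral>\<^sup>+y. f y \<partial>P (Suc t) (X t \<omega>)) = (\<integral>\<^sup>+y. g y \<partial>P (Suc t) (X t \<omega>))" if "\<omega> \<in> space N" for \<omega>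
      using cong(3) sets_eq_imp_space_eq[OF kernel(1)[OF that]] by (intro nn_integral_cong) simp
    moreover have "f (X (Suc t) \<omega>) = g (X (Suc t) \<omega>)" if "\<omega> \<in> space N" for \<omega>
      using cong(3) measurable_space[OF X that] by simp
    ultimately show ?case using cong(4) by (simp cong: nn_integral_cong)
  next
    case (set A)
    note [measurable] = set
    let ?I = "indicator (X (Suc t) -` A \<inter> space N) :: 'a \<Rightarrow> real"
    have I: "?I \<in> borel_measurable N" by measurable
    have int: "integrable N (\<lambda>\<omega>. c \<omega> * ?I \<omega>)"
      using integrable_bounded_measurable[OF cN] I
      by (intro integrable_real_mult_indicator) auto
    have "(\<integral>\<^sup>+\<omega>. ennreal (c \<omega>) * indicator A (X (Suc t) \<omega>) \<partial>N) = (\<integral>\<^sup>+\<omega>. ennreal (c \<omega> * ?I \<omega>) \<partial>N)"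
      by (intro nn_integral_cong) (auto split: split_indicator)
    also have "\<dots> = ennreal (\<integral>\<omega>. c \<omega> * ?I \<omega> \<partial>N)"
      using c(2) by (intro nn_integral_eq_integral int) auto
    also have "(\<integral>\<omega>. c \<omega> * ?I \<omega> \<partial>N) = (\<integral>\<omega>. c \<omega> * real_cond_exp N G ?I \<omega> \<partial>N)"
      using real_cond_exp_intg(2)[OF int c_meas(1) I] by simp
    also have "ennreal \<dots> = (\<integral>\<^sup>+\<omega>. ennreal (c \<omega> * real_cond_exp N G ?I \<omega>) \<partial>N)"
    proof (rule nn_integral_eq_integral[symmetric])
      show "integrable N (\<lambda>\<omega>. c \<omega> * real_cond_exp N G ?I \<omega>)"
        by (rule real_cond_exp_intg(1)[OF int c_meas(1) I])
      have "AE \<omega> in N. real_cond_exp N G ?I \<omega> \<ge> 0"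
        by (rule real_cond_exp_pos) (auto simp: I)
      then show "AE \<omega> in N. 0 \<le> c \<omega> * real_cond_exp N G ?I \<omega>"
        using AE_space by eventually_elim (simp add: c(2))
    qed
    also have "\<dots> = (\<integral>\<^sup>+\<omega>. ennreal (c \<omega>) * (\<integral>\<^sup>+y. indicator A y \<partial>P (Suc t) (X t \<omega>)) \<partial>N)"
    proof (rule nn_integral_cong_AE)
      have "AE \<omega> in N. real_cond_exp N G ?I \<omega> = measure (P (Suc t) (X t \<omega>)) A"
        using step set by (simp add: G_def)
      then show "AE \<omega> in N. ennreal (c \<omega> * real_cond_exp N G ?I \<omega>) =
          ennreal (c \<omega>) * (\<integral>\<^sup>+y. indicator A y \<partial>P (Suc t) (X t \<omega>))"
        using AE_space
      proof eventually_elim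
        case (elim \<omega>)
        interpret K: prob_space "P (Suc t) (X t \<omega>)" by (rule kernel(2)[OF elim(2)])
        show ?case using elim kernel(1)[OF elim(2)] set c(2)
          by (simp add: ennreal_mult K.emeasure_eq_measure)
      qed
    qed
    finally show ?case .
  next
    case (mult u k)
    have *: "(\<integral>\<^sup>+y. k * u y \<partial>P (Suc t) (X t \<omega>)) = k * (\<integral>\<^sup>+y. u y \<partial>P (Suc t) (X t \<omega>))"
      if "\<omega> \<in> space N" for \<omega>
      using mult(2) measurable_cong_sets[OF kernel(1)[OF that] refl]
      by (intro nn_integral_cmult) auto
    have "(\<integral>\<^sup>+\<omega>. ennreal (c \<omega>) * (k * u (X (Suc t) \<omega>)) \<partial>N) = k * (\<integral>\<^sup>+\<omega>. ennreal (c \<omega>) * u (X (Suc t) \<omega>) \<partial>N)"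
      using mult(2) by (subst nn_integral_cmult[symmetric]) (auto simp: mult_ac)
    also have "\<dots> = k * (\<integral>\<^sup>+\<omega>. ennreal (c \<omega>) * (\<integral>\<^sup>+y. u y \<partial>P (Suc t) (X t \<omega>)) \<partial>N)"
      using mult by simp
    also have "\<dots> = (\<integral>\<^sup>+\<omega>. ennreal (c \<omega>) * (\<integral>\<^sup>+y. k * u y \<partial>P (Suc t) (X t \<omega>)) \<partial>N)"
      using meas[OF mult(2)]
      by (subst nn_integral_cmult[symmetric]) (auto simp: * mult_ac intro!: nn_integral_cong)
    finally show ?case .
  next
    case (add u v)
    have *: "(\<integral>\<^sup>+y. v y + u y \<partial>P (Suc t) (X t \<omega>)) =
        (\<integral>\<^sup>+y. v y \<partial>P (Suc t) (X t \<omega>)) + (\<integral>\<^sup>+y. u y \<partial>P (Suc t) (X t \<omega>))"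
      if "\<omega> \<in> space N" for \<omega>
      using add.hyps(1,3) measurable_cong_sets[OF kernel(1)[OF that] refl]
      by (intro nn_integral_add) auto
    note [measurable] = add.hyps(1,3)
    have "(\<integral>\<^sup>+\<omega>. ennreal (c \<omega>) * (v (X (Suc t) \<omega>) + u (X (Suc t) \<omega>)) \<partial>N) =
        (\<integral>\<^sup>+\<omega>. ennreal (c \<omega>) * v (X (Suc t) \<omega>) \<partial>N) + (\<integral>\<^sup>+\<omega>. ennreal (c \<omega>) * u (X (Suc t) \<omega>) \<partial>N)"
      by (simp add: distrib_left nn_integral_add)
    also have "\<dots> = (\<integral>\<^sup>+\<omega>. ennreal (c \<omega>) * (\<integral>\<^sup>+y. v y \<partial>P (Suc t) (X t \<omega>)) \<partial>N) +
        (\<integral>\<^sup>+\<omega>. ennreal (c \<omega>) * (\<integral>\<^sup>+y. u y \<partial>P (Suc t) (X t \<omega>)) \<partial>N)"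
      using add.IH by simp
    also have "\<dots> = (\<integral>\<^sup>+\<omega>. ennreal (c \<omega>) * (\<integral>\<^sup>+y. v y + u y \<partial>P (Suc t) (X t \<omega>)) \<partial>N)"
      using meas[OF add.hyps(1)] meas[OF add.hyps(3)]
      by (subst nn_integral_add[symmetric]) (auto simp: * distrib_left intro!: nn_integral_cong)
    finally show ?case .
  next
    case (seq U)
    note [measurable] = seq.hyps(1)
    have *: "(\<integral>\<^sup>+y. (SUP i. U i) y \<partial>P (Suc t) (X t \<omega>)) = (SUP i. \<integral>\<^sup>+y. U i y \<partial>P (Suc t) (X t \<omega>))"
      if "\<omega> \<in> space N" for \<omega>
      unfolding SUP_apply
      using seq.hyps(1)
      by (intro nn_integral_monotone_convergence_SUP seq.hyps(3))
         (simp add: measurable_cong_sets[OF kernel(1)[OF that] refl])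
    have "(\<integral>\<^sup>+\<omega>. ennreal (c \<omega>) * (SUP i. U i) (X (Suc t) \<omega>) \<partial>N) =
        (\<integral>\<^sup>+\<omega>. (SUP i. ennreal (c \<omega>) * U i (X (Suc t) \<omega>)) \<partial>N)"
      by (simp add: SUP_apply SUP_mult_left_ennreal image_image)
    also have "\<dots> = (SUP i. \<integral>\<^sup>+\<omega>. ennreal (c \<omega>) * U i (X (Suc t) \<omega>) \<partial>N)"
      using seq.hyps(3) by (intro nn_integral_monotone_convergence_SUP)
        (auto simp: incseq_def le_fun_def intro!: mult_left_mono)
    also have "\<dots> = (SUP i. \<integral>\<^sup>+\<omega>. ennreal (c \<omega>) * (\<integral>\<^sup>+y. U i y \<partial>P (Suc t) (X t \<omega>)) \<partial>N)"
      using seq.IH by simp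
    also have "\<dots> = (\<integral>\<^sup>+\<omega>. (SUP i. ennreal (c \<omega>) * (\<integral>\<^sup>+y. U i y \<partial>P (Suc t) (X t \<omega>))) \<partial>N)"
      using seq.hyps(3) meas[OF seq.hyps(1)] by (intro nn_integral_monotone_convergence_SUP[symmetric])
        (auto simp: incseq_def le_fun_def intro!: mult_left_mono nn_integral_mono)
    also have "\<dots> = (\<integral>\<^sup>+\<omega>. ennreal (c \<omega>) * (\<integral>\<^sup>+y. (SUP i. U i) y \<partial>P (Suc t) (X t \<omega>)) \<partial>N)"
      by (intro nn_integral_cong) (simp only: * SUP_mult_left_ennreal)
    finally show ?case .
  qed
qed


lemma prob_kernel:
  assumes "K \<in> M \<rightarrow>\<^sub>M prob_algebra M" "x \<in> space M"
  shows "prob_space (K x)" "sets (K x) = sets M" "space (K x) = space M"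
  using measurable_space[OF assms] sets_eq_imp_space_eq[of "K x" M] by (auto simp: space_prob_algebra)

lemma bounded_measurable_kernel:
  assumes "K \<in> M \<rightarrow>\<^sub>M prob_algebra M" "x \<in> space M" "bounded_measurable M h"
  shows "bounded_measurable (K x) h"
  using assms(3) by (simp add: bounded_measurable_cong_sets[OF prob_kernel(2)[OF assms(1,2)]])

lemma integrable_kernel:
  assumes "K \<in> M \<rightarrow>\<^sub>M prob_algebra M" "x \<in> space M" "bounded_measurable M h"
  shows "integrable (K x) h"
proof -
  interpret prob_space "K x" using prob_kernel[OF assms(1,2)] by simp
  show ?thesis by (rule integrable_bounded_measurable[OF bounded_measurable_kernel[OF assms]])
qed

lemma bounded_measurable_kernel_mean:
  assumes K: "K \<in> M \<rightarrow>\<^sub>M prob_algebra M" and h: "bounded_measurable M h"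
  shows "bounded_measurable M (\<lambda>x. \<integral>y. h y \<partial>K x)"
proof -
  obtain B where B: "\<And>x. x \<in> space M \<Longrightarrow> norm (h x) \<le> B" using bounded_measurable_bound[OF h] by blast
  show ?thesis
  proof (rule bounded_measurableI)
    show "(\<lambda>x. \<integral>y. h y \<partial>K x) \<in> borel_measurable M"
      by (rule measurable_compose[OF measurable_prob_algebraD[OF K]
            integral_measurable_subprob_algebra[OF bounded_measurable_measurable[OF h]]])
    fix x assume x: "x \<in> space M"
    interpret prob_space "K x" using prob_kernel[OF K x] by simp
    have "norm (\<integral>y. h y \<partial>K x) \<le> (\<integral>y. norm (h y) \<partial>K x)" by (rule integral_norm_bound)
    also have "\<dots> \<le> (\<integral>y. B \<partial>K x)"
      using integrable_kernel[OF K x h] B prob_kernel(3)[OF K x] by (intro integral_mono) auto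
    finally show "norm (\<integral>y. h y \<partial>K x) \<le> B" by (simp add: prob_space)
  qed
qed

text \<open>Bounded functions of either sign become nonnegative after adding a constant. The sign of \<open>h\<close> is
  removed first, for a nonnegative weight; the sign of the weight then costs one more use of that
  case, with a constant weight.\<close>

lemma markov_chain_expectation_step_real:
  fixes c :: "'w \<Rightarrow> real" and h :: "'a \<Rightarrow> real"
  assumes chain: "markov_chain N M \<mu>0 P X"
    and c: "bounded_measurable (natural_sigma N M X t) c"
    and h: "bounded_measurable M h"
  shows "(\<integral>\<omega>. c \<omega> * h (X (Suc t) \<omega>) \<partial>N) = (\<integral>\<omega>. c \<omega> * (\<integral>y. h y \<partial>P (Suc t) (X t \<omega>)) \<partial>N)"
proof -
  have N: "prob_space N" and P: "P (Suc t) \<in> M \<rightarrow>\<^sub>M prob_algebra M" and X: "X s \<in> N \<rightarrow>\<^sub>M M" for s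
    using chain by (auto simp: markov_chain_def)
  interpret prob_space N by (rule N)
  have sub: "subalgebra N (natural_sigma N M X t)" by (rule subalgebra_natural_sigma[OF X])
  have toN: "bounded_measurable N c" if "bounded_measurable (natural_sigma N M X t) c" for c :: "'w \<Rightarrow> real"
    using that measurable_from_subalg[OF sub] sub by (auto simp: bounded_measurable_def subalgebra_def)
  have bm: "bounded_measurable N (\<lambda>\<omega>. c \<omega> * h (X s \<omega>))"
    if "bounded_measurable (natural_sigma N M X t) c" "bounded_measurable M h"
    for c :: "'w \<Rightarrow> real" and h s
    using bounded_measurable_inner[OF toN[OF that(1)] bounded_measurable_compose[OF that(2) X]] by simp
  have int: "integrable N (\<lambda>\<omega>. c \<omega> * h (X s \<omega>))"
    if "bounded_measurable (natural_sigma N M X t) c" "bounded_measurable M h"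
    for c :: "'w \<Rightarrow> real" and h s
    by (rule integrable_bounded_measurable[OF bm[OF that]])
  note km = bounded_measurable_kernel_mean[OF P]
  have pos: "(\<integral>\<omega>. c \<omega> * h (X (Suc t) \<omega>) \<partial>N) = (\<integral>\<omega>. c \<omega> * (\<integral>y. h y \<partial>P (Suc t) (X t \<omega>)) \<partial>N)"
    if c: "bounded_measurable (natural_sigma N M X t) c" and h: "bounded_measurable M h"
      and c0: "\<And>\<omega>. \<omega> \<in> space N \<Longrightarrow> 0 \<le> c \<omega>" and h0: "\<And>x. x \<in> space M \<Longrightarrow> 0 \<le> h x" for c :: "'w \<Rightarrow> real" and h :: "'a \<Rightarrow> real"
  proof -
    have ih: "ennreal (\<integral>y. h y \<partial>P (Suc t) (X t \<omega>)) = (\<integral>\<^sup>+y. ennreal (h y) \<partial>P (Suc t) (X t \<omega>))"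
      and ih0: "0 \<le> (\<integral>y. h y \<partial>P (Suc t) (X t \<omega>))"
      if "\<omega> \<in> space N" for \<omega>
    proof -
      have x: "X t \<omega> \<in> space M" using measurable_space[OF X that] .
      have "AE y in P (Suc t) (X t \<omega>). 0 \<le> h y"
        using h0 prob_kernel(3)[OF P x] by (intro AE_I2) auto
      then show "ennreal (\<integral>y. h y \<partial>P (Suc t) (X t \<omega>)) = (\<integral>\<^sup>+y. ennreal (h y) \<partial>P (Suc t) (X t \<omega>))"
        "0 \<le> (\<integral>y. h y \<partial>P (Suc t) (X t \<omega>))"
        using nn_integral_eq_integral[OF integrable_kernel[OF P x h]] by (auto intro: integral_nonneg_AE)
    qed
    have "ennreal (\<integral>\<omega>. c \<omega> * h (X (Suc t) \<omega>) \<partial>N) = (\<integral>\<^sup>+\<omega>. ennreal (c \<omega> * h (X (Suc t) \<omega>)) \<partial>N)"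
      using c0 h0 measurable_space[OF X]
      by (intro nn_integral_eq_integral[symmetric] int[OF c h]) (auto intro!: AE_I2)
    also have "\<dots> = (\<integral>\<^sup>+\<omega>. ennreal (c \<omega>) * ennreal (h (X (Suc t) \<omega>)) \<partial>N)"
      using c0 h0 measurable_space[OF X] by (intro nn_integral_cong) (simp add: ennreal_mult)
    also have "\<dots> = (\<integral>\<^sup>+\<omega>. ennreal (c \<omega>) * (\<integral>\<^sup>+y. ennreal (h y) \<partial>P (Suc t) (X t \<omega>)) \<partial>N)"
      by (rule markov_chain_nn_integral_step[OF chain c c0])
         (use bounded_measurable_measurable[OF h] in auto)
    also have "\<dots> = (\<integral>\<^sup>+\<omega>. ennreal (c \<omega> * (\<integral>y. h y \<partial>P (Suc t) (X t \<omega>))) \<partial>N)"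
      using c0 ih ih0 by (intro nn_integral_cong) (simp add: ennreal_mult)
    also have "\<dots> = ennreal (\<integral>\<omega>. c \<omega> * (\<integral>y. h y \<partial>P (Suc t) (X t \<omega>)) \<partial>N)"
      using c0 ih0 by (intro nn_integral_eq_integral int[OF c km[OF h]]) (auto intro!: AE_I2)
    finally show ?thesis
      using c0 h0 ih0 measurable_space[OF X]
      by (subst (asm) ennreal_inj) (auto intro!: integral_nonneg_AE AE_I2)
  qed
  obtain C where C: "C \<ge> 0" "\<And>\<omega>. \<omega> \<in> space N \<Longrightarrow> \<bar>c \<omega>\<bar> \<le> C"
    using bounded_measurable_bound[OF toN[OF c]] by auto
  obtain H where H: "H \<ge> 0" "\<And>x. x \<in> space M \<Longrightarrow> \<bar>h x\<bar> \<le> H"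
    using bounded_measurable_bound[OF h] by auto
  have cC: "bounded_measurable (natural_sigma N M X t) (\<lambda>\<omega>. c \<omega> + C)"
    by (intro bounded_measurable_add c) auto
  have hH: "bounded_measurable M (\<lambda>x. h x + H)" by (intro bounded_measurable_add h) auto
  have shift: "(\<integral>\<omega>. c' \<omega> * h (X (Suc t) \<omega>) \<partial>N) = (\<integral>\<omega>. c' \<omega> * (\<integral>y. h y \<partial>P (Suc t) (X t \<omega>)) \<partial>N)"
    if c': "bounded_measurable (natural_sigma N M X t) c'" "\<And>\<omega>. \<omega> \<in> space N \<Longrightarrow> 0 \<le> c' \<omega>" for c'
  proof -
    have ic': "integrable N c'" using toN[OF c'(1)] by (rule integrable_bounded_measurable)
    have "(\<integral>\<omega>. c' \<omega> * h (X (Suc t) \<omega>) \<partial>N) + (\<integral>\<omega>. c' \<omega> * H \<partial>N) = (\<integral>\<omega>. c' \<omega> * (h (X (Suc t) \<omega>) + H) \<partial>N)"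
      using int[OF c'(1) h, of "Suc t"] ic' by (simp add: distrib_left)
    also have "\<dots> = (\<integral>\<omega>. c' \<omega> * (\<integral>y. h y + H \<partial>P (Suc t) (X t \<omega>)) \<partial>N)"
      using H(2) by (intro pos[OF c'(1) hH c'(2)]) (force simp: abs_le_iff)+
    also have "\<dots> = (\<integral>\<omega>. c' \<omega> * ((\<integral>y. h y \<partial>P (Suc t) (X t \<omega>)) + H) \<partial>N)"
    proof (intro Bochner_Integration.integral_cong refl arg_cong2[where f = "(*)"])
      fix \<omega> assume "\<omega> \<in> space N"
      then have x: "X t \<omega> \<in> space M" using measurable_space[OF X] by blast
      interpret K: prob_space "P (Suc t) (X t \<omega>)" by (rule prob_kernel(1)[OF P x])
      show "(\<integral>y. h y + H \<partial>P (Suc t) (X t \<omega>)) = (\<integral>y. h y \<partial>P (Suc t) (X t \<omega>)) + H"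
        using integrable_kernel[OF P x h] by (simp add: K.prob_space)
    qed
    also have "\<dots> = (\<integral>\<omega>. c' \<omega> * (\<integral>y. h y \<partial>P (Suc t) (X t \<omega>)) \<partial>N) + (\<integral>\<omega>. c' \<omega> * H \<partial>N)"
      using int[OF c'(1) km[OF h], of t] ic' by (simp add: distrib_left)
    finally show ?thesis by simp
  qed
  have "(\<integral>\<omega>. c \<omega> * h (X (Suc t) \<omega>) \<partial>N) + (\<integral>\<omega>. C * h (X (Suc t) \<omega>) \<partial>N) = (\<integral>\<omega>. (c \<omega> + C) * h (X (Suc t) \<omega>) \<partial>N)"
    using int[OF c h, of "Suc t"] int[of "\<lambda>_. C", OF _ h, of "Suc t"]
    by (simp add: distrib_right)
  also have "\<dots> = (\<integral>\<omega>. (c \<omega> + C) * (\<integral>y. h y \<partial>P (Suc t) (X t \<omega>)) \<partial>N)"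
    using C(2) by (intro shift[OF cC]) (force simp: abs_le_iff)
  also have "\<dots> = (\<integral>\<omega>. c \<omega> * (\<integral>y. h y \<partial>P (Suc t) (X t \<omega>)) \<partial>N) +
      (\<integral>\<omega>. C * (\<integral>y. h y \<partial>P (Suc t) (X t \<omega>)) \<partial>N)"
    using int[OF c km[OF h], of t] int[of "\<lambda>_. C", OF _ km[OF h], of t]
    by (simp add: distrib_right)
  also have "(\<integral>\<omega>. C * (\<integral>y. h y \<partial>P (Suc t) (X t \<omega>)) \<partial>N) = (\<integral>\<omega>. C * h (X (Suc t) \<omega>) \<partial>N)"
    using C(1) by (intro shift[symmetric]) auto
  finally show ?thesis by simp
qed

text \<open>Vector-valued functions are treated one coordinate at a time.\<close>

lemma markov_chain_expectation_step:
  fixes c :: "'w \<Rightarrow> 'b::euclidean_space" and h :: "'a \<Rightarrow> 'b"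
  assumes chain: "markov_chain N M \<mu>0 P X"
    and c: "bounded_measurable (natural_sigma N M X t) c"
    and h: "bounded_measurable M h"
  shows "(\<integral>\<omega>. c \<omega> \<bullet> h (X (Suc t) \<omega>) \<partial>N) = (\<integral>\<omega>. c \<omega> \<bullet> (\<integral>y. h y \<partial>P (Suc t) (X t \<omega>)) \<partial>N)"
proof -
  have N: "prob_space N" and P: "P (Suc t) \<in> M \<rightarrow>\<^sub>M prob_algebra M" and X: "X s \<in> N \<rightarrow>\<^sub>M M" for s
    using chain by (auto simp: markov_chain_def)
  interpret prob_space N by (rule N)
  have sub: "subalgebra N (natural_sigma N M X t)" by (rule subalgebra_natural_sigma[OF X])
  have cb: "bounded_measurable (natural_sigma N M X t) (\<lambda>\<omega>. c \<omega> \<bullet> b)" for b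
    by (intro bounded_measurable_inner c) auto
  have hb: "bounded_measurable M (\<lambda>x. h x \<bullet> b)" for b
    by (intro bounded_measurable_inner h) auto
  have cN: "bounded_measurable N (\<lambda>\<omega>. c \<omega> \<bullet> b)" for b
    using cb[of b] measurable_from_subalg[OF sub] sub by (auto simp: bounded_measurable_def subalgebra_def)
  have int: "integrable N (\<lambda>\<omega>. (c \<omega> \<bullet> b) * (g (X s \<omega>) \<bullet> b))" if "bounded_measurable M g" for g b s
    using bounded_measurable_inner[OF cN[of b] bounded_measurable_compose[OF bounded_measurable_inner[OF that], of "\<lambda>_. b" "X s" N]] X
    by (intro integrable_bounded_measurable) auto
  have comp: "(\<integral>y. h y \<partial>P (Suc t) (X t \<omega>)) \<bullet> b = (\<integral>y. h y \<bullet> b \<partial>P (Suc t) (X t \<omega>))"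
    if "\<omega> \<in> space N" for \<omega> b
    using integrable_kernel[OF P measurable_space[OF X that] h] by simp
  have "(\<integral>\<omega>. c \<omega> \<bullet> h (X (Suc t) \<omega>) \<partial>N) = (\<integral>\<omega>. (\<Sum>b\<in>Basis. (c \<omega> \<bullet> b) * (h (X (Suc t) \<omega>) \<bullet> b)) \<partial>N)"
    by (subst euclidean_inner) simp
  also have "\<dots> = (\<Sum>b\<in>Basis. \<integral>\<omega>. (c \<omega> \<bullet> b) * (h (X (Suc t) \<omega>) \<bullet> b) \<partial>N)"
    by (intro Bochner_Integration.integral_sum int h)
  also have "\<dots> = (\<Sum>b\<in>Basis. \<integral>\<omega>. (c \<omega> \<bullet> b) * (\<integral>y. h y \<bullet> b \<partial>P (Suc t) (X t \<omega>)) \<partial>N)"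
    by (intro sum.cong refl markov_chain_expectation_step_real[OF chain cb hb])
  also have "\<dots> = (\<Sum>b\<in>Basis. \<integral>\<omega>. (c \<omega> \<bullet> b) * ((\<integral>y. h y \<partial>P (Suc t) (X t \<omega>)) \<bullet> b) \<partial>N)"
    by (intro sum.cong refl Bochner_Integration.integral_cong) (simp add: comp)
  also have "\<dots> = (\<integral>\<omega>. (\<Sum>b\<in>Basis. (c \<omega> \<bullet> b) * ((\<integral>y. h y \<partial>P (Suc t) (X t \<omega>)) \<bullet> b)) \<partial>N)"
    by (intro Bochner_Integration.integral_sum[symmetric] int bounded_measurable_kernel_mean[OF P h])
  also have "\<dots> = (\<integral>\<omega>. c \<omega> \<bullet> (\<integral>y. h y \<partial>P (Suc t) (X t \<omega>)) \<partial>N)"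
    by (subst euclidean_inner[symmetric]) simp
  finally show ?thesis .
qed

section \<open>Singular values and kernel means\<close>

lemma markov_chain_kernel_measurable:
  assumes "markov_chain N M \<mu>0 P X"
  shows "P (Suc t) \<in> M \<rightarrow>\<^sub>M prob_algebra M"
  using assms by (auto simp: markov_chain_def)

lemma markov_chain_expectation_kernel_mean:
  fixes h :: "'a \<Rightarrow> 'b::euclidean_space"
  assumes chain: "markov_chain N M \<mu>0 P X" and h: "bounded_measurable M h"
  shows "(\<integral>\<omega>. h (X (Suc t) \<omega>) \<partial>N) = (\<integral>\<omega>. (\<integral>y. h y \<partial>P (Suc t) (X t \<omega>)) \<partial>N)"
proof (rule euclidean_eqI)
  fix b :: 'b assume "b \<in> Basis"
  have N: "prob_space N" and X: "X s \<in> N \<rightarrow>\<^sub>M M" for s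
    using chain by (auto simp: markov_chain_def)
  interpret prob_space N by (rule N)
  have i: "integrable N (\<lambda>\<omega>. h (X (Suc t) \<omega>))" "integrable N (\<lambda>\<omega>. \<integral>y. h y \<partial>P (Suc t) (X t \<omega>))"
    by (intro integrable_bounded_measurable bounded_measurable_compose[OF h X]
        bounded_measurable_compose[OF bounded_measurable_kernel_mean[OF
            markov_chain_kernel_measurable[OF chain] h] X])+
  show "(\<integral>\<omega>. h (X (Suc t) \<omega>) \<partial>N) \<bullet> b = (\<integral>\<omega>. (\<integral>y. h y \<partial>P (Suc t) (X t \<omega>)) \<partial>N) \<bullet> b"
    using markov_chain_expectation_step[OF chain bounded_measurable_const[of _ b] h, where t = t] i
    by (simp add: inner_commute[of b])
qed

lemma (in prob_space) norm_integral_power2_le_nn_integral: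
  fixes f :: "'a \<Rightarrow> 'b::{banach, second_countable_topology}"
  assumes f [measurable]: "f \<in> borel_measurable M"
  shows "ennreal ((norm (\<integral>x. f x \<partial>M))\<^sup>2) \<le> (\<integral>\<^sup>+x. ennreal ((norm (f x))\<^sup>2) \<partial>M)"
proof -
  have "ennreal (norm (\<integral>x. f x \<partial>M)) \<le> (\<integral>\<^sup>+x. ennreal (norm (f x)) \<partial>M)"
    by (cases "integrable M f") (auto intro: integral_norm_bound_ennreal simp: not_integrable_integral_eq)
  then have "(ennreal (norm (\<integral>x. f x \<partial>M)))\<^sup>2 \<le> (\<integral>\<^sup>+x. ennreal (norm (f x)) \<partial>M)\<^sup>2"
    by (rule power_mono) simp
  also have "\<dots> \<le> (\<integral>\<^sup>+x. (ennreal (norm (f x)))\<^sup>2 \<partial>M)"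
    using Cauchy_Schwarz_nn_integral[of "\<lambda>x. ennreal (norm (f x))" M "\<lambda>_. 1"]
    by (simp add: emeasure_space_1)
  finally show ?thesis by (simp add: ennreal_power)
qed

text \<open>Jensen's inequality for each \<open>P (Suc t) x\<close>, averaged over the law of \<open>X t\<close>. Unbounded \<open>f\<close> have to be
  admitted, since the supremum defining the singular value runs over the whole of \<open>L\<^sup>2\<close>. This is
  why both sides are integrals with values in the extended nonnegative reals.\<close>

lemma kernel_mean_L2_contraction:
  fixes f :: "'a \<Rightarrow> 'b::{banach, second_countable_topology}"
  assumes chain: "markov_chain N M \<mu>0 P X" and f: "f \<in> borel_measurable M"
  shows "(\<integral>\<^sup>+\<omega>. ennreal ((norm (\<integral>y. f y \<partial>P (Suc t) (X t \<omega>)))\<^sup>2) \<partial>N) \<le>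
    (\<integral>\<^sup>+\<omega>. ennreal ((norm (f (X (Suc t) \<omega>)))\<^sup>2) \<partial>N)"
proof -
  have X: "X s \<in> N \<rightarrow>\<^sub>M M" for s using chain by (auto simp: markov_chain_def)
  note P = markov_chain_kernel_measurable[OF chain, of t]
  have "(\<integral>\<^sup>+\<omega>. ennreal ((norm (\<integral>y. f y \<partial>P (Suc t) (X t \<omega>)))\<^sup>2) \<partial>N) \<le>
      (\<integral>\<^sup>+\<omega>. (\<integral>\<^sup>+y. ennreal ((norm (f y))\<^sup>2) \<partial>P (Suc t) (X t \<omega>)) \<partial>N)"
  proof (rule nn_integral_mono)
    fix \<omega> assume "\<omega> \<in> space N"
    then have x: "X t \<omega> \<in> space M" using measurable_space[OF X] by blast
    interpret K: prob_space "P (Suc t) (X t \<omega>)" by (rule prob_kernel(1)[OF P x])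
    show "ennreal ((norm (\<integral>y. f y \<partial>P (Suc t) (X t \<omega>)))\<^sup>2) \<le> (\<integral>\<^sup>+y. ennreal ((norm (f y))\<^sup>2) \<partial>P (Suc t) (X t \<omega>))"
      by (rule K.norm_integral_power2_le_nn_integral)
         (simp add: measurable_cong_sets[OF prob_kernel(2)[OF P x] refl] f)
  qed
  also have "\<dots> = (\<integral>\<^sup>+\<omega>. ennreal ((norm (f (X (Suc t) \<omega>)))\<^sup>2) \<partial>N)"
    using markov_chain_nn_integral_step[OF chain, of t "\<lambda>_. 1" "\<lambda>y. ennreal ((norm (f y))\<^sup>2)"] f
    by simp
  finally show ?thesis .
qed

lemma L2_norm_distr:
  assumes "X \<in> N \<rightarrow>\<^sub>M M" "f \<in> borel_measurable M"
  shows "L2_norm (distr N M X) f = sqrt (\<integral>\<omega>. (norm (f (X \<omega>)))\<^sup>2 \<partial>N)"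
  unfolding L2_norm_def using assms by (subst integral_distr) auto

text \<open>The set whose supremum is the singular value of the step from \<open>t\<close> to \<open>t + 1\<close>.\<close>

definition mean_zero_unit_norms ::
  "'w measure \<Rightarrow> 'a measure \<Rightarrow> (nat \<Rightarrow> 'a \<Rightarrow> 'a measure) \<Rightarrow> (nat \<Rightarrow> 'w \<Rightarrow> 'a) \<Rightarrow> nat \<Rightarrow> real set" where
  "mean_zero_unit_norms N M P X t = insert 0 {L2_norm (distr N M (X t)) (kernel_op (P (Suc t)) f) | f.
     f \<in> borel_measurable (distr N M (X (Suc t))) \<and>
     integrable (distr N M (X (Suc t))) (\<lambda>x. (norm (f x))\<^sup>2) \<and>
     L2_norm (distr N M (X (Suc t))) f = 1 \<and> (\<integral>x. f x \<partial>distr N M (X (Suc t))) = 0}"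

lemma chain_sigma_Suc: "chain_sigma N M P X (Suc t) = Sup (mean_zero_unit_norms N M P X t)"
  by (simp add: chain_sigma_def singular_value_def mean_zero_unit_norms_def)

text \<open>Without an upper bound the supremum of a set of reals would carry no information.\<close>

lemma bdd_above_mean_zero_unit_norms:
  assumes chain: "markov_chain N M \<mu>0 P X"
  shows "bdd_above (mean_zero_unit_norms N M P X t)"
proof (rule bdd_aboveI)
  have X: "X s \<in> N \<rightarrow>\<^sub>M M" for s using chain by (auto simp: markov_chain_def)
  note P = markov_chain_kernel_measurable[OF chain, of t]
  fix r assume "r \<in> mean_zero_unit_norms N M P X t"
  then consider "r = 0" | f where "r = L2_norm (distr N M (X t)) (kernel_op (P (Suc t)) f)"
    "f \<in> borel_measurable M" "integrable (distr N M (X (Suc t))) (\<lambda>x. (norm (f x))\<^sup>2)"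
    "L2_norm (distr N M (X (Suc t))) f = 1"
    unfolding mean_zero_unit_norms_def by auto
  then show "r \<le> 1"
  proof cases
    case 2
    note f = this
    have k: "kernel_op (P (Suc t)) f \<in> borel_measurable M"
      unfolding kernel_op_def
      by (rule measurable_compose[OF measurable_prob_algebraD[OF P] integral_measurable_subprob_algebra[OF f(2)]])
    have int: "integrable N (\<lambda>\<omega>. (norm (f (X (Suc t) \<omega>)))\<^sup>2)"
      using f(2,3) X by (subst (asm) integrable_distr_eq) auto
    have one: "(\<integral>\<omega>. (norm (f (X (Suc t) \<omega>)))\<^sup>2 \<partial>N) = 1"
      using f(4) L2_norm_distr[OF X f(2), of "Suc t"] by simp
    have "(\<integral>\<omega>. (norm (kernel_op (P (Suc t)) f (X t \<omega>)))\<^sup>2 \<partial>N) =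
        enn2real (\<integral>\<^sup>+\<omega>. ennreal ((norm (kernel_op (P (Suc t)) f (X t \<omega>)))\<^sup>2) \<partial>N)"
      using measurable_compose[OF X k] by (intro integral_eq_nn_integral) auto
    also have "\<dots> \<le> enn2real (\<integral>\<^sup>+\<omega>. ennreal ((norm (f (X (Suc t) \<omega>)))\<^sup>2) \<partial>N)"
      using kernel_mean_L2_contraction[OF chain f(2), of t] nn_integral_eq_integral[OF int]
      unfolding kernel_op_def by (intro enn2real_mono) (auto simp: one)
    also have "\<dots> = 1" using nn_integral_eq_integral[OF int] by (simp add: one)
    finally show "r \<le> 1" unfolding f(1) L2_norm_distr[OF X k] by simp
  qed simp
qed

lemma chain_sigma_nonneg:
  assumes "markov_chain N M \<mu>0 P X"
  shows "0 \<le> chain_sigma N M P X (Suc t)"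
  unfolding chain_sigma_Suc
  by (rule cSup_upper[OF _ bdd_above_mean_zero_unit_norms[OF assms]]) (simp add: mean_zero_unit_norms_def)

text \<open>Normalising \<open>f\<close> to a unit vector makes it admissible in the supremum. If \<open>f\<close> vanishes in \<open>L\<^sup>2\<close> this is
  impossible, but then its kernel mean vanishes too, by contractivity.\<close>

lemma kernel_mean_le_chain_sigma_complex:
  fixes f :: "'a \<Rightarrow> complex"
  assumes chain: "markov_chain N M \<mu>0 P X" and f: "bounded_measurable M f"
    and mean: "(\<integral>\<omega>. f (X (Suc t) \<omega>) \<partial>N) = 0"
  shows "(\<integral>\<omega>. (norm (\<integral>y. f y \<partial>P (Suc t) (X t \<omega>)))\<^sup>2 \<partial>N) \<le>
    (chain_sigma N M P X (Suc t))\<^sup>2 * (\<integral>\<omega>. (norm (f (X (Suc t) \<omega>)))\<^sup>2 \<partial>N)"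
proof -
  have N: "prob_space N" and X: "X s \<in> N \<rightarrow>\<^sub>M M" for s using chain by (auto simp: markov_chain_def)
  interpret prob_space N by (rule N)
  note P = markov_chain_kernel_measurable[OF chain, of t]
  define s where "s = (\<integral>\<omega>. (norm (f (X (Suc t) \<omega>)))\<^sup>2 \<partial>N)"
  have s0: "s \<ge> 0" unfolding s_def by (rule integral_nonneg_AE) simp
  have fm: "f \<in> borel_measurable M" using f by (rule bounded_measurable_measurable)
  have int: "integrable N (\<lambda>\<omega>. (norm (f (X (Suc t) \<omega>)))\<^sup>2)"
    by (intro integrable_bounded_measurable bounded_measurable_norm_power2 bounded_measurable_compose[OF f X])
  have intk: "integrable N (\<lambda>\<omega>. (norm (\<integral>y. f y \<partial>P (Suc t) (X t \<omega>)))\<^sup>2)"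
    by (intro integrable_bounded_measurable bounded_measurable_norm_power2
        bounded_measurable_compose[OF bounded_measurable_kernel_mean[OF P f] X])
  show ?thesis
  proof (cases "s = 0")
    case True
    have "ennreal (\<integral>\<omega>. (norm (\<integral>y. f y \<partial>P (Suc t) (X t \<omega>)))\<^sup>2 \<partial>N) \<le> ennreal s"
      using kernel_mean_L2_contraction[OF chain fm, of t]
        nn_integral_eq_integral[OF int] nn_integral_eq_integral[OF intk] by (simp add: s_def)
    then have "(\<integral>\<omega>. (norm (\<integral>y. f y \<partial>P (Suc t) (X t \<omega>)))\<^sup>2 \<partial>N) \<le> s"
      using s0 by (simp add: ennreal_le_iff)
    then show ?thesis using True by (simp add: s_def)
  next
    case False
    then have s: "s > 0" using s0 by simp
    define c where "c = 1 / sqrt s"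
    have c: "c > 0" "c\<^sup>2 * s = 1" using s by (simp_all add: c_def power_divide)
    define g where "g y = of_real c * f y" for y
    have gm: "g \<in> borel_measurable M" using fm unfolding g_def by measurable
    have ng: "(norm (g y))\<^sup>2 = c\<^sup>2 * (norm (f y))\<^sup>2" for y
      by (simp add: g_def norm_mult power_mult_distrib)
    have kg: "kernel_op (P (Suc t)) g x = of_real c * (\<integral>y. f y \<partial>P (Suc t) x)" for x
      by (simp add: kernel_op_def g_def)
    have kgm: "kernel_op (P (Suc t)) g \<in> borel_measurable M"
      unfolding kernel_op_def
      by (rule measurable_compose[OF measurable_prob_algebraD[OF P] integral_measurable_subprob_algebra[OF gm]])
    have "L2_norm (distr N M (X t)) (kernel_op (P (Suc t)) g) \<in> mean_zero_unit_norms N M P X t"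
      unfolding mean_zero_unit_norms_def
    proof (rule insertI2, rule CollectI, rule exI[of _ g], intro conjI)
      show "g \<in> borel_measurable (distr N M (X (Suc t)))" using gm by simp
      show "integrable (distr N M (X (Suc t))) (\<lambda>x. (norm (g x))\<^sup>2)"
        using int gm fm X by (subst integrable_distr_eq) (auto simp: ng)
      show "L2_norm (distr N M (X (Suc t))) g = 1"
        using c(2) by (simp add: L2_norm_distr[OF X gm] ng s_def)
      show "(\<integral>x. g x \<partial>distr N M (X (Suc t))) = 0"
        using mean gm X by (subst integral_distr) (auto simp: g_def)
    qed (rule refl)
    then have "L2_norm (distr N M (X t)) (kernel_op (P (Suc t)) g) \<le> chain_sigma N M P X (Suc t)"
      unfolding chain_sigma_Suc by (rule cSup_upper[OF _ bdd_above_mean_zero_unit_norms[OF chain]])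
    then have "(L2_norm (distr N M (X t)) (kernel_op (P (Suc t)) g))\<^sup>2 \<le> (chain_sigma N M P X (Suc t))\<^sup>2"
      by (rule power_mono) (simp add: L2_norm_def)
    also have "(L2_norm (distr N M (X t)) (kernel_op (P (Suc t)) g))\<^sup>2 =
        c\<^sup>2 * (\<integral>\<omega>. (norm (\<integral>y. f y \<partial>P (Suc t) (X t \<omega>)))\<^sup>2 \<partial>N)"
      unfolding L2_norm_distr[OF X kgm]
      by (simp add: kg norm_mult power_mult_distrib integral_nonneg_AE)
    finally have "s * (c\<^sup>2 * (\<integral>\<omega>. (norm (\<integral>y. f y \<partial>P (Suc t) (X t \<omega>)))\<^sup>2 \<partial>N)) \<le>
        s * (chain_sigma N M P X (Suc t))\<^sup>2"
      using s0 by (rule mult_left_mono)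
    then show ?thesis using c(2) unfolding s_def[symmetric] mult.assoc[symmetric]
      by (simp add: mult.commute)
  qed
qed

lemma norm_matrix_power2: "(norm (A :: complex ^ 'm ^ 'm))\<^sup>2 = (\<Sum>i\<in>UNIV. \<Sum>j\<in>UNIV. (norm (A $ i $ j))\<^sup>2)"
  by (simp add: norm_vec_def L2_set_def real_sqrt_pow2 sum_nonneg)

lemma bounded_linear_entry: "bounded_linear (\<lambda>A :: complex ^ 'm ^ 'm. A $ i $ j)"
  using bounded_linear_compose[OF bounded_linear_vec_nth[of j] bounded_linear_vec_nth[of i]]
  by (simp add: o_def)

text \<open>The squared Frobenius norm is the sum of the squared moduli of the entries, so the singular value
  of the scalar chain also governs matrix-valued functions.\<close>

lemma kernel_mean_le_chain_sigma:
  fixes h :: "'a \<Rightarrow> complex ^ 'm ^ 'm"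
  assumes chain: "markov_chain N M \<mu>0 P X" and h: "bounded_measurable M h"
    and mean: "(\<integral>\<omega>. h (X (Suc t) \<omega>) \<partial>N) = 0"
  shows "(\<integral>\<omega>. (norm (\<integral>y. h y \<partial>P (Suc t) (X t \<omega>)))\<^sup>2 \<partial>N) \<le>
    (chain_sigma N M P X (Suc t))\<^sup>2 * (\<integral>\<omega>. (norm (h (X (Suc t) \<omega>)))\<^sup>2 \<partial>N)"
proof -
  have N: "prob_space N" and X: "X s \<in> N \<rightarrow>\<^sub>M M" for s using chain by (auto simp: markov_chain_def)
  interpret prob_space N by (rule N)
  note P = markov_chain_kernel_measurable[OF chain, of t]
  have e: "bounded_measurable M (\<lambda>x. h x $ i $ j)" for i j
    by (rule bounded_measurable_bounded_linear[OF h bounded_linear_entry])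
  have ih: "integrable N (\<lambda>\<omega>. h (X (Suc t) \<omega>))"
    by (intro integrable_bounded_measurable bounded_measurable_compose[OF h X])
  have int: "integrable N (\<lambda>\<omega>. (norm (h (X (Suc t) \<omega>) $ i $ j))\<^sup>2)" for i j
    by (intro integrable_bounded_measurable bounded_measurable_norm_power2 bounded_measurable_compose[OF e X])
  have intk: "integrable N (\<lambda>\<omega>. (norm (\<integral>y. h y $ i $ j \<partial>P (Suc t) (X t \<omega>)))\<^sup>2)" for i j
    by (intro integrable_bounded_measurable bounded_measurable_norm_power2
        bounded_measurable_compose[OF bounded_measurable_kernel_mean[OF P e] X])
  have entry: "(\<integral>y. h y \<partial>P (Suc t) (X t \<omega>)) $ i $ j = (\<integral>y. h y $ i $ j \<partial>P (Suc t) (X t \<omega>))"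
    if "\<omega> \<in> space N" for \<omega> i j
    by (rule integral_bounded_linear[OF bounded_linear_entry
          integrable_kernel[OF P measurable_space[OF X that] h], symmetric])
  have m0: "(\<integral>\<omega>. h (X (Suc t) \<omega>) $ i $ j \<partial>N) = 0" for i j
    using integral_bounded_linear[OF bounded_linear_entry ih, of i j] mean by simp
  have "(\<integral>\<omega>. (norm (\<integral>y. h y \<partial>P (Suc t) (X t \<omega>)))\<^sup>2 \<partial>N) =
      (\<integral>\<omega>. (\<Sum>i\<in>UNIV. \<Sum>j\<in>UNIV. (norm (\<integral>y. h y $ i $ j \<partial>P (Suc t) (X t \<omega>)))\<^sup>2) \<partial>N)"
    by (intro Bochner_Integration.integral_cong refl) (simp add: norm_matrix_power2 entry)
  also have "\<dots> = (\<Sum>i\<in>UNIV. \<Sum>j\<in>UNIV. \<integral>\<omega>. (norm (\<integral>y. h y $ i $ j \<partial>P (Suc t) (X t \<omega>)))\<^sup>2 \<partial>N)"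
    using intk by (subst Bochner_Integration.integral_sum) (auto intro!: sum.cong)
  also have "\<dots> \<le> (\<Sum>i\<in>UNIV. \<Sum>j\<in>UNIV. (chain_sigma N M P X (Suc t))\<^sup>2 *
      (\<integral>\<omega>. (norm (h (X (Suc t) \<omega>) $ i $ j))\<^sup>2 \<partial>N))"
    by (intro sum_mono kernel_mean_le_chain_sigma_complex[OF chain e m0])
  also have "\<dots> = (chain_sigma N M P X (Suc t))\<^sup>2 *
      (\<Sum>i\<in>UNIV. \<Sum>j\<in>UNIV. \<integral>\<omega>. (norm (h (X (Suc t) \<omega>) $ i $ j))\<^sup>2 \<partial>N)"
    by (simp add: sum_distrib_left)
  also have "(\<Sum>i\<in>UNIV. \<Sum>j\<in>UNIV. \<integral>\<omega>. (norm (h (X (Suc t) \<omega>) $ i $ j))\<^sup>2 \<partial>N) =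
      (\<integral>\<omega>. (\<Sum>i\<in>UNIV. \<Sum>j\<in>UNIV. (norm (h (X (Suc t) \<omega>) $ i $ j))\<^sup>2) \<partial>N)"
    using int by (subst Bochner_Integration.integral_sum) (auto intro!: sum.cong)
  finally show ?thesis by (simp add: norm_matrix_power2)
qed

section \<open>Conjugation by one factor\<close>

lemma norm_matrix_mult_le: "norm (A ** B) \<le> norm A * norm B" for A B :: "complex ^ 'm ^ 'm"
  by (rule norm_mult_left_le) (auto intro: norm_matrix_vector_le_norm)

lemma bounded_bilinear_matrix_mult:
  "bounded_bilinear ((**) :: complex ^ 'm ^ 'm \<Rightarrow> complex ^ 'm ^ 'm \<Rightarrow> complex ^ 'm ^ 'm)"
proof
  fix A B C :: "complex ^ 'm ^ 'm" and r :: real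
  show "(A + B) ** C = A ** C + B ** C" by (rule matrix_add_rdistrib)
  show "A ** (B + C) = A ** B + A ** C" by (rule matrix_add_ldistrib)
  show "(r *\<^sub>R A) ** B = r *\<^sub>R (A ** B)" "A ** (r *\<^sub>R B) = r *\<^sub>R (A ** B)"
    by (simp_all add: matrix_matrix_mult_def vec_eq_iff scaleR_sum_right)
  show "\<exists>K. \<forall>(A :: complex ^ 'm ^ 'm) (B :: complex ^ 'm ^ 'm). norm (A ** B) \<le> norm A * norm B * K"
    by (intro exI[of _ 1]) (simp add: norm_matrix_mult_le)
qed

lemma bounded_linear_ctranspose: "bounded_linear (ctranspose :: complex ^ 'm ^ 'm \<Rightarrow> _)"
  by (rule linear_conv_bounded_linear[THEN iffD1], rule linearI) (simp_all add: vec_eq_iff)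

lemma bounded_linear_cscale: "bounded_linear (cscale c :: complex ^ 'm ^ 'm \<Rightarrow> _)"
  by (rule linear_conv_bounded_linear[THEN iffD1], rule linearI)
     (simp_all add: vec_eq_iff algebra_simps)

lemmas bounded_measurable_matrix_mult =
  bounded_measurable_bounded_bilinear[OF _ _ bounded_bilinear_matrix_mult]
lemmas bounded_measurable_ctranspose =
  bounded_measurable_bounded_linear[OF _ bounded_linear_ctranspose]
lemmas bounded_measurable_cscale =
  bounded_measurable_bounded_linear[OF _ bounded_linear_cscale]

text \<open>Conjugation of \<open>W\<close> by a factor \<open>c I + z A\<close> with \<open>\<bar>z\<bar> = 1\<close> is a scalar multiple of \<open>W\<close> plus this
  perturbation of order \<open>\<parallel>A\<parallel>\<close>.\<close>

definition conj_deviation ::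
  "real \<Rightarrow> complex \<Rightarrow> complex ^ 'm ^ 'm \<Rightarrow> complex ^ 'm ^ 'm \<Rightarrow> complex ^ 'm ^ 'm" where
  "conj_deviation \<kappa> z A W =
    cscale ((1 + of_real \<kappa> * z\<^sup>2) * cnj z) (A ** W) +
    cscale (cnj (1 + of_real \<kappa> * z\<^sup>2) * z) (W ** A) + A ** W ** A"

lemma rotation_step_conjugation:
  fixes A W :: "complex ^ 'm ^ 'm"
  assumes A: "hermitian A" and z: "norm z = 1"
  shows "ctranspose (rotation_step \<kappa> z A) ** W ** rotation_step \<kappa> z A =
    (norm (1 + of_real \<kappa> * z\<^sup>2))\<^sup>2 *\<^sub>R W + conj_deviation \<kappa> z A W"
proof -
  define c where "c = 1 + of_real \<kappa> * z\<^sup>2"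
  have 1: "ctranspose (rotation_step \<kappa> z A) ** W = cscale (cnj c) W + cscale (cnj z) (A ** W)"
    using A unfolding rotation_step_def c_def[symmetric]
    by (simp add: ctranspose_add ctranspose_cscale matrix_add_rdistrib cscale_mult_left hermitian_def)
  have 2: "V ** rotation_step \<kappa> z A = cscale c V + cscale z (V ** A)" for V
    unfolding rotation_step_def c_def[symmetric]
    by (simp add: matrix_add_ldistrib cscale_mult_right)
  have zz: "cnj z * z = 1" "z * cnj z = 1"
    using z complex_norm_square[of z] by (simp_all add: mult.commute)
  have cc: "cscale (c * cnj c) W = (norm c)\<^sup>2 *\<^sub>R W"
    unfolding complex_norm_square[of c, symmetric]
    by (simp add: vec_eq_iff scaleR_conv_of_real[of _ "_ :: complex"])
  have one: "cscale 1 V = V" for V :: "complex ^ 'm ^ 'm" by (simp add: vec_eq_iff)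
  show ?thesis
    unfolding 1 2 conj_deviation_def c_def[symmetric] cc[symmetric]
    by (simp add: matrix_add_rdistrib cscale_mult_left cscale_add cscale_cscale zz one mult_ac)
qed

lemma norm_conj_deviation_le:
  fixes A W :: "complex ^ 'm ^ 'm"
  assumes A: "hermitian A" "\<And>v. norm (A *v v) \<le> \<beta> * norm v" and \<beta>: "0 \<le> \<beta>" and \<kappa>: "0 \<le> \<kappa>"
    and z: "norm z = 1"
  shows "norm (conj_deviation \<kappa> z A W) \<le> (2 * \<beta> * (1 + \<kappa>) + \<beta>\<^sup>2) * norm W"
proof -
  define c where "c = 1 + of_real \<kappa> * z\<^sup>2"
  have c: "norm c \<le> 1 + \<kappa>"
    unfolding c_def using norm_triangle_ineq[of 1 "of_real \<kappa> * z\<^sup>2"] z \<kappa>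
    by (simp add: norm_mult norm_power)
  have l: "norm (A ** V) \<le> \<beta> * norm V" for V :: "complex ^ 'm ^ 'm" by (rule norm_mult_left_le[OF A(2) \<beta>])
  have r: "norm (V ** A) \<le> \<beta> * norm V" for V :: "complex ^ 'm ^ 'm" by (rule norm_mult_right_le[OF A \<beta>])
  have "norm (cscale (c * cnj z) (A ** W)) \<le> (1 + \<kappa>) * (\<beta> * norm W)"
    unfolding norm_cscale using z c l \<kappa> by (intro mult_mono) (auto simp: norm_mult)
  moreover have "norm (cscale (cnj c * z) (W ** A)) \<le> (1 + \<kappa>) * (\<beta> * norm W)"
    unfolding norm_cscale using z c r \<kappa> by (intro mult_mono) (auto simp: norm_mult)
  moreover have "norm (A ** W ** A) \<le> \<beta> * (\<beta> * norm W)"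
    by (rule order_trans[OF r mult_left_mono[OF l \<beta>]])
  ultimately have "norm (conj_deviation \<kappa> z A W) \<le>
      (1 + \<kappa>) * (\<beta> * norm W) + (1 + \<kappa>) * (\<beta> * norm W) + \<beta> * (\<beta> * norm W)"
    unfolding conj_deviation_def c_def[symmetric] by (intro norm_triangle_mono)
  then show ?thesis by (simp add: power2_eq_square algebra_simps)
qed

lemma bounded_measurable_conj_deviation:
  assumes "bounded_measurable M A" "bounded_measurable M W"
  shows "bounded_measurable M (\<lambda>x. conj_deviation \<kappa> z (A x) (W x))"
  unfolding conj_deviation_def
  by (intro bounded_measurable_add bounded_measurable_cscale bounded_measurable_matrix_mult assms)

lemma conj_deviation_add:
  "conj_deviation \<kappa> z A (V + W) = conj_deviation \<kappa> z A V + conj_deviation \<kappa> z A W"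
  by (simp add: conj_deviation_def matrix_add_rdistrib matrix_add_ldistrib cscale_add)

text \<open>For constant \<open>W\<close> the part of the perturbation that is linear in \<open>A\<close> has mean zero, which leaves
  the quadratic part \<open>A W A\<close>. This improves the pointwise order \<open>\<beta>\<close> to \<open>\<beta>\<^sup>2\<close>, and the Gaussian
  shape of the final bound rests on it.\<close>

lemma (in prob_space) norm_expectation_conj_deviation_const_le:
  fixes A :: "'a \<Rightarrow> complex ^ 'm ^ 'm"
  assumes Ab: "bounded_measurable M A" and mean: "expectation A = 0"
    and A: "\<And>x. x \<in> space M \<Longrightarrow> hermitian (A x)"
      "\<And>x v. x \<in> space M \<Longrightarrow> norm (A x *v v) \<le> \<beta> * norm v" and \<beta>: "0 \<le> \<beta>"
  shows "norm (\<integral>x. conj_deviation \<kappa> z (A x) W \<partial>M) \<le> \<beta>\<^sup>2 * norm W"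
proof -
  define l where "l V = cscale ((1 + of_real \<kappa> * z\<^sup>2) * cnj z) (V ** W) +
    cscale (cnj (1 + of_real \<kappa> * z\<^sup>2) * z) (W ** V)" for V :: "complex ^ 'm ^ 'm"
  have l: "bounded_linear l"
    unfolding l_def
    by (intro bounded_linear_add bounded_linear_compose[OF bounded_linear_cscale]
        bounded_bilinear.bounded_linear_left[OF bounded_bilinear_matrix_mult]
        bounded_bilinear.bounded_linear_right[OF bounded_bilinear_matrix_mult])
  have i: "integrable M A" by (rule integrable_bounded_measurable[OF Ab])
  have q: "bounded_measurable M (\<lambda>x. A x ** W ** A x)"
    by (intro bounded_measurable_matrix_mult Ab bounded_measurable_const)
  have lin: "(\<integral>x. l (A x) \<partial>M) = 0" "integrable M (\<lambda>x. l (A x))"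
    using integral_bounded_linear[OF l i] integrable_bounded_linear[OF l i] mean
      bounded_linear.linear[OF l] by (simp_all add: linear_0)
  have "(\<integral>x. conj_deviation \<kappa> z (A x) W \<partial>M) = (\<integral>x. l (A x) + A x ** W ** A x \<partial>M)"
    by (simp add: conj_deviation_def l_def)
  also have "\<dots> = (\<integral>x. A x ** W ** A x \<partial>M)"
    using lin integrable_bounded_measurable[OF q] by simp
  also have "norm \<dots> \<le> (\<integral>x. norm (A x ** W ** A x) \<partial>M)" by (rule integral_norm_bound)
  also have "\<dots> \<le> (\<integral>x. \<beta>\<^sup>2 * norm W \<partial>M)"
  proof (rule integral_mono)
    show "integrable M (\<lambda>x. norm (A x ** W ** A x))"
      using integrable_bounded_measurable[OF q] by simp
    fix x assume x: "x \<in> space M"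
    show "norm (A x ** W ** A x) \<le> \<beta>\<^sup>2 * norm W"
      using order_trans[OF norm_mult_right_le[OF A(1,2)[OF x] \<beta>, of "A x ** W"]
          mult_left_mono[OF norm_mult_left_le[OF A(2)[OF x] \<beta>, of W] \<beta>]]
      by (simp add: power2_eq_square mult.assoc)
  qed simp
  finally show ?thesis by (simp add: prob_space)
qed

section \<open>Moment recursion along the chain\<close>

lemma (in prob_space) expectation_le_L2:
  assumes "bounded_measurable M (u :: 'a \<Rightarrow> real)"
  shows "expectation u \<le> sqrt (\<integral>x. (u x)\<^sup>2 \<partial>M)"
proof (rule real_le_rsqrt)
  show "(expectation u)\<^sup>2 \<le> (\<integral>x. (u x)\<^sup>2 \<partial>M)"
    using norm_expectation_power2_le[OF assms] by simp
qed

lemma bounded_measurable_norm: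
  assumes "bounded_measurable M f" shows "bounded_measurable M (\<lambda>x. norm (f x))"
  using assms by (auto simp: bounded_measurable_def)

lemma bounded_measurable_mono_sigma:
  assumes "bounded_measurable F f" "subalgebra N F"
  shows "bounded_measurable N f"
  using assms measurable_from_subalg[OF assms(2)] by (auto simp: bounded_measurable_def subalgebra_def)

text \<open>A chain together with bounded Hermitian matrix functions that have mean zero at each time. In the
  application \<open>A t\<close> is a small multiple of \<open>F t\<close> minus its mean. Times are written \<open>Suc t\<close> because
  both the kernels and the matrices start at time 1.\<close>

locale centered_matrix_chain =
  fixes N :: "'w measure" and M :: "'a measure" and \<mu>0 :: "'a measure"
    and P :: "nat \<Rightarrow> 'a \<Rightarrow> 'a measure" and X :: "nat \<Rightarrow> 'w \<Rightarrow> 'a"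
    and A :: "nat \<Rightarrow> 'a \<Rightarrow> complex ^ 'm ^ 'm" and \<beta> :: real
  assumes chain: "markov_chain N M \<mu>0 P X"
    and A_measurable: "\<And>t. A (Suc t) \<in> borel_measurable M"
    and A_hermitian: "\<And>t x. x \<in> space M \<Longrightarrow> hermitian (A (Suc t) x)"
    and A_bound: "\<And>t x v. x \<in> space M \<Longrightarrow> norm (A (Suc t) x *v v) \<le> \<beta> * norm v"
    and A_mean: "\<And>t. (\<integral>\<omega>. A (Suc t) (X (Suc t) \<omega>) \<partial>N) = 0"
    and \<beta>: "0 \<le> \<beta>" "\<beta> \<le> 1"
begin

sublocale prob_space N
  using chain by (simp add: markov_chain_def)

lemma X_measurable: "X t \<in> N \<rightarrow>\<^sub>M M"
  using chain by (simp add: markov_chain_def)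

lemma X_space: "\<omega> \<in> space N \<Longrightarrow> X t \<omega> \<in> space M"
  by (rule measurable_space[OF X_measurable])

lemma kernel: "P (Suc t) \<in> M \<rightarrow>\<^sub>M prob_algebra M"
  by (rule markov_chain_kernel_measurable[OF chain])

lemma A_bounded: "bounded_measurable M (A (Suc t))"
proof (rule bounded_measurableI[OF A_measurable])
  fix x assume x: "x \<in> space M"
  show "norm (A (Suc t) x) \<le> \<beta> * norm (mat 1 :: complex ^ 'm ^ 'm)"
    using norm_mult_left_le[OF A_bound[OF x] \<beta>(1), of t "mat 1"] by simp
qed

definition mean_norm :: "nat \<Rightarrow> ('a \<Rightarrow> complex ^ 'm ^ 'm) \<Rightarrow> real" where
  "mean_norm t g = norm (\<integral>\<omega>. g (X t \<omega>) \<partial>N)"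

definition deviation :: "nat \<Rightarrow> ('a \<Rightarrow> complex ^ 'm ^ 'm) \<Rightarrow> real" where
  "deviation t g = sqrt (\<integral>\<omega>. (norm (g (X t \<omega>) - (\<integral>\<omega>. g (X t \<omega>) \<partial>N)))\<^sup>2 \<partial>N)"

text \<open>One step of the backward evolution of matrix-valued test functions: \<open>g\<close> at time \<open>t + 1\<close> is
  conjugated by the factor of that time and then averaged by the kernel, which gives a test
  function at time \<open>t\<close>.\<close>

definition conjugated :: "complex \<Rightarrow> nat \<Rightarrow> ('a \<Rightarrow> complex ^ 'm ^ 'm) \<Rightarrow> 'a \<Rightarrow> complex ^ 'm ^ 'm" where
  "conjugated z t g x =
    ctranspose (rotation_step (\<beta>\<^sup>2) z (A (Suc t) x)) ** g x ** rotation_step (\<beta>\<^sup>2) z (A (Suc t) x)"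

definition pulled_back :: "complex \<Rightarrow> nat \<Rightarrow> ('a \<Rightarrow> complex ^ 'm ^ 'm) \<Rightarrow> 'a \<Rightarrow> complex ^ 'm ^ 'm" where
  "pulled_back z t g x = (\<integral>y. conjugated z t g y \<partial>P (Suc t) x)"

definition path_product :: "complex \<Rightarrow> nat \<Rightarrow> 'w \<Rightarrow> complex ^ 'm ^ 'm" where
  "path_product z t \<omega> = rotation_product (\<beta>\<^sup>2) (\<lambda>j. A j (X j \<omega>)) t z"

text \<open>The bound on \<open>conj_deviation\<close> per unit norm of its last argument, and the growth factor of the mean alone.\<close>

definition drift :: real where "drift = 2 * \<beta> * (1 + \<beta>\<^sup>2) + \<beta>\<^sup>2"
definition growth :: real where "growth = (1 + \<beta>\<^sup>2)\<^sup>2 + \<beta>\<^sup>2"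

lemma drift_nonneg: "0 \<le> drift"
  using \<beta> by (simp add: drift_def)

lemma mean_norm_nonneg: "0 \<le> mean_norm t g" by (simp add: mean_norm_def)
lemma deviation_nonneg: "0 \<le> deviation t g"
  unfolding deviation_def by (intro real_sqrt_ge_zero integral_nonneg_AE) simp

lemma bounded_measurable_rotation_step:
  assumes "bounded_measurable L B"
  shows "bounded_measurable L (\<lambda>x. rotation_step \<kappa> z (B x))"
  unfolding rotation_step_def
  by (intro bounded_measurable_add bounded_measurable_const bounded_measurable_cscale assms)

lemma bounded_measurable_conjugated:
  assumes "bounded_measurable M g" shows "bounded_measurable M (conjugated z t g)"
  unfolding conjugated_def
  by (intro bounded_measurable_matrix_mult bounded_measurable_ctranspose
      bounded_measurable_rotation_step A_bounded assms)

lemma bounded_measurable_pulled_back: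
  assumes "bounded_measurable M g" shows "bounded_measurable M (pulled_back z t g)"
  unfolding pulled_back_def
  by (rule bounded_measurable_kernel_mean[OF kernel bounded_measurable_conjugated[OF assms]])

lemma pulled_back_mean:
  assumes "bounded_measurable M g"
  shows "(\<integral>\<omega>. pulled_back z t g (X t \<omega>) \<partial>N) = (\<integral>\<omega>. conjugated z t g (X (Suc t) \<omega>) \<partial>N)"
  unfolding pulled_back_def
  by (rule markov_chain_expectation_kernel_mean[OF chain bounded_measurable_conjugated[OF assms], symmetric])

lemma scalar_part_le:
  fixes z :: complex
  assumes "norm z = 1" shows "(norm (1 + of_real (\<beta>\<^sup>2) * z\<^sup>2))\<^sup>2 \<le> (1 + \<beta>\<^sup>2)\<^sup>2"
  using norm_triangle_ineq[of 1 "of_real (\<beta>\<^sup>2) * z\<^sup>2"] assms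
  by (intro power_mono) (simp_all add: norm_mult norm_power)

text \<open>Write \<open>g = a + h\<close> with mean \<open>a\<close> and deviation \<open>h\<close>. After conjugation the test function is
  \<open>s a + \<psi> a + s h + \<psi> h\<close>, where \<open>\<psi>\<close> is the perturbation. The term \<open>s h\<close> has mean zero and \<open>\<psi> a\<close> has mean of
  order \<open>\<beta>\<^sup>2\<close>. The constant \<open>s a\<close> does not contribute to the deviation, and the kernel
  multiplies what is left of the deviation by the singular value.\<close>

lemma one_step_bounds:
  assumes z: "norm z = 1" and g: "bounded_measurable M g"
  shows mean_norm_pulled_back_le:
      "mean_norm t (pulled_back z t g) \<le> growth * mean_norm (Suc t) g + drift * deviation (Suc t) g"
    and deviation_pulled_back_le:
      "deviation t (pulled_back z t g) \<le> chain_sigma N M P X (Suc t) *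
        (drift * mean_norm (Suc t) g + ((1 + \<beta>\<^sup>2)\<^sup>2 + drift) * deviation (Suc t) g)"
proof -
  define a where "a = (\<integral>\<omega>. g (X (Suc t) \<omega>) \<partial>N)"
  define h where "h x = g x - a" for x
  define s where "s = (norm (1 + of_real (\<beta>\<^sup>2) * z\<^sup>2))\<^sup>2"
  define \<psi> where "\<psi> x W = conj_deviation (\<beta>\<^sup>2) z (A (Suc t) x) W" for x W
  let ?Y = "X (Suc t)"
  have s: "0 \<le> s" "s \<le> (1 + \<beta>\<^sup>2)\<^sup>2" unfolding s_def using scalar_part_le[OF z] by simp_all
  have hb: "bounded_measurable M h"
    unfolding h_def by (intro bounded_measurable_diff g bounded_measurable_const)
  have h0: "(\<integral>\<omega>. h (?Y \<omega>) \<partial>N) = 0"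
    unfolding h_def using integrable_bounded_measurable[OF bounded_measurable_compose[OF g X_measurable]]
    by (simp add: a_def prob_space)
  have dev: "deviation (Suc t) g = sqrt (\<integral>\<omega>. (norm (h (?Y \<omega>)))\<^sup>2 \<partial>N)"
    by (simp add: deviation_def h_def a_def)
  have q: "conjugated z t g x = s *\<^sub>R a + \<psi> x a + (s *\<^sub>R h x + \<psi> x (h x))" if "x \<in> space M" for x
  proof -
    have "conjugated z t g x = s *\<^sub>R g x + \<psi> x (g x)"
      unfolding conjugated_def \<psi>_def s_def by (rule rotation_step_conjugation[OF A_hermitian[OF that] z])
    also have "g x = a + h x" by (simp add: h_def)
    finally show ?thesis by (simp add: \<psi>_def conj_deviation_add scaleR_add_right)
  qed
  have \<psi>_le: "norm (\<psi> x W) \<le> drift * norm W" if "x \<in> space M" for x W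
    unfolding \<psi>_def drift_def
    by (rule norm_conj_deviation_le[OF A_hermitian[OF that] A_bound[OF that] \<beta>(1) _ z]) simp
  have \<psi>b: "bounded_measurable M (\<lambda>x. \<psi> x (W x))" if "bounded_measurable M W" for W
    unfolding \<psi>_def by (rule bounded_measurable_conj_deviation[OF A_bounded that])
  have qb: "bounded_measurable M (conjugated z t g)" by (rule bounded_measurable_conjugated[OF g])
  have intr: "integrable N (\<lambda>\<omega>. f (?Y \<omega>))" if "bounded_measurable M f" for f :: "'a \<Rightarrow> real"
    by (rule integrable_bounded_measurable[OF bounded_measurable_compose[OF that X_measurable]])
  have intm: "integrable N (\<lambda>\<omega>. f (?Y \<omega>))" if "bounded_measurable M f" for f :: "'a \<Rightarrow> complex ^ 'm ^ 'm"
    by (rule integrable_bounded_measurable[OF bounded_measurable_compose[OF that X_measurable]])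
  have h1: "(\<integral>\<omega>. norm (h (?Y \<omega>)) \<partial>N) \<le> deviation (Suc t) g"
    unfolding dev using expectation_le_L2[OF bounded_measurable_norm[OF bounded_measurable_compose[OF hb X_measurable]]] .
  define a' where "a' = (\<integral>\<omega>. conjugated z t g (?Y \<omega>) \<partial>N)"
  have "a' = (\<integral>\<omega>. s *\<^sub>R a + \<psi> (?Y \<omega>) a + (s *\<^sub>R h (?Y \<omega>) + \<psi> (?Y \<omega>) (h (?Y \<omega>))) \<partial>N)"
    unfolding a'_def by (intro Bochner_Integration.integral_cong refl q X_space)
  also have "\<dots> = s *\<^sub>R a + (\<integral>\<omega>. \<psi> (?Y \<omega>) a \<partial>N) + (\<integral>\<omega>. \<psi> (?Y \<omega>) (h (?Y \<omega>)) \<partial>N)"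
    using intm[OF \<psi>b[OF bounded_measurable_const[of M a]]] intm[OF \<psi>b[OF hb]] intm[OF hb] h0 prob_space
    by simp
  finally have "norm a' \<le> s * norm a + norm (\<integral>\<omega>. \<psi> (?Y \<omega>) a \<partial>N) + norm (\<integral>\<omega>. \<psi> (?Y \<omega>) (h (?Y \<omega>)) \<partial>N)"
    using s by (auto intro!: norm_triangle_mono)
  moreover have "norm (\<integral>\<omega>. \<psi> (?Y \<omega>) a \<partial>N) \<le> \<beta>\<^sup>2 * norm a"
    unfolding \<psi>_def
    by (rule norm_expectation_conj_deviation_const_le[OF bounded_measurable_compose[OF A_bounded X_measurable] A_mean])
       (auto intro: A_hermitian A_bound X_space \<beta>)
  moreover have "norm (\<integral>\<omega>. \<psi> (?Y \<omega>) (h (?Y \<omega>)) \<partial>N) \<le> drift * deviation (Suc t) g"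
  proof -
    have "norm (\<integral>\<omega>. \<psi> (?Y \<omega>) (h (?Y \<omega>)) \<partial>N) \<le> (\<integral>\<omega>. norm (\<psi> (?Y \<omega>) (h (?Y \<omega>))) \<partial>N)"
      by (rule integral_norm_bound)
    also have "\<dots> \<le> (\<integral>\<omega>. drift * norm (h (?Y \<omega>)) \<partial>N)"
      using intm[OF \<psi>b[OF hb]] intm[OF hb] by (intro integral_mono \<psi>_le X_space) auto
    also have "\<dots> \<le> drift * deviation (Suc t) g"
      using mult_left_mono[OF h1 drift_nonneg] by simp
    finally show ?thesis .
  qed
  moreover have "s * norm a \<le> (1 + \<beta>\<^sup>2)\<^sup>2 * norm a" using s by (intro mult_right_mono) auto
  ultimately have na': "norm a' \<le> growth * norm a + drift * deviation (Suc t) g"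
    by (simp add: growth_def algebra_simps)
  then show "mean_norm t (pulled_back z t g) \<le> growth * mean_norm (Suc t) g + drift * deviation (Suc t) g"
    by (simp add: mean_norm_def pulled_back_mean[OF g] a'_def a_def)

  define \<rho> where "\<rho> = (1 + \<beta>\<^sup>2)\<^sup>2 + drift"
  have \<rho>: "\<rho> \<ge> 0" using drift_nonneg by (simp add: \<rho>_def)
  define q' where "q' x = conjugated z t g x - a'" for x
  have q'b: "bounded_measurable M q'"
    unfolding q'_def by (intro bounded_measurable_diff qb bounded_measurable_const)
  have q'0: "(\<integral>\<omega>. q' (?Y \<omega>) \<partial>N) = 0"
    unfolding q'_def using intm[OF qb] by (simp add: a'_def prob_space)
  \<comment> \<open>deviations ignore constants, and after removing the large constant \<open>s a\<close> the second moment is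
    a good bound for the deviation\<close>
  define r where "r x = conjugated z t g x - s *\<^sub>R a" for x
  have rb: "bounded_measurable M r"
    unfolding r_def by (intro bounded_measurable_diff qb bounded_measurable_const)
  have rmean: "(\<integral>\<omega>. r (?Y \<omega>) \<partial>N) = a' - s *\<^sub>R a"
    unfolding r_def using intm[OF qb] by (simp add: a'_def prob_space)
  have r_le: "norm (r x) \<le> drift * norm a + \<rho> * norm (h x)" if x: "x \<in> space M" for x
  proof -
    have "r x = \<psi> x a + (s *\<^sub>R h x + \<psi> x (h x))" unfolding r_def q[OF x] by simp
    also have "norm \<dots> \<le> drift * norm a + ((1 + \<beta>\<^sup>2)\<^sup>2 * norm (h x) + drift * norm (h x))"
      using s by (intro norm_triangle_mono \<psi>_le x) (auto intro: mult_right_mono)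
    finally show ?thesis by (simp add: \<rho>_def algebra_simps)
  qed
  have "(\<integral>\<omega>. (norm (q' (?Y \<omega>)))\<^sup>2 \<partial>N) = (\<integral>\<omega>. (norm (r (?Y \<omega>) - (\<integral>\<omega>. r (?Y \<omega>) \<partial>N)))\<^sup>2 \<partial>N)"
    unfolding rmean by (simp add: q'_def r_def)
  also have "\<dots> \<le> (\<integral>\<omega>. (norm (r (?Y \<omega>)))\<^sup>2 \<partial>N)"
    using expectation_norm_diff_power2[OF bounded_measurable_compose[OF rb X_measurable]] by simp
  also have "\<dots> \<le> (\<integral>\<omega>. (drift * norm a)\<^sup>2 + 2 * (drift * norm a) * \<rho> * norm (h (?Y \<omega>)) +
      \<rho>\<^sup>2 * (norm (h (?Y \<omega>)))\<^sup>2 \<partial>N)"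
  proof (rule integral_mono)
    show "integrable N (\<lambda>\<omega>. (norm (r (?Y \<omega>)))\<^sup>2)" by (rule intr[OF bounded_measurable_norm_power2[OF rb]])
    show "integrable N (\<lambda>\<omega>. (drift * norm a)\<^sup>2 + 2 * (drift * norm a) * \<rho> * norm (h (?Y \<omega>)) +
      \<rho>\<^sup>2 * (norm (h (?Y \<omega>)))\<^sup>2)"
      using intr[OF bounded_measurable_norm_power2[OF hb]] intm[OF hb] by simp
    fix \<omega> assume "\<omega> \<in> space N"
    then have "(norm (r (?Y \<omega>)))\<^sup>2 \<le> (drift * norm a + \<rho> * norm (h (?Y \<omega>)))\<^sup>2"
      by (intro power_mono r_le X_space) auto
    then show "(norm (r (?Y \<omega>)))\<^sup>2 \<le> (drift * norm a)\<^sup>2 + 2 * (drift * norm a) * \<rho> * norm (h (?Y \<omega>)) +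
      \<rho>\<^sup>2 * (norm (h (?Y \<omega>)))\<^sup>2"
      by (simp add: power2_sum power_mult_distrib mult_ac)
  qed
  also have "\<dots> = (drift * norm a)\<^sup>2 + 2 * (drift * norm a) * \<rho> * (\<integral>\<omega>. norm (h (?Y \<omega>)) \<partial>N) +
      \<rho>\<^sup>2 * (deviation (Suc t) g)\<^sup>2"
    using intr[OF bounded_measurable_norm_power2[OF hb]] intm[OF hb]
    by (simp add: dev prob_space integral_nonneg_AE)
  also have "\<dots> \<le> (drift * norm a)\<^sup>2 + 2 * (drift * norm a) * \<rho> * deviation (Suc t) g +
      \<rho>\<^sup>2 * (deviation (Suc t) g)\<^sup>2"
    using h1 drift_nonneg \<rho> by (intro add_mono mult_left_mono order_refl) auto
  also have "\<dots> = (drift * norm a + \<rho> * deviation (Suc t) g)\<^sup>2"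
    by (simp add: power2_sum power_mult_distrib mult_ac)
  finally have q'_le: "(\<integral>\<omega>. (norm (q' (?Y \<omega>)))\<^sup>2 \<partial>N) \<le> (drift * norm a + \<rho> * deviation (Suc t) g)\<^sup>2" .
  have pm: "(\<integral>\<omega>. pulled_back z t g (X t \<omega>) \<partial>N) = a'"
    by (simp add: pulled_back_mean[OF g] a'_def)
  have "(deviation t (pulled_back z t g))\<^sup>2 = (\<integral>\<omega>. (norm (\<integral>y. q' y \<partial>P (Suc t) (X t \<omega>)))\<^sup>2 \<partial>N)"
  proof -
    have "pulled_back z t g (X t \<omega>) - a' = (\<integral>y. q' y \<partial>P (Suc t) (X t \<omega>))" if "\<omega> \<in> space N" for \<omega>
    proof -
      interpret K: prob_space "P (Suc t) (X t \<omega>)" by (rule prob_kernel(1)[OF kernel X_space[OF that]])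
      show ?thesis
        unfolding q'_def pulled_back_def
        using integrable_kernel[OF kernel X_space[OF that] qb] by (simp add: K.prob_space)
    qed
    then have "(\<integral>\<omega>. (norm (pulled_back z t g (X t \<omega>) - a'))\<^sup>2 \<partial>N) =
        (\<integral>\<omega>. (norm (\<integral>y. q' y \<partial>P (Suc t) (X t \<omega>)))\<^sup>2 \<partial>N)"
      by (intro Bochner_Integration.integral_cong) auto
    then show ?thesis by (simp add: deviation_def pm integral_nonneg_AE)
  qed
  also have "\<dots> \<le> (chain_sigma N M P X (Suc t))\<^sup>2 * (\<integral>\<omega>. (norm (q' (?Y \<omega>)))\<^sup>2 \<partial>N)"
    by (rule kernel_mean_le_chain_sigma[OF chain q'b q'0])
  also have "\<dots> \<le> (chain_sigma N M P X (Suc t))\<^sup>2 * (drift * norm a + \<rho> * deviation (Suc t) g)\<^sup>2"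
    by (intro mult_left_mono q'_le) simp
  finally have "(deviation t (pulled_back z t g))\<^sup>2 \<le>
      (chain_sigma N M P X (Suc t) * (drift * norm a + \<rho> * deviation (Suc t) g))\<^sup>2"
    by (simp add: power_mult_distrib)
  then have "deviation t (pulled_back z t g) \<le>
      chain_sigma N M P X (Suc t) * (drift * norm a + \<rho> * deviation (Suc t) g)"
    by (rule power2_le_imp_le)
       (intro mult_nonneg_nonneg chain_sigma_nonneg[OF chain] add_nonneg_nonneg drift_nonneg \<rho>
         deviation_nonneg norm_ge_zero)
  then show "deviation t (pulled_back z t g) \<le> chain_sigma N M P X (Suc t) *
        (drift * mean_norm (Suc t) g + ((1 + \<beta>\<^sup>2)\<^sup>2 + drift) * deviation (Suc t) g)"
    by (simp add: mean_norm_def a_def \<rho>_def)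
qed

lemma bounded_measurable_path_product:
  assumes "t \<le> s"
  shows "bounded_measurable (natural_sigma N M X s) (path_product z t)"
  using assms
proof (induction t)
  case (Suc t)
  have "bounded_measurable (natural_sigma N M X s) (\<lambda>\<omega>. A (Suc t) (X (Suc t) \<omega>))"
    by (rule bounded_measurable_compose[OF A_bounded measurable_natural_sigma[OF X_measurable Suc.prems]])
  then have "bounded_measurable (natural_sigma N M X s)
      (\<lambda>\<omega>. rotation_step (\<beta>\<^sup>2) z (A (Suc t) (X (Suc t) \<omega>)) ** path_product z t \<omega>)"
    using Suc by (intro bounded_measurable_matrix_mult bounded_measurable_rotation_step) auto
  then show ?case by (simp add: path_product_def)
next
  case 0
  have "path_product z 0 = (\<lambda>\<omega>. mat 1)" by (simp add: path_product_def fun_eq_iff)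
  then show ?case by simp
qed

text \<open>Moving the last factor from the matrix \<open>B B*\<close> to the test function by adjointness leaves a matrix
  that depends on the past up to time \<open>t\<close> only, so the Markov property applies.\<close>

lemma path_product_step:
  assumes g: "bounded_measurable M g"
  shows "(\<integral>\<omega>. (path_product z (Suc t) \<omega> ** ctranspose (path_product z (Suc t) \<omega>)) \<bullet> g (X (Suc t) \<omega>) \<partial>N) =
    (\<integral>\<omega>. (path_product z t \<omega> ** ctranspose (path_product z t \<omega>)) \<bullet> pulled_back z t g (X t \<omega>) \<partial>N)"
proof -
  let ?B = "path_product z t"
  have "(path_product z (Suc t) \<omega> ** ctranspose (path_product z (Suc t) \<omega>)) \<bullet> g (X (Suc t) \<omega>) =
      (?B \<omega> ** ctranspose (?B \<omega>)) \<bullet> conjugated z t g (X (Suc t) \<omega>)" for \<omega>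
  proof -
    let ?G = "rotation_step (\<beta>\<^sup>2) z (A (Suc t) (X (Suc t) \<omega>))"
    have "path_product z (Suc t) \<omega> ** ctranspose (path_product z (Suc t) \<omega>) =
        ?G ** ((?B \<omega> ** ctranspose (?B \<omega>)) ** ctranspose ?G)"
      by (simp add: path_product_def ctranspose_mult matrix_mul_assoc)
    moreover have "(?G ** (C ** ctranspose ?G)) \<bullet> V = C \<bullet> (ctranspose ?G ** V ** ?G)" for C V
      by (simp only: inner_mult_left[of ?G] inner_mult_right[of C] ctranspose_ctranspose)
    ultimately show ?thesis by (simp only: conjugated_def)
  qed
  then show ?thesis
    unfolding pulled_back_def
    by (simp only:) (rule markov_chain_expectation_step[OF chain _ bounded_measurable_conjugated[OF g]],
      intro bounded_measurable_matrix_mult bounded_measurable_ctranspose bounded_measurable_path_product order_refl)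
qed

end

text \<open>One backward step multiplies a deviation by \<open>\<sigma>\<close>, which lowers its weight from \<open>2 \<delta> (1 + \<sigma> S)\<close>
  to \<open>2 \<delta> \<sigma> S\<close>. The margin \<open>2 \<delta>\<close> absorbs both the transfer \<open>\<delta> \<eta>\<close> into the mean and the excess
  growth \<open>\<rho> - \<rho>1\<close> of the deviation. Since \<open>\<sigma> S \<le> L - 1\<close>, the transfer from the mean into the
  deviation costs \<open>2 \<delta>\<^sup>2 (L - 1)\<close>.\<close>

lemma potential_step:
  fixes \<alpha> \<eta> \<sigma> S L \<delta> \<rho>1 \<rho> r :: real
  assumes "0 \<le> \<alpha>" "0 \<le> \<eta>" "0 \<le> \<sigma>" "0 \<le> S" "1 + \<sigma> * S \<le> L" "0 \<le> \<delta>" "1 \<le> \<rho>1"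
    and \<alpha>': "\<alpha>' \<le> \<rho>1 * \<alpha> + \<delta> * \<eta>" and \<eta>': "\<eta>' \<le> \<sigma> * (\<delta> * \<alpha> + \<rho> * \<eta>)"
    and gap: "2 * (\<rho> - \<rho>1) * (L - 1) \<le> 1" "\<rho>1 \<le> \<rho>"
    and r: "r = \<rho>1 + 2 * \<delta>\<^sup>2 * (L - 1)"
  shows "\<alpha>' + 2 * \<delta> * S * \<eta>' \<le> r * (\<alpha> + 2 * \<delta> * (1 + \<sigma> * S) * \<eta>)"
proof -
  define w where "w = \<sigma> * S"
  have w: "0 \<le> w" "w \<le> L - 1" using assms by (auto simp: w_def)
  have "\<alpha>' + 2 * \<delta> * S * \<eta>' \<le> \<rho>1 * \<alpha> + \<delta> * \<eta> + 2 * \<delta> * S * (\<sigma> * (\<delta> * \<alpha> + \<rho> * \<eta>))"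
    using assms by (intro add_mono mult_left_mono) auto
  also have "\<dots> = (\<rho>1 + 2 * \<delta>\<^sup>2 * w) * \<alpha> + \<delta> * (1 + 2 * w * \<rho>) * \<eta>"
    by (simp add: w_def power2_eq_square algebra_simps)
  also have "\<dots> \<le> r * \<alpha> + r * (2 * \<delta> * (1 + w)) * \<eta>"
  proof (intro add_mono mult_right_mono)
    show "\<rho>1 + 2 * \<delta>\<^sup>2 * w \<le> r" unfolding r using w by (intro add_left_mono mult_left_mono) auto
    have "2 * w * (\<rho> - \<rho>1) \<le> 2 * (L - 1) * (\<rho> - \<rho>1)" using w gap by (intro mult_right_mono mult_left_mono) auto
    then have "1 + 2 * w * \<rho> \<le> 2 * \<rho>1 + 2 * w * \<rho>1" using gap assms by (simp add: algebra_simps)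
    also have "\<dots> \<le> 2 * r * (1 + w)"
    proof -
      have "\<rho>1 \<le> r" unfolding r using w by simp
      then have "\<rho>1 * (1 + w) \<le> r * (1 + w)" using w by (intro mult_right_mono) auto
      then show ?thesis by (simp add: algebra_simps)
    qed
    finally have "\<delta> * (1 + 2 * w * \<rho>) \<le> \<delta> * (2 * r * (1 + w))" using assms by (intro mult_left_mono) auto
    then show "\<delta> * (1 + 2 * w * \<rho>) \<le> r * (2 * \<delta> * (1 + w))" by (simp add: mult_ac)
  qed (use assms in auto)
  finally show ?thesis by (simp add: w_def algebra_simps)
qed

text \<open>The sums of products of singular values in the gap condition, in recursive form.\<close>

primrec gap_sum :: "(nat \<Rightarrow> real) \<Rightarrow> nat \<Rightarrow> real" where
  "gap_sum \<sigma> 0 = 1"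
| "gap_sum \<sigma> (Suc t) = 1 + \<sigma> (Suc t) * gap_sum \<sigma> t"

lemma gap_sum_eq: "gap_sum \<sigma> t = (\<Sum>k=1..t+1. \<Prod>l=k..t. \<sigma> l)"
proof (induction t)
  case (Suc t)
  have "(\<Sum>k=1..Suc t+1. \<Prod>l=k..Suc t. \<sigma> l) = 1 + (\<Sum>k=1..t+1. \<Prod>l=k..Suc t. \<sigma> l)"
    by simp
  also have "(\<Sum>k=1..t+1. \<Prod>l=k..Suc t. \<sigma> l) = (\<Sum>k=1..t+1. \<sigma> (Suc t) * (\<Prod>l=k..t. \<sigma> l))"
    by (intro sum.cong refl) (auto simp: prod.nat_ivl_Suc' atLeastAtMostSuc_conv)
  also have "\<dots> = \<sigma> (Suc t) * gap_sum \<sigma> t"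
    by (simp only: Suc.IH sum_distrib_left)
  finally show ?case by simp
qed simp

context centered_matrix_chain
begin

text \<open>The induction is over \<open>t\<close> for all test functions at once: the test function at time \<open>t + 1\<close> is
  traded for its pulled back version at time \<open>t\<close>.\<close>

lemma expectation_path_product_le:
  assumes z: "norm z = 1" and g: "bounded_measurable M g"
    and L: "\<And>t. gap_sum (chain_sigma N M P X) t \<le> L" and small: "4 * \<beta> * (1 + \<beta>\<^sup>2) * (L - 1) \<le> 1"
  shows "\<bar>\<integral>\<omega>. (path_product z t \<omega> ** ctranspose (path_product z t \<omega>)) \<bullet> g (X t \<omega>) \<partial>N\<bar> \<le>
    (growth + 2 * drift\<^sup>2 * (L - 1)) ^ t * sqrt CARD('m) *
      (mean_norm t g + 2 * drift * gap_sum (chain_sigma N M P X) t * deviation t g)"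
  using g
proof (induction t arbitrary: g)
  case 0
  have i: "integrable N (\<lambda>\<omega>. g (X 0 \<omega>))"
    by (rule integrable_bounded_measurable[OF bounded_measurable_compose[OF 0 X_measurable]])
  have "\<bar>(mat 1 :: complex ^ 'm ^ 'm) \<bullet> (\<integral>\<omega>. g (X 0 \<omega>) \<partial>N)\<bar> \<le> norm (mat 1 :: complex ^ 'm ^ 'm) * mean_norm 0 g"
    unfolding mean_norm_def by (rule Cauchy_Schwarz_ineq2)
  also have "\<dots> \<le> sqrt CARD('m) * (mean_norm 0 g + 2 * drift * 1 * deviation 0 g)"
    unfolding norm_mat_1 using drift_nonneg deviation_nonneg by (intro mult_left_mono) auto
  finally show ?case using i by (simp add: path_product_def)
next
  case (Suc t)
  let ?S = "gap_sum (chain_sigma N M P X)"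
  let ?r = "growth + 2 * drift\<^sup>2 * (L - 1)"
  have S0: "?S s \<ge> 0" for s
    using chain_sigma_nonneg[OF chain] by (induction s) (auto intro: add_nonneg_nonneg)
  have L1: "L \<ge> 1" using L[of 0] by simp
  have growth1: "growth \<ge> 1" unfolding growth_def
    by (rule order_trans[OF one_le_power[of "1 + \<beta>\<^sup>2" 2]]) simp_all
  have r0: "?r \<ge> 0" using growth1 L1 by simp
  have "\<bar>\<integral>\<omega>. (path_product z (Suc t) \<omega> ** ctranspose (path_product z (Suc t) \<omega>)) \<bullet> g (X (Suc t) \<omega>) \<partial>N\<bar> \<le>
      ?r ^ t * sqrt CARD('m) * (mean_norm t (pulled_back z t g) + 2 * drift * ?S t * deviation t (pulled_back z t g))"
    unfolding path_product_step[OF Suc.prems]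
    by (rule Suc.IH[OF bounded_measurable_pulled_back[OF Suc.prems]])
  also have "\<dots> \<le> ?r ^ t * sqrt CARD('m) * (?r * (mean_norm (Suc t) g + 2 * drift * ?S (Suc t) * deviation (Suc t) g))"
  proof (rule mult_left_mono)
    show "mean_norm t (pulled_back z t g) + 2 * drift * ?S t * deviation t (pulled_back z t g) \<le>
        ?r * (mean_norm (Suc t) g + 2 * drift * ?S (Suc t) * deviation (Suc t) g)"
      unfolding gap_sum.simps
    proof (rule potential_step[OF mean_norm_nonneg deviation_nonneg chain_sigma_nonneg[OF chain] S0 _ drift_nonneg
          growth1 one_step_bounds[OF z Suc.prems] _ _ refl])
      show "1 + chain_sigma N M P X (Suc t) * ?S t \<le> L" using L[of "Suc t"] by simp
      have d: "(1 + \<beta>\<^sup>2)\<^sup>2 + drift - growth = 2 * \<beta> * (1 + \<beta>\<^sup>2)" by (simp add: growth_def drift_def)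
      show "2 * ((1 + \<beta>\<^sup>2)\<^sup>2 + drift - growth) * (L - 1) \<le> 1"
        unfolding d using small by (simp add: algebra_simps)
      show "growth \<le> (1 + \<beta>\<^sup>2)\<^sup>2 + drift" using d \<beta> by (simp add: growth_def drift_def)
    qed
    show "0 \<le> ?r ^ t * sqrt CARD('m)" using r0 by simp
  qed
  finally show ?case by (simp add: mult_ac)
qed

lemma expectation_norm_path_product_le:
  assumes z: "norm z = 1"
    and L: "\<And>t. gap_sum (chain_sigma N M P X) t \<le> L" and small: "4 * \<beta> * (1 + \<beta>\<^sup>2) * (L - 1) \<le> 1"
  shows "(\<integral>\<omega>. (norm (path_product z t \<omega>))\<^sup>2 \<partial>N) \<le> CARD('m) * (growth + 2 * drift\<^sup>2 * (L - 1)) ^ t"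
proof -
  have "(norm (path_product z t \<omega>))\<^sup>2 = (path_product z t \<omega> ** ctranspose (path_product z t \<omega>)) \<bullet> mat 1" for \<omega>
    using inner_mult_right[of "mat 1" "path_product z t \<omega>" "path_product z t \<omega>"]
    by (simp add: power2_norm_eq_inner inner_commute)
  moreover have "mean_norm t (\<lambda>_. mat 1) = sqrt CARD('m)" "deviation t (\<lambda>_. mat 1) = 0"
    by (simp_all add: mean_norm_def deviation_def prob_space norm_mat_1)
  ultimately show ?thesis
    using expectation_path_product_le[OF z bounded_measurable_const[of M "mat 1"] L small, of t]
    by (simp add: mult.left_commute[of _ "sqrt _" "sqrt _"] mult.assoc[of "sqrt _", symmetric] mult.commute abs_le_iff)
qed

end

section \<open>The tail bound\<close>

lemma bounded_bilinear_cscale: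
  "bounded_bilinear (cscale :: complex \<Rightarrow> complex ^ 'm ^ 'm \<Rightarrow> complex ^ 'm ^ 'm)"
proof
  fix A B :: "complex ^ 'm ^ 'm" and a b :: complex and r :: real
  show "cscale (a + b) A = cscale a A + cscale b A" by (simp add: vec_eq_iff distrib_right)
  show "cscale a (A + B) = cscale a A + cscale a B" by (rule cscale_add)
  show "cscale (r *\<^sub>R a) A = r *\<^sub>R cscale a A" by (simp add: vec_eq_iff)
  show "cscale a (r *\<^sub>R A) = r *\<^sub>R cscale a A" by (simp add: vec_eq_iff)
  show "\<exists>K. \<forall>a (A :: complex ^ 'm ^ 'm). norm (cscale a A) \<le> norm a * norm A * K"
    by (intro exI[of _ 1]) (simp add: norm_cscale)
qed

lemma borel_measurable_matrix_mult:
  fixes f g :: "'a \<Rightarrow> complex ^ 'm ^ 'm"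
  assumes "f \<in> borel_measurable M" "g \<in> borel_measurable M"
  shows "(\<lambda>x. f x ** g x) \<in> borel_measurable M"
  by (rule borel_measurable_continuous_Pair[OF assms])
     (intro bounded_bilinear.continuous_on[OF bounded_bilinear_matrix_mult] continuous_intros)

text \<open>Joint measurability in the angle and the path, needed to interchange the two integrals.\<close>

lemma borel_measurable_rotation_product:
  fixes B :: "nat \<Rightarrow> 'a \<Rightarrow> complex ^ 'm ^ 'm"
  assumes z: "z \<in> borel_measurable M" and B: "\<And>j. B (Suc j) \<in> borel_measurable M"
  shows "(\<lambda>x. rotation_product \<kappa> (\<lambda>j. B j x) n (z x)) \<in> borel_measurable M"
proof (induction n)
  case (Suc n)
  have "(\<lambda>x. cscale (c x) (C x)) \<in> borel_measurable M"
    if "c \<in> borel_measurable M" "C \<in> borel_measurable M" for c and C :: "'a \<Rightarrow> complex ^ 'm ^ 'm"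
    by (rule borel_measurable_continuous_Pair[OF that])
       (intro bounded_bilinear.continuous_on[OF bounded_bilinear_cscale] continuous_intros)
  from this[of "\<lambda>x. 1 + of_real \<kappa> * (z x)\<^sup>2" "\<lambda>_. mat 1"] this[OF z B]
  have "(\<lambda>x. rotation_step \<kappa> (z x) (B (Suc n) x)) \<in> borel_measurable M"
    unfolding rotation_step_def using z by (intro borel_measurable_add) auto
  then show ?case unfolding rotation_product.simps by (intro borel_measurable_matrix_mult Suc)
qed simp

context centered_matrix_chain
begin

lemma path_product_joint_measurable:
  "(\<lambda>(\<phi>, \<omega>). path_product (cis \<phi>) n \<omega>) \<in> borel_measurable (lborel \<Otimes>\<^sub>M N)"
proof -
  have c: "cis \<in> borel_measurable borel"
    by (intro borel_measurable_continuous_onI continuous_intros)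
  have "(\<lambda>p. A (Suc j) (X (Suc j) (snd p))) \<in> borel_measurable (lborel \<Otimes>\<^sub>M N)" for j
    by (rule measurable_compose[OF measurable_compose[OF measurable_snd X_measurable] A_measurable])
  moreover have "(\<lambda>p. cis (fst p)) \<in> borel_measurable (lborel \<Otimes>\<^sub>M N)"
    using c by measurable
  ultimately show ?thesis
    unfolding path_product_def case_prod_beta
    using borel_measurable_rotation_product[of "\<lambda>p. cis (fst p)" "lborel \<Otimes>\<^sub>M N" "\<lambda>j p. A j (X j (snd p))"]
    by blast
qed

text \<open>Tonelli's theorem; the weight \<open>cos \<phi> / 2\<close> has total mass 1 on the half circle, so the bound for each
  angle carries over to the mean.\<close>

lemma expectation_arc_mean_le:
  assumes L: "\<And>t. gap_sum (chain_sigma N M P X) t \<le> L" and small: "4 * \<beta> * (1 + \<beta>\<^sup>2) * (L - 1) \<le> 1"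
  shows "(\<integral>\<^sup>+\<omega>. ennreal (integral {-pi/2..pi/2} (\<lambda>\<phi>. (norm (path_product (cis \<phi>) n \<omega>))\<^sup>2 * (cos \<phi> / 2))) \<partial>N)
    \<le> ennreal (CARD('m) * (growth + 2 * drift\<^sup>2 * (L - 1)) ^ n)"
proof -
  let ?I = "{-pi/2..pi/2}"
  let ?m = "CARD('m) * (growth + 2 * drift\<^sup>2 * (L - 1)) ^ n"
  interpret sw: pair_sigma_finite lborel N ..
  have cos_ge: "0 \<le> cos \<phi>" if "\<phi> \<in> ?I" for \<phi> using that by (intro cos_ge_zero) auto
  have L1: "L \<ge> 1" using L[of 0] by simp
  have m0: "0 \<le> ?m" using L1 by (intro mult_nonneg_nonneg zero_le_power add_nonneg_nonneg) (auto simp: growth_def drift_nonneg)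
  have "(\<integral>\<^sup>+\<omega>. ennreal (integral ?I (\<lambda>\<phi>. (norm (path_product (cis \<phi>) n \<omega>))\<^sup>2 * (cos \<phi> / 2))) \<partial>N) =
      (\<integral>\<^sup>+\<omega>. \<integral>\<^sup>+\<phi>. ennreal ((norm (path_product (cis \<phi>) n \<omega>))\<^sup>2 * (cos \<phi> / 2)) * indicator ?I \<phi> \<partial>lborel \<partial>N)"
  proof (intro nn_integral_cong nn_integral_has_integral_lebesgue'[symmetric] integrable_integral)
    fix \<omega>
    have "continuous_on ?I (\<lambda>\<phi>. path_product (cis \<phi>) n \<omega>)"
      unfolding path_product_def by (rule continuous_on_rotation_product_cis)
    then show "(\<lambda>\<phi>. (norm (path_product (cis \<phi>) n \<omega>))\<^sup>2 * (cos \<phi> / 2)) integrable_on ?I"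
      by (intro integrable_continuous_real continuous_on_mult continuous_on_power continuous_on_norm
          continuous_on_divide continuous_on_cos continuous_on_id continuous_on_const) auto
  qed (use cos_ge in auto)
  also have "\<dots> = (\<integral>\<^sup>+\<phi>. \<integral>\<^sup>+\<omega>. ennreal ((norm (path_product (cis \<phi>) n \<omega>))\<^sup>2 * (cos \<phi> / 2)) * indicator ?I \<phi> \<partial>N \<partial>lborel)"
  proof (rule sw.Fubini')
    have "(\<lambda>p. path_product (cis (fst p)) n (snd p)) \<in> borel_measurable (lborel \<Otimes>\<^sub>M N)"
      using path_product_joint_measurable by (simp add: case_prod_beta)
    then show "(\<lambda>(\<phi>, \<omega>). ennreal ((norm (path_product (cis \<phi>) n \<omega>))\<^sup>2 * (cos \<phi> / 2)) * indicator ?I \<phi>)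
        \<in> borel_measurable (lborel \<Otimes>\<^sub>M N)"
      unfolding case_prod_beta by measurable
  qed
  also have "\<dots> \<le> (\<integral>\<^sup>+\<phi>. ennreal (?m * (cos \<phi> / 2)) * indicator ?I \<phi> \<partial>lborel)"
  proof (rule nn_integral_mono)
    fix \<phi> :: real
    show "(\<integral>\<^sup>+\<omega>. ennreal ((norm (path_product (cis \<phi>) n \<omega>))\<^sup>2 * (cos \<phi> / 2)) * indicator ?I \<phi> \<partial>N) \<le>
        ennreal (?m * (cos \<phi> / 2)) * indicator ?I \<phi>"
    proof (cases "\<phi> \<in> ?I")
      case True
      have "bounded_measurable N (path_product (cis \<phi>) n)"
        using bounded_measurable_path_product[of n n] subalgebra_natural_sigma[OF X_measurable]
        by (rule bounded_measurable_mono_sigma[OF _ ]) simp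
      then have int: "integrable N (\<lambda>\<omega>. (norm (path_product (cis \<phi>) n \<omega>))\<^sup>2)"
        by (intro integrable_bounded_measurable bounded_measurable_norm_power2)
      then have "(\<integral>\<^sup>+\<omega>. ennreal ((norm (path_product (cis \<phi>) n \<omega>))\<^sup>2 * (cos \<phi> / 2)) \<partial>N) =
          ennreal ((\<integral>\<omega>. (norm (path_product (cis \<phi>) n \<omega>))\<^sup>2 \<partial>N) * (cos \<phi> / 2))"
        using cos_ge[OF True] by (subst nn_integral_eq_integral) auto
      also have "\<dots> \<le> ennreal (?m * (cos \<phi> / 2))"
        using expectation_norm_path_product_le[OF _ L small, of "cis \<phi>" n] cos_ge[OF True]
        by (intro ennreal_leI mult_right_mono) auto
      finally show ?thesis using True by simp
    qed simp
  qed
  also have "\<dots> = ennreal (?m * 1)"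
  proof (rule nn_integral_has_integral_lebesgue')
    have "((\<lambda>\<phi>. cos \<phi> / 2) has_integral (sin (pi/2) / 2 - sin (-pi/2) / 2)) ?I"
      by (rule fundamental_theorem_of_calculus)
         (auto intro!: derivative_eq_intros simp: has_real_derivative_iff_has_vector_derivative[symmetric])
    then have "((\<lambda>\<phi>. cos \<phi> / 2) has_integral 1) ?I" by simp
    then show "((\<lambda>\<phi>. ?m * (cos \<phi> / 2)) has_integral ?m * 1) ?I" by (rule has_integral_mult_right)
    show "0 \<le> ?m * (cos \<phi> / 2)" if "\<phi> \<in> ?I" for \<phi>
      using cos_ge[OF that] by (intro mult_nonneg_nonneg[OF m0]) simp
  qed
  finally show ?thesis by simp
qed

lemma growth_rate_le:
  assumes L: "1 \<le> L" and small: "\<beta> * L \<le> 1 / 20"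
  shows "growth + 2 * drift\<^sup>2 * (L - 1) \<le> exp (16 * \<beta>\<^sup>2 * L)"
    and "4 * \<beta> * (1 + \<beta>\<^sup>2) * (L - 1) \<le> 1"
proof -
  have b: "\<beta> \<le> 1 / 20" using mult_left_mono[OF L \<beta>(1)] small by simp
  have b2: "\<beta>\<^sup>2 \<le> 1 / 10" using b \<beta>(1) power_mono[of \<beta> "1/20" 2] by (simp add: power2_eq_square)
  have "\<beta>\<^sup>2 * \<beta>\<^sup>2 \<le> 1 * \<beta>\<^sup>2" using b2 by (intro mult_right_mono) auto
  then have g: "growth \<le> 1 + 4 * \<beta>\<^sup>2"
    unfolding growth_def power2_sum power2_eq_square[of "\<beta>\<^sup>2"] by simp
  have "drift = \<beta> * (2 * (1 + \<beta>\<^sup>2) + \<beta>)" by (simp add: drift_def power2_eq_square algebra_simps)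
  also have "\<dots> \<le> \<beta> * (5 / 2)" using b b2 \<beta>(1) by (intro mult_left_mono) auto
  finally have "drift\<^sup>2 \<le> (\<beta> * (5 / 2))\<^sup>2" using drift_nonneg by (rule power_mono)
  then have "drift\<^sup>2 \<le> \<beta>\<^sup>2 * (25 / 4)" by (simp add: power_mult_distrib power_divide)
  then have "drift\<^sup>2 \<le> 8 * \<beta>\<^sup>2" using zero_le_power2[of \<beta>] by linarith
  then have "2 * drift\<^sup>2 * (L - 1) \<le> 2 * (8 * \<beta>\<^sup>2) * (L - 1)" using L by (intro mult_right_mono mult_left_mono) auto
  moreover have "2 * (8 * \<beta>\<^sup>2) * (L - 1) = 16 * \<beta>\<^sup>2 * L - 16 * \<beta>\<^sup>2" by (simp add: algebra_simps)
  ultimately have "growth + 2 * drift\<^sup>2 * (L - 1) \<le> 1 + 16 * \<beta>\<^sup>2 * L"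
    using g zero_le_power2[of \<beta>] by linarith
  also have "\<dots> \<le> exp (16 * \<beta>\<^sup>2 * L)" by (rule exp_ge_add_one_self)
  finally show "growth + 2 * drift\<^sup>2 * (L - 1) \<le> exp (16 * \<beta>\<^sup>2 * L)" .
  have "4 * \<beta> * (1 + \<beta>\<^sup>2) * (L - 1) = (\<beta> * (L - 1)) * (4 * (1 + \<beta>\<^sup>2))" by simp
  also have "\<dots> \<le> (1 / 20) * (4 * 2)"
    using small \<beta> b2 L by (intro mult_mono) (auto simp: algebra_simps)
  also have "\<dots> \<le> 1" by simp
  finally show "4 * \<beta> * (1 + \<beta>\<^sup>2) * (L - 1) \<le> 1" .
qed

text \<open>Markov's inequality for the arc mean. An event outside the sigma-algebra has measure 0 by
  convention, so the bound is trivial there.\<close>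

lemma eigenvalue_tail:
  assumes L: "\<And>t. gap_sum (chain_sigma N M P X) t \<le> L" and small: "\<beta> * L \<le> 1 / 20"
    and ev: "\<And>\<omega>. \<omega> \<in> E \<Longrightarrow> \<exists>v r. norm v = 1 \<and> u \<le> r \<and>
      (\<Sum>j=1..n. A j (X j \<omega>)) *v v = complex_of_real r *s v"
    and E: "E \<subseteq> space N"
  shows "measure N E \<le> CARD('m) * exp (16 * \<beta>\<^sup>2 * L * n - pi / 2 * u)"
proof (cases "E \<in> sets N")
  case False
  then show ?thesis by (simp add: measure_notin_sets)
next
  case True
  let ?f = "\<lambda>\<omega>. integral {-pi/2..pi/2} (\<lambda>\<phi>. (norm (path_product (cis \<phi>) n \<omega>))\<^sup>2 * (cos \<phi> / 2))"
  have L1: "1 \<le> L" using L[of 0] by simp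
  have "ennreal (exp (pi / 2 * u) * measure N E) = (\<integral>\<^sup>+\<omega>. ennreal (exp (pi / 2 * u)) * indicator E \<omega> \<partial>N)"
    using True by (simp add: nn_integral_cmult_indicator emeasure_eq_measure ennreal_mult)
  also have "\<dots> \<le> (\<integral>\<^sup>+\<omega>. ennreal (?f \<omega>) \<partial>N)"
  proof (rule nn_integral_mono)
    fix \<omega>
    show "ennreal (exp (pi / 2 * u)) * indicator E \<omega> \<le> ennreal (?f \<omega>)"
    proof (cases "\<omega> \<in> E")
      case True
      then obtain v r where v: "norm v = 1" "u \<le> r"
        "(\<Sum>j=1..n. A j (X j \<omega>)) *v v = complex_of_real r *s v" using ev by blast
      have \<omega>: "\<omega> \<in> space N" using True E by blast
      have A1: "hermitian (A t (X t \<omega>))" "\<And>v. norm (A t (X t \<omega>) *v v) \<le> \<beta> * norm v" if "1 \<le> t" for t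
        using A_hermitian[OF X_space[OF \<omega>], of "t - 1" t] A_bound[OF X_space[OF \<omega>], of "t - 1" t] that by auto
      have "exp (pi / 2 * u) \<le> exp (pi / 2 * r)" using v(2) by simp
      also have "\<dots> \<le> ?f \<omega>"
        unfolding path_product_def
        by (rule exp_eigenvalue_le_arc_mean[OF A1(1) A1(2) \<beta> v(1,3)]) auto
      finally show ?thesis using True by (simp add: ennreal_leI)
    qed simp
  qed
  also have "\<dots> \<le> ennreal (CARD('m) * (growth + 2 * drift\<^sup>2 * (L - 1)) ^ n)"
    by (rule expectation_arc_mean_le[OF L growth_rate_le(2)[OF L1 small]])
  also have "\<dots> \<le> ennreal (CARD('m) * exp (16 * \<beta>\<^sup>2 * L) ^ n)"
    using growth_rate_le(1)[OF L1 small] L1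
    by (intro ennreal_leI mult_left_mono power_mono add_nonneg_nonneg) (auto simp: growth_def drift_nonneg)
  finally have "exp (pi / 2 * u) * measure N E \<le> CARD('m) * exp (16 * \<beta>\<^sup>2 * L) ^ n"
    by (subst (asm) ennreal_le_iff) auto
  then have "measure N E \<le> CARD('m) * exp (16 * \<beta>\<^sup>2 * L) ^ n / exp (pi / 2 * u)"
    by (simp add: pos_le_divide_eq mult.commute)
  also have "exp (16 * \<beta>\<^sup>2 * L) ^ n = exp (16 * \<beta>\<^sup>2 * L * n)"
    by (simp add: exp_of_nat_mult[symmetric] mult.commute)
  finally show ?thesis by (simp add: exp_diff)
qed

end

lemma op_norm_diff_le_Delta_op:
  assumes fin: "Delta_op M F < \<infinity>" and t: "t \<ge> 1" and x: "x \<in> space M" "y \<in> space M"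
  shows "op_norm (F t x - F t y) \<le> enn2real (Delta_op M F)"
proof -
  have "ennreal (op_norm (F t x - F t y)) \<le> Delta_op M F"
    unfolding Delta_op_def
    by (rule SUP_upper2[of t], use t in simp, rule SUP_upper2[OF x(1)], rule SUP_upper2[OF x(2)], rule order_refl)
  then have "enn2real (ennreal (op_norm (F t x - F t y))) \<le> enn2real (Delta_op M F)"
    using fin by (intro enn2real_mono) auto
  then show ?thesis by (simp add: op_norm_nonneg)
qed

lemma norm_diff_le_Delta_F:
  assumes fin: "Delta_F M F < \<infinity>" and t: "t \<ge> 1" and x: "x \<in> space M" "y \<in> space M"
  shows "norm (F t x - F t y) \<le> enn2real (Delta_F M F)"
proof -
  have "ennreal (frobenius_norm (F t x - F t y)) \<le> Delta_F M F"
    unfolding Delta_F_def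
    by (rule SUP_upper2[of t], use t in simp, rule SUP_upper2[OF x(1)], rule SUP_upper2[OF x(2)], rule order_refl)
  then have "enn2real (ennreal (frobenius_norm (F t x - F t y))) \<le> enn2real (Delta_F M F)"
    using fin by (intro enn2real_mono) auto
  then show ?thesis by (simp add: frobenius_norm_eq_norm)
qed

lemma Delta_op_le_Delta_F: "Delta_op M F \<le> Delta_F M F"
  unfolding Delta_op_def Delta_F_def
  by (intro SUP_mono') (simp add: ennreal_leI op_norm_le_frobenius_norm SUP_mono')

theorem theorem10:
  fixes N :: "'w measure" and M :: "'a measure" and \<mu>0 :: "'a measure"
    and P :: "nat \<Rightarrow> 'a \<Rightarrow> 'a measure" and X :: "nat \<Rightarrow> 'w \<Rightarrow> 'a"
    and F :: "nat \<Rightarrow> 'a \<Rightarrow> complex ^ 'm ^ 'm"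
    and lam vB2 \<epsilon> :: real and n :: nat
  assumes chain: "markov_chain N M \<mu>0 P X"
    and F_measurable: "\<And>t. t \<ge> 1 \<Longrightarrow> F t \<in> borel_measurable M"
    and F_hermitian: "\<And>t x. t \<ge> 1 \<Longrightarrow> x \<in> space M \<Longrightarrow> hermitian (F t x)"
    and Delta_op: "0 < Delta_op M F" "Delta_op M F < \<infinity>"
    and Delta_F: "0 < Delta_F M F" "Delta_F M F < \<infinity>"
    and lam: "0 < lam" "lam \<le> 1"
    and gap: "\<And>t. t \<ge> 1 \<Longrightarrow>
      (\<Sum>k=1..t+1. \<Prod>l=k..t. chain_sigma N M P X l) \<le> 1 / lam"
    and vB2: "vB2 = 768 / pi\<^sup>2 * (enn2real (Delta_op M F) * enn2real (Delta_F M F) / lam)"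
    and n: "n \<ge> 1" and eps: "\<epsilon> \<ge> 0"
  shows "measure N {\<omega> \<in> space N.
           lambda_max (\<Sum>j=1..n. F j (X j \<omega>) - (\<integral>\<omega>'. F j (X j \<omega>') \<partial>N)) \<ge> real n * \<epsilon>}
         \<le> real CARD('m) powr (2 - pi / 4) * exp (- (real n * \<epsilon>\<^sup>2) / (2 * vB2))"
proof -
  interpret prob_space N using chain by (simp add: markov_chain_def)
  have X: "X t \<in> N \<rightarrow>\<^sub>M M" for t using chain by (simp add: markov_chain_def)
  have X_space: "\<omega> \<in> space N \<Longrightarrow> X t \<omega> \<in> space M" for \<omega> t by (rule measurable_space[OF X])
  define D where "D = enn2real (Delta_op M F)"
  define DF where "DF = enn2real (Delta_F M F)"
  define L where "L = 1 / lam"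
  have D: "0 < D" using Delta_op by (auto simp: D_def enn2real_positive_iff)
  have DF: "D \<le> DF" unfolding D_def DF_def
    using Delta_F by (intro enn2real_mono Delta_op_le_Delta_F) auto
  have L1: "L \<ge> 1" using lam by (simp add: L_def)
  obtain x0 where x0: "x0 \<in> space M" using not_empty X_space by blast
  have Fb: "bounded_measurable M (F t)" if t: "t \<ge> 1" for t
  proof (rule bounded_measurableI[OF F_measurable[OF t]])
    fix x assume "x \<in> space M"
    then have "norm (F t x - F t x0) \<le> DF"
      unfolding DF_def using norm_diff_le_Delta_F[OF Delta_F(2) t] x0 by blast
    then show "norm (F t x) \<le> norm (F t x0) + DF"
      using norm_triangle_sub[of "F t x" "F t x0"] by linarith
  qed
  have Fi: "integrable N (\<lambda>\<omega>. F t (X t \<omega>))" if "t \<ge> 1" for t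
    by (rule integrable_bounded_measurable[OF bounded_measurable_compose[OF Fb[OF that] X]])
  define Y where "Y t x = F t x - (\<integral>\<omega>. F t (X t \<omega>) \<partial>N)" for t x
  have Y_hermitian: "hermitian (Y t x)" if t: "t \<ge> 1" and x: "x \<in> space M" for t x
  proof -
    have "ctranspose (\<integral>\<omega>. F t (X t \<omega>) \<partial>N) = (\<integral>\<omega>. ctranspose (F t (X t \<omega>)) \<partial>N)"
      by (rule integral_bounded_linear[OF bounded_linear_ctranspose Fi[OF t], symmetric])
    also have "\<dots> = (\<integral>\<omega>. F t (X t \<omega>) \<partial>N)"
      using F_hermitian[OF t X_space] by (intro Bochner_Integration.integral_cong) (auto simp: hermitian_def)
    moreover have "ctranspose (V - W) = ctranspose V - ctranspose W" for V W :: "complex ^ 'm ^ 'm"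
      by (simp add: vec_eq_iff)
    ultimately show ?thesis
      using F_hermitian[OF t x] by (simp add: Y_def hermitian_def)
  qed
  have Y_bound: "norm (Y t x *v v) \<le> D * norm v" if t: "t \<ge> 1" and x: "x \<in> space M" for t x v
  proof -
    have lin: "bounded_linear (\<lambda>W :: complex ^ 'm ^ 'm. W *v v)"
      by (rule linear_conv_bounded_linear[THEN iffD1], rule linearI)
         (simp_all add: matrix_vector_mult_def vec_eq_iff scaleR_sum_right sum.distrib distrib_right)
    have i: "integrable N (\<lambda>\<omega>. F t x - F t (X t \<omega>))" using Fi[OF t] by simp
    have "Y t x = (\<integral>\<omega>. F t x - F t (X t \<omega>) \<partial>N)"
      using Fi[OF t] by (simp add: Y_def prob_space)
    then have "Y t x *v v = (\<integral>\<omega>. (F t x - F t (X t \<omega>)) *v v \<partial>N)"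
      using integral_bounded_linear[OF lin i] by simp
    also have "norm \<dots> \<le> (\<integral>\<omega>. norm ((F t x - F t (X t \<omega>)) *v v) \<partial>N)" by (rule integral_norm_bound)
    also have "\<dots> \<le> (\<integral>\<omega>. D * norm v \<partial>N)"
    proof (rule integral_mono)
      show "integrable N (\<lambda>\<omega>. norm ((F t x - F t (X t \<omega>)) *v v))"
        using integrable_bounded_linear[OF lin i] by simp
      fix \<omega> assume "\<omega> \<in> space N"
      then have "op_norm (F t x - F t (X t \<omega>)) \<le> D"
        unfolding D_def by (intro op_norm_diff_le_Delta_op[OF Delta_op(2) t x] X_space)
      then show "norm ((F t x - F t (X t \<omega>)) *v v) \<le> D * norm v"
        using norm_matrix_vector_le[of "F t x - F t (X t \<omega>)" v] mult_right_mono[of _ D "norm v"]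
        by (meson norm_ge_zero order_trans)
    qed simp
    finally show ?thesis by (simp add: prob_space)
  qed
  define E where "E = {\<omega> \<in> space N. lambda_max (\<Sum>j=1..n. Y j (X j \<omega>)) \<ge> real n * \<epsilon>}"
  have top: "\<exists>v. norm v = 1 \<and> (\<Sum>j=1..n. Y j (X j \<omega>)) *v v =
      complex_of_real (lambda_max (\<Sum>j=1..n. Y j (X j \<omega>))) *s v" if "\<omega> \<in> space N" for \<omega>
  proof -
    have "hermitian (\<Sum>j=1..n. Y j (X j \<omega>))"
      by (intro hermitian_sum Y_hermitian X_space that) auto
    then show ?thesis by (rule lambda_max_eigenvector) blast
  qed
  have m1: "1 \<le> real CARD('m)" by simp
  have tail: "measure N E \<le> CARD('m) * exp (- (real n * \<epsilon>\<^sup>2) / (2 * vB2))"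
  proof -
    \<comment> \<open>for \<open>\<epsilon> > D\<close> the event is empty; otherwise \<open>\<epsilon> / D \<le> 1\<close> keeps \<open>\<beta> L\<close> small\<close>
    consider "\<epsilon> = 0" | "\<epsilon> > D" | "0 < \<epsilon>" "\<epsilon> \<le> D" using eps by linarith
    then show ?thesis
    proof cases
      case 1
      then show ?thesis using order_trans[OF prob_le_1[of E] m1] by simp
    next
      case 2
      have "E = {}"
      proof (rule ccontr)
        assume "E \<noteq> {}"
        then obtain \<omega> where \<omega>: "\<omega> \<in> space N" "lambda_max (\<Sum>j=1..n. Y j (X j \<omega>)) \<ge> real n * \<epsilon>"
          unfolding E_def by blast
        obtain v where v: "norm v = 1" "(\<Sum>j=1..n. Y j (X j \<omega>)) *v v =
            complex_of_real (lambda_max (\<Sum>j=1..n. Y j (X j \<omega>))) *s v"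
          using top[OF \<omega>(1)] by blast
        have "\<bar>lambda_max (\<Sum>j=1..n. Y j (X j \<omega>))\<bar> = norm ((\<Sum>j=1..n. Y j (X j \<omega>)) *v v)"
          unfolding v(2) norm_scalar_mult_vec using v(1) by simp
        also have "(\<Sum>j=1..n. Y j (X j \<omega>)) *v v = (\<Sum>j=1..n. Y j (X j \<omega>) *v v)"
          by (induction n) (simp_all add: matrix_vector_mult_add_rdistrib)
        also have "norm \<dots> \<le> (\<Sum>j=1..n. D * norm v)"
          by (intro sum_norm_le Y_bound X_space \<omega>) auto
        finally have "real n * \<epsilon> \<le> real n * D" using \<omega>(2) v(1) by simp
        then show False using 2 n by simp
      qed
      then show ?thesis by simp
    next
      case 3
      \<comment> \<open>with \<open>\<beta> = \<theta> D / 2\<close> the exponent is \<open>4 \<theta>\<^sup>2 D\<^sup>2 L n - \<pi> \<theta> n \<epsilon> / 4\<close>, which is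
        minimal at this \<open>\<theta>\<close>\<close>
      define \<theta> where "\<theta> = pi * \<epsilon> / (32 * D\<^sup>2 * L)"
      define \<beta> where "\<beta> = \<theta> / 2 * D"
      have \<theta>: "\<theta> > 0" using 3 D L1 by (simp add: \<theta>_def)
      have \<beta>: "0 \<le> \<beta>" using \<theta> D by (simp add: \<beta>_def)
      have "\<beta> * L = pi / 64 * (\<epsilon> / D)" using D L1 by (simp add: \<beta>_def \<theta>_def power2_eq_square)
      also have "\<dots> \<le> (3.2 / 64) * 1"
        using 3 D pi_approx by (intro mult_mono) auto
      finally have \<beta>L: "\<beta> * L \<le> 1 / 20" by simp
      then have \<beta>1: "\<beta> \<le> 1" using mult_left_mono[OF L1 \<beta>] by simp
      have sc: "(c *\<^sub>R V) *v v = c *\<^sub>R (V *v v)" for c and V :: "complex ^ 'm ^ 'm" and v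
        by (simp add: matrix_vector_mult_def vec_eq_iff scaleR_sum_right)
      define A where "A t x = (\<theta> / 2) *\<^sub>R Y t x" for t x
      interpret cmc: centered_matrix_chain N M \<mu>0 P X A \<beta>
      proof
        show "markov_chain N M \<mu>0 P X" by (rule chain)
        show "A (Suc t) \<in> borel_measurable M" for t
          unfolding A_def Y_def using F_measurable[of "Suc t"] by simp
        show "hermitian (A (Suc t) x)" if "x \<in> space M" for t x
        proof -
          have "ctranspose (c *\<^sub>R V) = c *\<^sub>R ctranspose V" for c and V :: "complex ^ 'm ^ 'm"
            by (simp add: vec_eq_iff)
          then show ?thesis
            using Y_hermitian[OF _ that, of "Suc t"] by (simp add: A_def hermitian_def)
        qed
        show "norm (A (Suc t) x *v v) \<le> \<beta> * norm v" if "x \<in> space M" for t x v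
        proof -
          have "A (Suc t) x *v v = (\<theta> / 2) *\<^sub>R (Y (Suc t) x *v v)"
            unfolding A_def by (rule sc)
          then show ?thesis
            using Y_bound[OF _ that, of "Suc t" v] \<theta> by (simp add: \<beta>_def)
        qed
        show "(\<integral>\<omega>. A (Suc t) (X (Suc t) \<omega>) \<partial>N) = 0" for t
          using Fi[of "Suc t"] by (simp add: A_def Y_def prob_space)
      qed (rule \<beta> \<beta>1)+
      have L: "gap_sum (chain_sigma N M P X) t \<le> L" for t
      proof (cases "t = 0")
        case False
        then show ?thesis unfolding gap_sum_eq L_def using gap[of t] by simp
      qed (use L1 in simp)
      have "measure N E \<le> CARD('m) * exp (16 * \<beta>\<^sup>2 * L * n - pi / 2 * (\<theta> / 2 * (real n * \<epsilon>)))"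
      proof (rule cmc.eigenvalue_tail[OF L \<beta>L])
        show "E \<subseteq> space N" by (auto simp: E_def)
        fix \<omega> assume "\<omega> \<in> E"
        then have \<omega>: "\<omega> \<in> space N" "real n * \<epsilon> \<le> lambda_max (\<Sum>j=1..n. Y j (X j \<omega>))" by (auto simp: E_def)
        obtain v where v: "norm v = 1" "(\<Sum>j=1..n. Y j (X j \<omega>)) *v v =
            complex_of_real (lambda_max (\<Sum>j=1..n. Y j (X j \<omega>))) *s v"
          using top[OF \<omega>(1)] by blast
        have "(\<Sum>j=1..n. A j (X j \<omega>)) *v v = (\<theta> / 2) *\<^sub>R ((\<Sum>j=1..n. Y j (X j \<omega>)) *v v)"
          unfolding A_def scaleR_sum_right[symmetric] by (rule sc)
        also have "\<dots> = complex_of_real (\<theta> / 2 * lambda_max (\<Sum>j=1..n. Y j (X j \<omega>))) *s v"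
          unfolding v(2) of_real_scalar_mult_vec by simp
        finally show "\<exists>v r. norm v = 1 \<and> \<theta> / 2 * (real n * \<epsilon>) \<le> r \<and>
            (\<Sum>j=1..n. A j (X j \<omega>)) *v v = complex_of_real r *s v"
          using v(1) \<theta> \<omega>(2)
          by (intro exI[of _ v] exI[of _ "\<theta> / 2 * lambda_max (\<Sum>j=1..n. Y j (X j \<omega>))"] conjI mult_left_mono)
            simp_all
      qed
      also have "\<dots> \<le> CARD('m) * exp (- (real n * \<epsilon>\<^sup>2) / (2 * vB2))"
      proof -
        have "16 * \<beta>\<^sup>2 * L * n - pi / 2 * (\<theta> / 2 * (real n * \<epsilon>)) = - (pi\<^sup>2 * (real n * \<epsilon>\<^sup>2) * lam / (256 * (D * D)))"
          using D lam by (simp add: \<beta>_def \<theta>_def L_def power2_eq_square field_simps)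
        also have "\<dots> \<le> - (pi\<^sup>2 * (real n * \<epsilon>\<^sup>2) * lam / (1536 * (D * DF)))"
        proof -
          have "D * D \<le> D * DF" using DF D by (intro mult_left_mono) auto
          then have "256 * (D * D) \<le> 1536 * (D * DF)" using D by (smt (verit) mult_pos_pos)
          then show ?thesis using D DF lam by (intro le_imp_neg_le divide_left_mono) auto
        qed
        also have "\<dots> = - (real n * \<epsilon>\<^sup>2) / (2 * vB2)"
          using D DF lam by (simp add: vB2 D_def[symmetric] DF_def[symmetric] field_simps)
        finally show ?thesis by simp
      qed
      finally show ?thesis .
    qed
  qed
  also have "CARD('m) * exp (- (real n * \<epsilon>\<^sup>2) / (2 * vB2)) \<le>
      real CARD('m) powr (2 - pi / 4) * exp (- (real n * \<epsilon>\<^sup>2) / (2 * vB2))"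
  proof (rule mult_right_mono)
    have "real CARD('m) powr 1 \<le> real CARD('m) powr (2 - pi / 4)"
      using pi_less_4 m1 by (intro powr_mono) auto
    then show "real CARD('m) \<le> real CARD('m) powr (2 - pi / 4)" by simp
  qed simp
  finally show ?thesis by (simp add: E_def Y_def)
qed

end
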